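(* Let $q\ge2$ be an integer. Consider the open circular billiard with $q$ holes of the same length $\Delta$ with the centers placed at the vertices of a regular convex $q$-gon. Let $P_q(t,\Delta)$ denote the probability that the particle will not escape through this system of $q$ (different) holes till time $t$, and let $P_1^{(q)}(t,\Delta)$ denote the probability that the particle will not escape till time $t$ in the case when all these holes are placed on top of each other. Then, assuming that the Riemann hypothesis is correct, for any $\alpha>0$ $$\lim_{\Delta\to0}\lim_{t\to\infty}\Delta^{\alpha-\frac12}\,t\left[P_1^{(q)}(t,\Delta)-qP_q(t,\Delta)\right]=0.$$
   Context: Circular billiard: a point particle moves with unit speed in the unit disk $D$ with elastic reflections at $\partial D$. Boundary points are parametrized by the angle $\beta$ modulo $2\pi$. The phase space is $M=\{(\beta,\psi):-\pi<\beta\le\pi,\ -\frac\pi2\le\psi\le\frac\pi2\}$, where $\psi$ is the angle between the outgoing trajectory and the inner normal at $\beta$. The billiard map is $T(\beta,\psi)=(\beta+\pi-2\psi,\psi)$ (first coordinate mod $2\pi$). It preserves the probability measure $d\mu=\frac{\cos\psi}{4\pi}\,d\psi\,d\beta$ on $M$. Open billiard with a set of holes $H\subset\partial D$ (a finite union of arcs of length $\Delta$): write $T^n(\beta_0,\psi_0)=(\beta_n,\psi_0)$. Let $N(\beta_0,\psi_0)$ be the smallest integer $n\ge 0$ with $\beta_n\in H$, and $N=\infty$ if there is none. The escape time is $\tau(\beta_0,\psi_0)=2\cos\psi_0\,N(\beta_0,\psi_0)$, with $\tau=\infty$ if $N=\infty$. The probability of not escaping till time $t$ is $\mu(\{x\in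 M:\tau(x)>t\})$. $P_q(t,\Delta)$ is this probability when $H$ is the union of the $q$ arcs of length $\Delta$ whose centers are equally spaced at angle $2\pi/q$ around the circle; $P_1^{(q)}(t,\Delta)$ is this probability when $H$ is a single arc of length $\Delta$. *)

theory Defs
  imports "HOL-Complex_Analysis.Complex_Analysis"
begin

definition is_zeta_continuation :: "(complex \<Rightarrow> complex) \<Rightarrow> bool" where
  "is_zeta_continuation f \<longleftrightarrow>
     f holomorphic_on (- {1}) \<and>
     (\<forall>s. Re s > 1 \<longrightarrow> (\<lambda>n. 1 / of_nat (Suc n) powr s) sums f s)"

(* By the identity theorem the continuation is unique on - {1}; only the value
   at the pole 1 is left unspecified. *)
definition riemann_zeta :: "complex \<Rightarrow> complex" where
  "riemann_zeta = (SOME f. is_zeta_continuation f)"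

definition riemann_hypothesis :: bool where
  "riemann_hypothesis \<longleftrightarrow>
     (\<forall>s. riemann_zeta s = 0 \<and> 0 < Re s \<and> Re s < 1 \<longrightarrow> Re s = 1 / 2)"

definition phase_space :: "(real \<times> real) set" where
  "phase_space = {- pi<..pi} \<times> {- (pi / 2)..pi / 2}"

(* The representative of an angle modulo 2 pi in the interval (- pi, pi]. *)
definition wrap_angle :: "real \<Rightarrow> real" where
  "wrap_angle x = x - 2 * pi * of_int \<lceil>(x - pi) / (2 * pi)\<rceil>"

fun billiard_map :: "real \<times> real \<Rightarrow> real \<times> real" where
  "billiard_map (\<beta>, \<psi>) = (wrap_angle (\<beta> + pi - 2 * \<psi>), \<psi>)"

definition billiard_measure :: "(real \<times> real) measure" where
  "billiard_measure =
     density (restrict_space lborel phase_space) (\<lambda>(\<beta>, \<psi>). ennreal (cos \<psi> / (4 * pi)))"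

(* Sets of boundary points are represented by their angles in (- pi, pi]. *)
definition boundary_arc :: "real \<Rightarrow> real \<Rightarrow> real set" where
  "boundary_arc c \<Delta> =
     {\<beta>\<in>{- pi<..pi}. \<exists>k::int. \<bar>\<beta> - c - 2 * pi * of_int k\<bar> \<le> \<Delta> / 2}"

definition escape_count :: "real set \<Rightarrow> real \<times> real \<Rightarrow> enat" where
  "escape_count H x =
     (if \<exists>n. fst ((billiard_map ^^ n) x) \<in> H
      then enat (LEAST n. fst ((billiard_map ^^ n) x) \<in> H) else \<infinity>)"

definition escape_time :: "real set \<Rightarrow> real \<times> real \<Rightarrow> ereal" where
  "escape_time H x =
     (case escape_count H x of
        enat n \<Rightarrow> ereal (2 * cos (snd x) * real n)
      | \<infinity> \<Rightarrow> \<infinity>)"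

definition survival_prob :: "real set \<Rightarrow> real \<Rightarrow> real" where
  "survival_prob H t = measure billiard_measure {x\<in>phase_space. escape_time H x > ereal t}"

(* theta is the angle of one of the vertices of the regular q-gon. *)
definition polygon_holes :: "nat \<Rightarrow> real \<Rightarrow> real \<Rightarrow> real set" where
  "polygon_holes q \<theta> \<Delta> = (\<Union>k<q. boundary_arc (\<theta> + 2 * pi * real k / real q) \<Delta>)"

(* The lemmas from here to is_zeta_continuation_unique show that riemann_zeta is well defined. *)

lemma holomorphic_on_suminf:
  fixes f :: "nat \<Rightarrow> complex \<Rightarrow> complex"
  assumes S: "open S" and hol: "\<And>n. f n holomorphic_on S"
    and bnd: "\<And>K. compact K \<Longrightarrow> K \<subseteq> S \<Longrightarrow> \<exists>M. summable M \<and> (\<forall>n. \<forall>x\<in>K. norm (f n x) \<le> M n)"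
  shows "(\<lambda>x. \<Sum>n. f n x) holomorphic_on S"
proof (rule holomorphic_uniform_sequence[OF S, where f = "\<lambda>n x. \<Sum>i<n. f i x"])
  show "(\<lambda>x. \<Sum>i<n. f i x) holomorphic_on S" for n
    by (intro holomorphic_intros hol)
next
  fix x assume "x \<in> S"
  then obtain d where d: "d > 0" "cball x d \<subseteq> S"
    using S unfolding open_contains_cball by auto
  then obtain M where M: "summable M" "\<And>n y. y \<in> cball x d \<Longrightarrow> norm (f n y) \<le> M n"
    using bnd[OF compact_cball d(2)] by auto
  show "\<exists>d. 0 < d \<and> cball x d \<subseteq> S \<and>
          uniform_limit (cball x d) (\<lambda>n x. \<Sum>i<n. f i x) (\<lambda>x. \<Sum>n. f n x) sequentially"
    by (intro exI[of _ d] conjI d Weierstrass_m_test[OF M(2) M(1)])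
qed

definition zeta_series :: "complex \<Rightarrow> complex" where
  "zeta_series s = (\<Sum>n. of_nat (Suc n) powr (- s))"

lemma norm_nat_powr: "norm ((of_nat (Suc n) :: complex) powr s) = real (Suc n) powr Re s"
  by (subst norm_powr_real_powr) (auto simp del: of_nat_Suc)

lemma summable_Suc_powr: "a < -1 \<Longrightarrow> summable (\<lambda>n. real (Suc n) powr a)"
  by (subst summable_Suc_iff[of "\<lambda>n. real n powr a"]) (simp add: summable_real_powr_iff)

lemma zeta_series_sums:
  assumes "Re s > 1"
  shows "(\<lambda>n. of_nat (Suc n) powr (- s)) sums zeta_series s"
proof -
  have "summable (\<lambda>n. norm ((of_nat (Suc n) :: complex) powr (- s)))"
    unfolding norm_nat_powr using assms by (intro summable_Suc_powr) auto
  from summable_sums[OF summable_norm_cancel[OF this]] show ?thesis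
    unfolding zeta_series_def .
qed

lemma compact_Re_bound:
  assumes "compact K" "K \<subseteq> {s. Re s > a}"
  shows "\<exists>b>a. \<forall>s\<in>K. Re s \<ge> b"
proof (cases "K = {}")
  case True
  then show ?thesis by (auto intro: exI[of _ "a + 1"])
next
  case False
  have "continuous_on K Re" by (intro continuous_intros)
  then obtain s where "s \<in> K" "\<forall>t\<in>K. Re s \<le> Re t"
    using continuous_attains_inf[OF assms(1) False, of Re] by auto
  then show ?thesis using assms(2) by (intro exI[of _ "Re s"]) auto
qed

lemma zeta_series_holomorphic: "zeta_series holomorphic_on {s. Re s > 1}"
  unfolding zeta_series_def[abs_def]
proof (rule holomorphic_on_suminf)
  show "open {s. Re s > 1}" by (rule open_halfspace_Re_gt)
  show "(\<lambda>s. of_nat (Suc n) powr (- s)) holomorphic_on {s. 1 < Re s}" for n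
    by (intro holomorphic_intros)
  fix K assume "compact K" "K \<subseteq> {s. 1 < Re s}"
  then obtain b where b: "b > 1" "\<forall>s\<in>K. Re s \<ge> b"
    using compact_Re_bound by blast
  show "\<exists>M. summable M \<and> (\<forall>n. \<forall>x\<in>K. norm ((of_nat (Suc n) :: complex) powr - x) \<le> M n)"
    using b by (intro exI[of _ "\<lambda>n. real (Suc n) powr (- b)"] conjI summable_Suc_powr)
      (auto simp: norm_nat_powr simp del: of_nat_Suc intro!: powr_mono)
qed

definition zeta_falling :: "nat \<Rightarrow> complex \<Rightarrow> complex" where
  "zeta_falling i s = (\<Prod>k<i. 1 - s - of_nat k)"

(* Taylor remainder of x \<mapsto> x powr (1 - s) between n + 1 and n + 2; summing over n expresses
   (s - 1) * zeta_series s through values of the series further to the right. *)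
definition zeta_rem :: "nat \<Rightarrow> nat \<Rightarrow> complex \<Rightarrow> complex" where
  "zeta_rem K n s = of_nat (Suc (Suc n)) powr (1 - s) -
     (\<Sum>i\<le>K. zeta_falling i s * of_nat (Suc n) powr (1 - s - of_nat i) / fact i)"

lemma zeta_rem_bound:
  assumes "Re s + real K \<ge> 0"
  shows "norm (zeta_rem K n s) \<le> norm (zeta_falling (Suc K) s) * real (Suc n) powr (- (Re s + real K)) / fact K"
proof -
  define S where "S = closed_segment (of_nat (Suc n)) (of_nat (Suc (Suc n)) :: complex)"
  define f where "f = (\<lambda>i x. zeta_falling i s * x powr (1 - s - of_nat i))"
  have S: "\<exists>r. x = of_real r \<and> r \<ge> real (Suc n)" if x: "x \<in> S" for x
  proof -
    from x obtain u where u: "0 \<le> u" "u \<le> 1"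
      "x = (1 - u) *\<^sub>R of_nat (Suc n) + u *\<^sub>R of_nat (Suc (Suc n))"
      unfolding S_def closed_segment_def by auto
    then show ?thesis
      by (intro exI[of _ "real (Suc n) + u"]) (auto simp: algebra_simps scaleR_conv_of_real)
  qed
  have "norm (f 0 (of_nat (Suc (Suc n))) -
      (\<Sum>i\<le>K. f i (of_nat (Suc n)) * (of_nat (Suc (Suc n)) - of_nat (Suc n)) ^ i / fact i))
     \<le> (norm (zeta_falling (Suc K) s) * real (Suc n) powr (- (Re s + real K))) *
       norm (of_nat (Suc (Suc n)) - of_nat (Suc n) :: complex) ^ Suc K / fact K"
  proof (rule complex_Taylor[where S = S])
    show "convex S" by (simp add: S_def)
    show "of_nat (Suc n) \<in> S" "of_nat (Suc (Suc n)) \<in> S" by (auto simp: S_def)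
    show "(f i has_field_derivative f (Suc i) x) (at x within S)" if "x \<in> S" for i x
    proof -
      from S[OF that] have "x \<notin> \<real>\<^sub>\<le>\<^sub>0" by auto
      then show ?thesis unfolding f_def zeta_falling_def
        by (auto intro!: derivative_eq_intros simp: diff_diff_eq algebra_simps)
    qed
    show "norm (f (Suc K) x) \<le> norm (zeta_falling (Suc K) s) * real (Suc n) powr (- (Re s + real K))"
      if x: "x \<in> S" for x
    proof -
      obtain r where r: "x = of_real r" "r \<ge> real (Suc n)" using S[OF x] by blast
      have "norm (x powr (1 - s - of_nat (Suc K))) = r powr (- (Re s + real K))"
        using r by (subst norm_powr_real_powr) auto
      also have "\<dots> \<le> real (Suc n) powr (- (Re s + real K))"
        using r assms by (intro powr_mono2') auto
      finally show ?thesis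
        unfolding f_def by (simp add: norm_mult mult_left_mono del: of_nat_Suc)
    qed
  qed
  then show ?thesis by (simp add: f_def zeta_rem_def zeta_falling_def)
qed

lemma zeta_rem_suminf_holomorphic:
  "(\<lambda>s. \<Sum>n. zeta_rem K n s) holomorphic_on {s. Re s > 1 - real K}"
proof (rule holomorphic_on_suminf)
  show "open {s. Re s > 1 - real K}" by (rule open_halfspace_Re_gt)
  show "zeta_rem K n holomorphic_on {s. Re s > 1 - real K}" for n
    unfolding zeta_rem_def[abs_def] zeta_falling_def[abs_def]
    by (intro holomorphic_intros) auto
  fix C assume C: "compact C" "C \<subseteq> {s. Re s > 1 - real K}"
  then obtain b where b: "b > 1 - real K" "\<forall>s\<in>C. Re s \<ge> b"
    using compact_Re_bound by blast
  have "compact (zeta_falling (Suc K) ` C)"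
    unfolding zeta_falling_def[abs_def]
    by (intro compact_continuous_image continuous_intros C)
  then obtain B where B: "\<forall>s\<in>C. norm (zeta_falling (Suc K) s) \<le> B"
    using compact_imp_bounded[THEN bounded_iff[THEN iffD1]] by (metis image_eqI)
  show "\<exists>M. summable M \<and> (\<forall>n. \<forall>x\<in>C. norm (zeta_rem K n x) \<le> M n)"
  proof (intro exI[of _ "\<lambda>n. B / fact K * real (Suc n) powr (- (b + real K))"] conjI allI ballI)
    show "summable (\<lambda>n. B / fact K * real (Suc n) powr (- (b + real K)))"
      using b by (intro summable_mult summable_Suc_powr) auto
    fix n x assume x: "x \<in> C"
    have *: "Re x \<ge> b" using b x by auto
    have "norm (zeta_rem K n x) \<le> norm (zeta_falling (Suc K) x) * real (Suc n) powr (- (Re x + real K)) / fact K"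
      using * b by (intro zeta_rem_bound) auto
    also have "\<dots> \<le> B * real (Suc n) powr (- (b + real K)) / fact K"
      using B x * by (intro divide_right_mono mult_mono powr_mono) (auto intro: order_trans[OF norm_ge_zero])
    finally show "norm (zeta_rem K n x) \<le> B / fact K * real (Suc n) powr (- (b + real K))" by simp
  qed
qed

lemma zeta_rem_sums:
  assumes s: "Re s > 1"
  shows "(\<lambda>n. zeta_rem K n s) sums
    (-1 - (\<Sum>i\<in>{1..K}. zeta_falling i s * zeta_series (s + of_nat i - 1) / fact i))"
proof -
  have lim: "(\<lambda>n. (of_nat (Suc n) :: complex) powr (1 - s)) \<longlonglongrightarrow> 0"
  proof (rule tendsto_norm_zero_cancel)
    have "((\<lambda>x. x powr (1 - Re s)) \<longlongrightarrow> 0) at_top"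
      using s by (intro tendsto_neg_powr filterlim_ident) auto
    from filterlim_compose[OF this filterlim_compose[OF filterlim_real_sequentially filterlim_Suc]]
    show "(\<lambda>n. norm ((of_nat (Suc n) :: complex) powr (1 - s))) \<longlonglongrightarrow> 0"
      unfolding norm_nat_powr by simp
  qed
  have 1: "(\<lambda>n. of_nat (Suc (Suc n)) powr (1 - s) - of_nat (Suc n) powr (1 - s)) sums (0 - of_nat (Suc 0) powr (1 - s))"
    by (rule telescope_sums[OF lim])
  have 2: "(\<lambda>n. \<Sum>i\<in>{1..K}. zeta_falling i s / fact i * of_nat (Suc n) powr (- (s + of_nat i - 1))) sums
        (\<Sum>i\<in>{1..K}. zeta_falling i s / fact i * zeta_series (s + of_nat i - 1))"
    using s by (intro sums_sum sums_mult zeta_series_sums) auto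
  have 3: "{..K} = insert 0 {1..K}" by auto
  have 4: "zeta_rem K n s = of_nat (Suc (Suc n)) powr (1 - s) - of_nat (Suc n) powr (1 - s) -
     (\<Sum>i\<in>{1..K}. zeta_falling i s / fact i * of_nat (Suc n) powr (- (s + of_nat i - 1)))" for n
    unfolding zeta_rem_def 3 by (subst sum.insert) (auto simp: zeta_falling_def algebra_simps)
  show "(\<lambda>n. zeta_rem K n s) sums
    (-1 - (\<Sum>i\<in>{1..K}. zeta_falling i s * zeta_series (s + of_nat i - 1) / fact i))"
    unfolding 4 using sums_diff[OF 1 2] by simp
qed

lemma zeta_extend:
  "\<exists>g. g holomorphic_on {s. Re s > 1 - real k} \<and> (\<forall>s. Re s > 1 \<longrightarrow> g s = (s - 1) * zeta_series s)"
proof (induction k)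
  case 0
  show ?case
    by (intro exI[of _ "\<lambda>s. (s - 1) * zeta_series s"] conjI holomorphic_intros)
       (use zeta_series_holomorphic in auto)
next
  case (Suc k)
  then obtain g where g: "g holomorphic_on {s. Re s > 1 - real k}"
    "\<And>s. Re s > 1 \<Longrightarrow> g s = (s - 1) * zeta_series s" by blast
  define K where "K = Suc k"
  define h where "h = (\<lambda>s. 1 + (\<Sum>n. zeta_rem K n s) -
    (\<Sum>i\<in>{2..K}. zeta_falling (i - 1) s * g (s + of_nat i - 1) / fact i))"
  have "(\<lambda>s. g (s + of_nat i - 1)) holomorphic_on {s. Re s > 1 - real K}" if "i \<ge> 2" for i
    using that by (intro holomorphic_on_compose_gen[OF _ g(1), unfolded o_def] holomorphic_intros)
      (auto simp: K_def)
  then have "h holomorphic_on {s. Re s > 1 - real K}"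
    unfolding h_def zeta_falling_def
    by (intro holomorphic_intros zeta_rem_suminf_holomorphic) auto
  moreover have "h s = (s - 1) * zeta_series s" if s: "Re s > 1" for s
  proof -
    have "(\<Sum>n. zeta_rem K n s) = -1 - (\<Sum>i\<in>{1..K}. zeta_falling i s * zeta_series (s + of_nat i - 1) / fact i)"
      using zeta_rem_sums[OF s] sums_unique by metis
    also have "{1..K} = insert 1 {2..K}" by (auto simp: K_def)
    also have "(\<Sum>i\<in>\<dots>. zeta_falling i s * zeta_series (s + of_nat i - 1) / fact i) =
       (1 - s) * zeta_series s + (\<Sum>i\<in>{2..K}. zeta_falling i s * zeta_series (s + of_nat i - 1) / fact i)"
      by (subst sum.insert) (auto simp: zeta_falling_def)
    also have "(\<Sum>i\<in>{2..K}. zeta_falling i s * zeta_series (s + of_nat i - 1) / fact i) =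
        - (\<Sum>i\<in>{2..K}. zeta_falling (i - 1) s * g (s + of_nat i - 1) / fact i)"
      unfolding sum_negf[symmetric]
    proof (intro sum.cong refl)
      fix i assume i: "i \<in> {2..K}"
      then obtain j where j: "i = Suc j" "j \<ge> 1" by (cases i) auto
      have "g (s + of_nat i - 1) = (s + of_nat i - 1 - 1) * zeta_series (s + of_nat i - 1)"
        using s i by (intro g(2)) auto
      moreover have "zeta_falling i s = - (zeta_falling (i - 1) s * (s + of_nat i - 1 - 1))"
        by (simp add: j zeta_falling_def algebra_simps)
      ultimately show "zeta_falling i s * zeta_series (s + of_nat i - 1) / fact i =
           - (zeta_falling (i - 1) s * g (s + of_nat i - 1) / fact i)"
        by (simp add: mult.assoc)
    qed
    finally show ?thesis by (simp add: h_def algebra_simps)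
  qed
  ultimately show ?case unfolding K_def by blast
qed


lemma zeta_continuation_exists: "\<exists>f. is_zeta_continuation f"
proof -
  obtain g where g: "\<And>k. g k holomorphic_on {s. Re s > 1 - real k}"
    "\<And>k s. Re s > 1 \<Longrightarrow> g k s = (s - 1) * zeta_series s"
    using zeta_extend by metis
  have eq: "g j s = g k s" if "j \<le> k" "Re s > 1 - real j" for j k s
  proof (rule analytic_continuation_open[of "{s. Re s > 1}" "{s. Re s > 1 - real j}" "g j" "g k"])
    show "{s. Re s > 1} \<noteq> {}" by (auto intro: exI[of _ 2])
    show "g k holomorphic_on {s. Re s > 1 - real j}"
      using that by (intro holomorphic_on_subset[OF g(1)]) auto
    show "connected {s. Re s > 1 - real j}"
      by (intro convex_connected convex_halfspace_Re_gt)
  qed (use that g in \<open>auto simp: open_halfspace_Re_gt\<close>)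
  define F where "F = (\<lambda>s. g (nat \<lceil>2 + \<bar>Re s\<bar>\<rceil>) s)"
  have F: "F s = g k s" if "Re s > 1 - real k" for k s
  proof -
    have "Re s > 1 - real (nat \<lceil>2 + \<bar>Re s\<bar>\<rceil>)" by linarith
    then show ?thesis
      unfolding F_def using that eq by (metis nat_le_linear)
  qed
  have "F holomorphic_on (\<Union>k. {s. Re s > 1 - real k})"
  proof (rule holomorphic_on_UN_open)
    show "F holomorphic_on {s. Re s > 1 - real k}" for k
      using g(1)[of k] F[of k] by (subst holomorphic_cong[OF refl, of _ F "g k"]) auto
  qed (rule open_halfspace_Re_gt)
  also have "(\<Union>k. {s. Re s > 1 - real k}) = UNIV"
  proof -
    have "\<exists>k. Re s > 1 - real k" for s
      using reals_Archimedean2[of "1 - Re s"] by (auto simp: algebra_simps)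
    then show ?thesis by auto
  qed
  finally have "(\<lambda>s. F s / (s - 1)) holomorphic_on (- {1})"
    by (auto intro!: holomorphic_intros intro: holomorphic_on_subset)
  moreover have "(\<lambda>n. 1 / of_nat (Suc n) powr s) sums (F s / (s - 1))" if s: "Re s > 1" for s
  proof -
    have "F s = (s - 1) * zeta_series s" using F[of 0 s] g(2)[OF s] s by simp
    moreover have "s \<noteq> 1" using s by auto
    ultimately have "F s / (s - 1) = zeta_series s" by simp
    then show ?thesis
      using zeta_series_sums[OF s] by (simp add: powr_minus field_simps del: of_nat_Suc)
  qed
  ultimately show ?thesis unfolding is_zeta_continuation_def by blast
qed

lemma is_zeta_continuation_riemann_zeta: "is_zeta_continuation riemann_zeta"
  unfolding riemann_zeta_def by (rule someI_ex[OF zeta_continuation_exists])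

lemma is_zeta_continuation_unique:
  assumes "is_zeta_continuation f" "is_zeta_continuation g" "s \<noteq> 1"
  shows "f s = g s"
proof (rule analytic_continuation_open[of "{s. Re s > 1}" "- {1}" f g])
  show "{s. Re s > 1} \<noteq> {}" by (auto intro: exI[of _ 2])
  show "connected (- {1 :: complex})"
    by (rule connected_punctured_universe) simp
  show "f z = g z" if "z \<in> {s. Re s > 1}" for z
    using that assms sums_unique2 unfolding is_zeta_continuation_def by blast
qed (use assms in \<open>auto simp: open_halfspace_Re_gt is_zeta_continuation_def\<close>)

end

theory Submission
  imports Defs "HOL-Number_Theory.Prime_Powers" "HOL-Number_Theory.Cong"
begin

text \<open>
  The proof has a dynamical half, which computes the inner limit exactly, and an analytic half, which
  estimates it.

  Dynamics. Modulo \<open>2 \<pi> / q\<close> the \<open>q\<close> holes coincide, so with \<open>u = q (\<beta> - \<theta>) / (2 \<pi>)\<close> the billiard with \<open>q\<close>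
  holes is the rotation of the circle of length 1 by \<open>\<rho> = q (\<pi> - 2 \<psi>) / (2 \<pi>)\<close> with one hole of
  radius \<open>\<epsilon> = q \<Delta> / (4 \<pi>)\<close>. Write \<open>\<rho> = a / b + \<eta>\<close> with a reduced fraction. The \<open>b\<close> translates of the
  hole by multiples of \<open>1 / b\<close> leave gaps of length \<open>g = 1 / b - 2 \<epsilon>\<close>, and an orbit drifts through its
  gap at speed \<open>\<bar>\<eta>\<bar>\<close> per bounce. Hence the positions that survive \<open>T\<close> bounces have measure
  \<open>b max(0, g - T \<bar>\<eta>\<bar>)\<close>, up to a bounded change of \<open>T\<close> (\<open>rotation_survives\<close>, \<open>rotation_survives_imp\<close>).
  In time \<open>t\<close> there are \<open>t / (2 cos \<psi>)\<close> bounces. By Dirichlet's approximation theorem finitely many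
  fractions account for all angles, and integrating these tents over \<open>\<psi>\<close> yields
  \<open>t P_q(t, \<Delta>) \<longlonglongrightarrow> (\<pi> / 2) (\<Sum>b. c_q(b) max(0, 1 - b q \<Delta> / (2 \<pi>))^2)\<close>, where \<open>c_q(b)\<close> is a normalized
  sum of \<open>sin^2\<close> over the fractions with denominator \<open>b\<close> (\<open>survival_prob_asymptotics\<close>).

  Arithmetic. Summed over the divisors of \<open>b\<close>, the sine sums become sums over all residues, which are
  elementary. So \<open>c_q\<close> has the Dirichlet series \<open>(\<zeta>(s) - [q = 1]) / \<zeta>(s + 1)\<close>, and the combination
  \<open>P_1 - q P_q\<close> belongs to \<open>((1 - q^(1 - s)) \<zeta>(s) - 1) / \<zeta>(s + 1)\<close>. The factor \<open>1 - q^(1 - s)\<close> removes the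
  pole at 1; this is the reason for the weight \<open>q\<close>.

  Analysis. The weight \<open>max(0, 1 - b / Y)^2\<close> is the inverse Mellin transform of \<open>2 / (s (s + 1) (s + 2))\<close>,
  so the limit is a contour integral of \<open>Y^s\<close> against the series above with \<open>Y = 2 \<pi> / \<Delta>\<close>. The pole
  of the kernel at 0 is cancelled by \<open>1 / \<zeta>(s + 1)\<close>, and under the Riemann hypothesis nothing else
  obstructs moving the line to \<open>Re s = -1/2 + \<delta>\<close>. There \<open>(1 - q^(1 - s)) \<zeta>(s)\<close> is \<open>O(\<bar>s\<bar>^(3/2))\<close>
  (\<open>poleless_zeta_bound\<close>) and \<open>1 / \<zeta>(s + 1)\<close> is \<open>O(\<bar>s\<bar>^(1/4))\<close> by Littlewood's argument
  (\<open>zeta_scaled_inverse_bound\<close>), so that the integrand is \<open>O(\<bar>s\<bar>^(-5/4))\<close> and the integral converges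
  absolutely. The result is a bound \<open>O(\<Delta>^(1/2 - \<delta>))\<close> for every \<open>\<delta> > 0\<close>
  (\<open>hole_sum_difference_bound\<close>), which is what the theorem asks for.
\<close>

section \<open>Dirichlet series\<close>

lemma bij_betw_Suc_UNIV: "bij_betw Suc UNIV {1..}"
  by (rule bij_betwI[where g = "\<lambda>n. n - 1"]) auto

lemma has_sum_of_abs_summable_Suc:
  fixes f :: "nat \<Rightarrow> 'a :: banach"
  assumes "summable (\<lambda>n. norm (f (Suc n)))"
  shows "(f has_sum (\<Sum>n. f (Suc n))) {1..}"
proof -
  have "((\<lambda>n. f (Suc n)) has_sum (\<Sum>n. f (Suc n))) UNIV"
    by (rule norm_summable_imp_has_sum[OF assms summable_sums[OF summable_norm_cancel[OF assms]]])
  moreover note bij_betw_Suc_UNIV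
  ultimately show ?thesis
    using has_sum_reindex_bij_betw[of Suc UNIV "{1..}" f] by simp
qed

text \<open>Both series converge absolutely, so their product may be summed over all pairs \<open>(d, m)\<close>; grouping the
  pairs by the product \<open>n = d m\<close> gives the divisor sums. This is used for the von Mangoldt function
  and for the sine sums of the billiard.\<close>
lemma dirichlet_convolution_sums:
  fixes v :: "nat \<Rightarrow> complex" and s :: complex
  assumes s: "Re s > 1"
    and v: "summable (\<lambda>n. norm (v (Suc n) * of_nat (Suc n) powr (- s)))"
  shows "(\<lambda>n. (\<Sum>d | d dvd Suc n. v d) * of_nat (Suc n) powr (- s)) sums
           (zeta_series s * (\<Sum>n. v (Suc n) * of_nat (Suc n) powr (- s)))"
proof -
  define f where "f = (\<lambda>d. v d * of_nat d powr (- s))"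
  define g where "g = (\<lambda>m. of_nat m powr (- s) :: complex)"
  define F where "F = (\<Sum>n. f (Suc n))"
  have g: "summable (\<lambda>n. norm (g (Suc n)))"
    unfolding g_def norm_nat_powr using s by (intro summable_Suc_powr) auto
  have hf: "(f has_sum F) {1..}"
    unfolding F_def using v by (intro has_sum_of_abs_summable_Suc) (simp add: f_def)
  have hg: "(g has_sum zeta_series s) {1..}"
    unfolding zeta_series_def using has_sum_of_abs_summable_Suc[OF g] by (simp add: g_def)
  have af: "(\<lambda>d. norm (f d)) summable_on {1..}"
    using has_sum_of_abs_summable_Suc[of "\<lambda>d. norm (f d)"] v
    by (auto simp: f_def summable_on_def)
  have ag: "(\<lambda>d. norm (g d)) summable_on {1..}"
    using has_sum_of_abs_summable_Suc[of "\<lambda>d. norm (g d)"] g by (auto simp: summable_on_def)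
  have absprod: "(\<lambda>x. norm (case x of (d,m) \<Rightarrow> f d * g m)) summable_on ({1..} \<times> {1..})"
    unfolding Infinite_Sum.abs_summable_on_Sigma_iff
    using af ag by (auto simp: norm_mult infsum_cmult_right' abs_mult
        intro!: summable_on_cmult_right summable_on_cmult_left)
  have prod: "((\<lambda>(d,m). f d * g m) has_sum (F * zeta_series s)) ({1..} \<times> {1..})"
  proof (rule has_sum_SigmaI)
    show "((\<lambda>m. case (d, m) of (d, m) \<Rightarrow> f d * g m) has_sum f d * zeta_series s) {1..}" for d
      using has_sum_cmult_right[OF hg, of "f d"] by simp
    show "((\<lambda>d. f d * zeta_series s) has_sum F * zeta_series s) {1..}"
      by (rule has_sum_cmult_left[OF hf])
    show "(\<lambda>(d, m). f d * g m) summable_on {1..} \<times> {1..}"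
      using absprod by (rule abs_summable_summable)
  qed
  define B where "B = (\<lambda>n. {d. d dvd (n::nat)})"
  have bij: "bij_betw (\<lambda>(n,d). (d, n div d)) (Sigma {1..} B) ({1..} \<times> {1..})"
    by (rule bij_betwI[where g = "\<lambda>(d,m). (d * m, d)"])
       (auto simp: B_def intro: Suc_leI)
  have "((\<lambda>(n,d). f d * g (n div d)) has_sum (F * zeta_series s)) (Sigma {1..} B)"
    using has_sum_reindex_bij_betw[OF bij, of "\<lambda>(d,m). f d * g m"] prod
    by (simp add: case_prod_unfold)
  then have "((\<lambda>n. \<Sum>d\<in>B n. f d * g (n div d)) has_sum (F * zeta_series s)) {1..}"
    by (rule has_sum_SigmaD) (auto simp: B_def intro!: has_sum_finite)
  then have "((\<lambda>n. (\<Sum>d | d dvd n. v d) * of_nat n powr (- s)) has_sum (F * zeta_series s)) {1..}"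
  proof (rule has_sum_cong[THEN iffD1, rotated])
    fix n :: nat assume n: "n \<in> {1..}"
    have "f d * g (n div d) = v d * of_nat n powr (- s)" if "d dvd n" for d
    proof -
      obtain m where m: "n = d * m" using \<open>d dvd n\<close> by (rule dvdE)
      have "(of_nat (d * m) :: complex) powr (- s) = of_nat d powr (- s) * of_nat m powr (- s)"
        using powr_times_real[of "of_nat d" "of_nat m" "- s"] by simp
      with m n show ?thesis by (auto simp: f_def g_def)
    qed
    then show "(\<Sum>d\<in>B n. f d * g (n div d)) = (\<Sum>d | d dvd n. v d) * of_nat n powr (- s)"
      by (simp add: B_def sum_distrib_right)
  qed
  then have "((\<lambda>n. (\<Sum>d | d dvd Suc n. v d) * of_nat (Suc n) powr (- s)) has_sum (F * zeta_series s)) UNIV"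
    by (rule has_sum_reindex_bij_betw[OF bij_betw_Suc_UNIV, THEN iffD2])
  from has_sum_imp_sums[OF this] show ?thesis
    unfolding F_def f_def by (simp only: mult.commute)
qed

lemma dirichlet_series_derivative:
  fixes a :: "nat \<Rightarrow> complex" and s :: complex
  assumes a: "\<And>n. norm (a n) \<le> 1" and s: "Re s > 1"
  defines "f \<equiv> \<lambda>s. \<Sum>n. a (Suc n) * of_nat (Suc n) powr (- s)"
  shows "(\<lambda>n. a (Suc n) * of_nat (Suc n) powr (- s)) sums f s" (is ?A)
    and "(\<lambda>n. - (ln (real (Suc n)) * a (Suc n) * of_nat (Suc n) powr (- s))) sums deriv f s" (is ?B)
    and "(f has_field_derivative deriv f s) (at s)" (is ?C)
proof -
  define b where "b = (1 + Re s) / 2"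
  have b: "b > 1" "b < Re s" using s by (auto simp: b_def)
  define S where "S = {s. Re s > b}"
  define g where "g = (\<lambda>n s. a (Suc n) * of_nat (Suc n) powr (- s))"
  define g' where "g' = (\<lambda>n s. - (ln (real (Suc n)) * a (Suc n) * of_nat (Suc n) powr (- s)))"
  have "\<exists>h h'. \<forall>x\<in>S. ((\<lambda>n. g n x) sums h x) \<and> ((\<lambda>n. g' n x) sums h' x) \<and>
          (h has_field_derivative h' x) (at x)"
  proof (rule series_and_derivative_comparison[of S "\<lambda>n. real (Suc n) powr (- b)" g g'])
    show "open S" unfolding S_def by (rule open_halfspace_Re_gt)
    show "summable (\<lambda>n. real (Suc n) powr - b)" using b by (intro summable_Suc_powr) auto
    show "(g n has_field_derivative g' n x) (at x)" for n x
    proof -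
      have "((\<lambda>s. of_nat (Suc n) powr (- s)) has_field_derivative
          (Ln (of_nat (Suc n)) * of_nat (Suc n) powr (- x) * - 1)) (at x)"
        by (rule DERIV_chain2[OF has_field_derivative_powr_right])
          (auto intro!: derivative_eq_intros simp del: of_nat_Suc)
      from DERIV_cmult[OF this, of "a (Suc n)"] show ?thesis
        unfolding g_def g'_def by (simp add: Ln_of_nat mult_ac del: of_nat_Suc)
    qed
    show "\<forall>\<^sub>F n in sequentially. \<forall>x\<in>S. norm (g n x) \<le> real (Suc n) powr - b"
    proof (intro always_eventually allI ballI)
      fix n x assume x: "x \<in> S"
      have "norm (g n x) = norm (a (Suc n)) * real (Suc n) powr - Re x"
        by (simp add: g_def norm_mult norm_nat_powr del: of_nat_Suc)
      also have "\<dots> \<le> 1 * real (Suc n) powr - b"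
        using x a by (intro mult_mono powr_mono) (auto simp: S_def)
      finally show "norm (g n x) \<le> real (Suc n) powr - b" by simp
    qed
  qed blast
  then obtain h h' where h: "\<And>x. x \<in> S \<Longrightarrow> (\<lambda>n. g n x) sums h x"
    "\<And>x. x \<in> S \<Longrightarrow> (\<lambda>n. g' n x) sums h' x"
    "\<And>x. x \<in> S \<Longrightarrow> (h has_field_derivative h' x) (at x)" by blast
  have eq: "f x = h x" if "x \<in> S" for x
    using h(1)[OF that] by (simp add: f_def g_def sums_iff)
  have sS: "s \<in> S" using b by (simp add: S_def)
  have "(f has_field_derivative h' s) (at s)"
    using eq by (intro has_field_derivative_transform_within_open[OF h(3)[OF sS] _ sS])
       (auto simp: S_def open_halfspace_Re_gt)
  moreover from this have "deriv f s = h' s" by (rule DERIV_imp_deriv)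
  ultimately show ?A ?B ?C
    using h(1,2)[OF sS] eq[OF sS] by (auto simp: g_def g'_def)
qed

section \<open>The zeta function on and to the right of the line Re s = 1\<close>

lemma riemann_zeta_eq_series: "Re s > 1 \<Longrightarrow> riemann_zeta s = zeta_series s"
proof -
  assume s: "Re s > 1"
  have "(\<lambda>n. 1 / of_nat (Suc n) powr s) sums riemann_zeta s"
    using is_zeta_continuation_riemann_zeta s by (auto simp: is_zeta_continuation_def)
  moreover have "(\<lambda>n. 1 / of_nat (Suc n) powr s) sums zeta_series s"
    using zeta_series_sums[OF s] by (simp add: powr_minus field_simps del: of_nat_Suc)
  ultimately show ?thesis by (rule sums_unique2)
qed

lemma riemann_zeta_holomorphic: "riemann_zeta holomorphic_on (- {1})"
  using is_zeta_continuation_riemann_zeta by (simp add: is_zeta_continuation_def)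

text \<open>The function \<open>(s - 1) \<zeta>(s)\<close> to the right of the imaginary axis, in a form from which its value at the pole
  and a polynomial bound can be read off.\<close>
definition zeta_scaled :: "complex \<Rightarrow> complex" where
  "zeta_scaled s = 1 + (\<Sum>n. zeta_rem 1 n s)"

lemma zeta_scaled_holomorphic: "zeta_scaled holomorphic_on {s. Re s > 0}"
  unfolding zeta_scaled_def[abs_def]
  using zeta_rem_suminf_holomorphic[of 1] by (intro holomorphic_intros) simp

lemma zeta_scaled_eq:
  assumes "Re s > 0" "s \<noteq> 1"
  shows "zeta_scaled s = (s - 1) * riemann_zeta s"
proof (rule analytic_continuation_open[of "{s. Re s > 1}" "{s. Re s > 0} - {1}"
      zeta_scaled "\<lambda>s. (s - 1) * riemann_zeta s"])
  show "{s. Re s > 1} \<noteq> {}" by (auto intro: exI[of _ 2])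
  show "connected ({s. Re s > 0} - {1})"
    by (intro connected_open_delete convex_connected convex_halfspace_Re_gt open_halfspace_Re_gt) auto
  show "open ({s. Re s > 0} - {1})"
    by (intro open_Diff open_halfspace_Re_gt) auto
  show "zeta_scaled holomorphic_on {s. Re s > 0} - {1}"
    by (rule holomorphic_on_subset[OF zeta_scaled_holomorphic]) auto
  show "(\<lambda>s. (s - 1) * riemann_zeta s) holomorphic_on {s. Re s > 0} - {1}"
    by (intro holomorphic_intros holomorphic_on_subset[OF riemann_zeta_holomorphic]) auto
  show "zeta_scaled s = (s - 1) * riemann_zeta s" if "s \<in> {s. Re s > 1}" for s
  proof -
    have s: "Re s > 1" using that by simp
    have "(\<Sum>n. zeta_rem 1 n s) = -1 - (1 - s) * zeta_series s"
      using sums_unique[OF zeta_rem_sums[OF s, of 1]] by (simp add: zeta_falling_def)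
    then show ?thesis
      by (simp add: zeta_scaled_def riemann_zeta_eq_series[OF s] algebra_simps)
  qed
qed (use assms in \<open>auto simp: open_halfspace_Re_gt\<close>)

lemma zeta_scaled_1: "zeta_scaled 1 = 1"
proof -
  have "zeta_rem 1 n 1 = 0" for n
    by (simp add: zeta_rem_def zeta_falling_def del: of_nat_Suc)
  then show ?thesis by (simp add: zeta_scaled_def)
qed

lemma zeta_scaled_bound:
  assumes "b > 0"
  shows "\<exists>C>0. \<forall>s. Re s \<ge> b \<longrightarrow> norm (zeta_scaled s) \<le> C * (1 + norm s) ^ 2"
proof -
  define S where "S = (\<Sum>n. real (Suc n) powr (- (b + 1)))"
  have sm: "summable (\<lambda>n. real (Suc n) powr (- (b + 1)))"
    using assms by (intro summable_Suc_powr) auto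
  have S: "S \<ge> 0" unfolding S_def by (intro suminf_nonneg sm) auto
  show ?thesis
  proof (intro exI[of _ "1 + S"] conjI allI impI)
    show "1 + S > 0" using S by simp
    fix s assume s: "Re s \<ge> b"
    have n: "norm (zeta_rem 1 n s) \<le> (1 + norm s) ^ 2 * real (Suc n) powr (- (b + 1))" for n
    proof -
      have "norm (zeta_rem 1 n s) \<le> norm (zeta_falling 2 s) * real (Suc n) powr (- (Re s + 1))"
        using zeta_rem_bound[of s 1 n] s assms by (simp add: numeral_2_eq_2)
      also have "\<dots> \<le> (1 + norm s) ^ 2 * real (Suc n) powr (- (b + 1))"
      proof (intro mult_mono powr_mono)
        have "zeta_falling 2 s = (1 - s) * (- s)"
          by (simp add: zeta_falling_def numeral_2_eq_2 lessThan_Suc)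
        also have "norm \<dots> \<le> (1 + norm s) * (1 + norm s)"
          unfolding norm_mult by (intro mult_mono norm_triangle_le_diff) auto
        finally show "norm (zeta_falling 2 s) \<le> (1 + norm s) ^ 2" by (simp add: power2_eq_square)
      qed (use s in auto)
      finally show ?thesis .
    qed
    have sm2: "summable (\<lambda>n. norm (zeta_rem 1 n s))"
      by (rule summable_comparison_test'[OF summable_mult[OF sm, of "(1 + norm s) ^ 2"], of 0]) (use n in auto)
    have "norm (\<Sum>n. zeta_rem 1 n s) \<le> (\<Sum>n. norm (zeta_rem 1 n s))"
      by (rule summable_norm[OF sm2])
    also have "\<dots> \<le> (\<Sum>n. (1 + norm s) ^ 2 * real (Suc n) powr (- (b + 1)))"
      by (intro suminf_le n sm2 summable_mult sm)
    also have "\<dots> = (1 + norm s) ^ 2 * S" unfolding S_def by (rule suminf_mult[OF sm])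
    finally have *: "norm (\<Sum>n. zeta_rem 1 n s) \<le> (1 + norm s) ^ 2 * S" .
    have "norm (zeta_scaled s) \<le> 1 + (1 + norm s) ^ 2 * S"
      unfolding zeta_scaled_def using norm_triangle_ineq[of 1 "\<Sum>n. zeta_rem 1 n s"] * by simp
    moreover have "1 \<le> (1 + norm s) ^ 2" by simp
    ultimately show "norm (zeta_scaled s) \<le> (1 + S) * (1 + norm s) ^ 2"
      by (simp only: distrib_right mult_1 mult.commute[of S])
  qed
qed

text \<open>For \<open>n \<ge> 2\<close> the term \<open>n^(-4)\<close> is at most \<open>n^(-2) / 4\<close>, so the tail is at most \<open>(\<pi>^2 / 6 - 1) / 4\<close>.\<close>
lemma norm_riemann_zeta_minus_1:
  assumes "Re s \<ge> 4"
  shows "norm (riemann_zeta s - 1) \<le> 1 / 2"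
proof -
  have s1: "Re s > 1" using assms by simp
  have "(\<lambda>n. of_nat (Suc n) powr (- s)) sums riemann_zeta s"
    using zeta_series_sums[OF s1] by (simp add: riemann_zeta_eq_series[OF s1])
  then have Z: "(\<lambda>n. of_nat (Suc (Suc n)) powr (- s)) sums (riemann_zeta s - 1)"
    by (subst sums_Suc_iff) simp
  have sq: "(\<lambda>n. 1 / 4 * (1 / real (Suc (Suc n)) ^ 2)) sums (1 / 4 * (pi ^ 2 / 6 - 1))"
  proof (intro sums_mult)
    show "(\<lambda>n. 1 / real (Suc (Suc n)) ^ 2) sums (pi ^ 2 / 6 - 1)"
      using inverse_squares_sums by (subst sums_Suc_iff) simp
  qed
  have le: "norm ((of_nat (Suc (Suc n)) :: complex) powr (- s)) \<le> 1 / 4 * (1 / real (Suc (Suc n)) ^ 2)" for n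
  proof -
    have "norm ((of_nat (Suc (Suc n)) :: complex) powr (- s)) = real (Suc (Suc n)) powr (- Re s)"
      by (simp add: norm_nat_powr del: of_nat_Suc)
    also have "\<dots> \<le> real (Suc (Suc n)) powr (- 4)"
      using assms by (intro powr_mono) auto
    also have "\<dots> = 1 / real (Suc (Suc n)) ^ 2 * (1 / real (Suc (Suc n)) ^ 2)"
      by (simp add: powr_minus powr_numeral field_simps flip: power_add del: of_nat_Suc)
    also have "\<dots> \<le> 1 / 4 * (1 / real (Suc (Suc n)) ^ 2)"
    proof (intro mult_right_mono divide_left_mono)
      have "(2::real) ^ 2 \<le> real (Suc (Suc n)) ^ 2" by (intro power_mono) auto
      then show "4 \<le> real (Suc (Suc n)) ^ 2" by simp
    qed auto
    finally show ?thesis .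
  qed
  have "norm (riemann_zeta s - 1) \<le> 1 / 4 * (pi ^ 2 / 6 - 1)"
    using norm_suminf_le[OF le sums_summable[OF sq]] sums_unique[OF Z] sums_unique[OF sq] by simp
  moreover have "pi ^ 2 \<le> 4 ^ 2" using pi_less_4 by (intro power_mono) auto
  ultimately show ?thesis by simp
qed

text \<open>The Dirichlet series of \<open>log \<zeta>\<close>. Its coefficients \<open>\<Lambda>(n) / ln n\<close> are \<open>1 / k\<close> at a prime power \<open>p^k\<close>
  and 0 elsewhere (at \<open>n = 1\<close> because division by 0 gives 0).\<close>
definition log_zeta_series :: "complex \<Rightarrow> complex" where
  "log_zeta_series s = (\<Sum>n. of_real (mangoldt (Suc n) / ln (real (Suc n))) * of_nat (Suc n) powr (- s))"

lemma log_coeff_bounds: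
  "mangoldt n / ln (real n) \<ge> 0" "mangoldt n / ln (real n) \<le> (1::real)"
  "ln (real n) * (mangoldt n / ln (real n)) = (mangoldt n :: real)"
proof -
  show "mangoldt n / ln (real n) \<ge> 0"
    using mangoldt_nonneg[of n] by (cases "n = 0") auto
  show "mangoldt n / ln (real n) \<le> (1::real)"
    using mangoldt_le[of n] by (cases "n \<le> 1") (auto simp: le_Suc_eq)
  show "ln (real n) * (mangoldt n / ln (real n)) = (mangoldt n :: real)"
    by (cases "n \<le> 1") (auto simp: le_Suc_eq)
qed

lemma log_zeta_series_sums:
  assumes "Re s > 1"
  shows "(\<lambda>n. of_real (mangoldt (Suc n) / ln (real (Suc n))) * of_nat (Suc n) powr (- s)) sums log_zeta_series s"
  and "(\<lambda>n. - (of_real (mangoldt (Suc n)) * of_nat (Suc n) powr (- s))) sums deriv log_zeta_series s"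
  and "(log_zeta_series has_field_derivative deriv log_zeta_series s) (at s)"
proof -
  define a where "a = (\<lambda>n. of_real (mangoldt n / ln (real n)) :: complex)"
  have a: "norm (a n) \<le> 1" for n
    unfolding a_def norm_of_real using log_coeff_bounds[of n] by simp
  have eq: "of_real (ln (real n)) * a n = (mangoldt n :: complex)" for n
    unfolding a_def of_real_mult[symmetric] log_coeff_bounds by simp
  have f: "(\<lambda>s. \<Sum>n. a (Suc n) * of_nat (Suc n) powr (- s)) = log_zeta_series"
    unfolding log_zeta_series_def a_def by simp
  note * = dirichlet_series_derivative[of a, OF a assms, unfolded f eq]
  show "(\<lambda>n. of_real (mangoldt (Suc n) / ln (real (Suc n))) * of_nat (Suc n) powr (- s)) sums log_zeta_series s"
    using *(1) unfolding log_zeta_series_def a_def by simp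
  show "(\<lambda>n. - (of_real (mangoldt (Suc n)) * of_nat (Suc n) powr (- s))) sums deriv log_zeta_series s"
    using *(2) by simp
  show "(log_zeta_series has_field_derivative deriv log_zeta_series s) (at s)"
    by (rule *(3))
qed

text \<open>The divisor sums of \<open>\<Lambda>\<close> are \<open>ln n\<close>, so convolution gives \<open>-\<zeta>' = \<zeta> \<cdot> (\<Sum>n. \<Lambda>(n) n^(-s))\<close>, while termwise
  differentiation shows that the last factor is minus the derivative of the logarithmic series.\<close>
lemma zeta_series_log_derivative:
  assumes s: "Re s > 1"
  shows "(zeta_series has_field_derivative zeta_series s * deriv log_zeta_series s) (at s)"
proof -
  have "summable (\<lambda>n. norm (mangoldt (Suc n) * of_nat (Suc n) powr (- s) :: complex))"
  proof -
    have "(\<lambda>n. - (of_real (mangoldt (Suc n)) * of_nat (Suc n) powr (- of_real (Re s)))) sums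
        deriv log_zeta_series (of_real (Re s))"
      using s by (intro log_zeta_series_sums) simp
    from sums_summable[OF sums_minus[OF sums_Re[OF this]]]
    have "summable (\<lambda>n. Re (of_real (mangoldt (Suc n)) * of_nat (Suc n) powr (- of_real (Re s))))"
      by simp
    also have "(\<lambda>n. Re (of_real (mangoldt (Suc n)) * of_nat (Suc n) powr (- of_real (Re s)))) =
        (\<lambda>n. norm (mangoldt (Suc n) * of_nat (Suc n) powr (- s) :: complex))"
    proof
      fix n
      have "(of_nat (Suc n) :: complex) powr (- of_real (Re s)) = of_real (real (Suc n) powr (- Re s))"
        using powr_of_real[of "real (Suc n)" "- Re s"] by (simp del: of_nat_Suc)
      moreover have "norm (mangoldt (Suc n) :: complex) = mangoldt (Suc n)"
        by simp
      ultimately show "Re (of_real (mangoldt (Suc n)) * of_nat (Suc n) powr (- of_real (Re s))) =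
          norm (mangoldt (Suc n) * of_nat (Suc n) powr (- s) :: complex)"
        by (simp add: norm_mult norm_nat_powr del: of_nat_Suc of_real_mangoldt)
    qed
    finally show ?thesis .
  qed
  from dirichlet_convolution_sums[OF s this]
  have 1: "(\<lambda>n. of_real (ln (real (Suc n))) * of_nat (Suc n) powr (- s)) sums
      (zeta_series s * (\<Sum>n. mangoldt (Suc n) * of_nat (Suc n) powr (- s)))"
    by (simp add: mangoldt_sum del: of_nat_Suc)
  have 2: "(\<Sum>n. mangoldt (Suc n) * of_nat (Suc n) powr (- s)) = - deriv log_zeta_series s"
    using sums_unique[OF sums_minus[OF log_zeta_series_sums(2)[OF s]]] by simp
  have f: "(\<lambda>s. \<Sum>n. 1 * of_nat (Suc n) powr (- s)) = zeta_series"
    unfolding zeta_series_def by simp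
  have "norm (1 :: complex) \<le> 1" by simp
  note * = dirichlet_series_derivative[of "\<lambda>_. 1", OF this s, unfolded f]
  have "deriv zeta_series s = zeta_series s * deriv log_zeta_series s"
    by (rule sums_unique2[OF *(2)]) (use sums_minus[OF 1] 2 in \<open>simp del: of_nat_Suc\<close>)
  then show ?thesis using *(3) by simp
qed

text \<open>The quotient of \<open>\<zeta>\<close> and the exponential has derivative 0. The constant does
  not vanish because \<open>\<zeta>(4)\<close> is close to 1.\<close>
lemma zeta_series_eq_exp:
  "\<exists>c. c \<noteq> 0 \<and> (\<forall>s. Re s > 1 \<longrightarrow> zeta_series s = c * exp (log_zeta_series s))"
proof -
  define S where "S = {s. Re s > 1}"
  have "\<exists>c. \<forall>s\<in>S. zeta_series s * exp (- log_zeta_series s) = c"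
  proof (rule has_field_derivative_zero_constant)
    show "convex S" unfolding S_def by (rule convex_halfspace_Re_gt)
    fix s assume "s \<in> S"
    then have s: "Re s > 1" by (simp add: S_def)
    have "((\<lambda>s. zeta_series s * exp (- log_zeta_series s)) has_field_derivative 0) (at s)"
      by (auto intro!: derivative_eq_intros zeta_series_log_derivative[OF s] log_zeta_series_sums(3)[OF s]
          simp: algebra_simps)
    then show "((\<lambda>s. zeta_series s * exp (- log_zeta_series s)) has_field_derivative 0) (at s within S)"
      by (rule has_field_derivative_at_within)
  qed
  then obtain c where c: "\<And>s. Re s > 1 \<Longrightarrow> zeta_series s * exp (- log_zeta_series s) = c"
    by (auto simp: S_def)
  have "zeta_series 4 \<noteq> 0"
    using norm_riemann_zeta_minus_1[of 4] by (auto simp: riemann_zeta_eq_series)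
  then have "c \<noteq> 0" using c[of 4] by auto
  moreover have "zeta_series s = c * exp (log_zeta_series s)" if "Re s > 1" for s
    using c[OF that] by (simp add: exp_minus field_simps)
  ultimately show ?thesis by blast
qed

text \<open>Termwise this is \<open>3 + 4 cos x + cos (2 x) = 2 (1 + cos x)^2 \<ge> 0\<close> with \<open>x = t ln n\<close>.\<close>
lemma log_zeta_three_four_one:
  assumes "\<sigma> > 1"
  shows "0 \<le> 3 * Re (log_zeta_series (of_real \<sigma>)) + 4 * Re (log_zeta_series (Complex \<sigma> t))
          + Re (log_zeta_series (Complex \<sigma> (2 * t)))"
proof -
  define c where "c = (\<lambda>n. mangoldt (Suc n) / ln (real (Suc n)) * real (Suc n) powr (- \<sigma>))"
  define l where "l = (\<lambda>n. ln (real (Suc n)))"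
  have Re: "(\<lambda>n. c n * cos (u * l n)) sums Re (log_zeta_series (Complex \<sigma> u))" for u
  proof -
    have "(\<lambda>n. Re (of_real (mangoldt (Suc n) / ln (real (Suc n))) * of_nat (Suc n) powr (- Complex \<sigma> u)))
        sums Re (log_zeta_series (Complex \<sigma> u))"
      using assms by (intro sums_Re log_zeta_series_sums) simp
    moreover have "Re (of_real (mangoldt (Suc n) / ln (real (Suc n))) * of_nat (Suc n) powr (- Complex \<sigma> u)) =
        c n * cos (u * l n)" for n
    proof -
      have "Re ((of_nat (Suc n) :: complex) powr (- Complex \<sigma> u)) = real (Suc n) powr (- \<sigma>) * cos (u * l n)"
        by (simp add: powr_def Re_exp Ln_of_nat l_def del: of_nat_Suc)
      then show ?thesis unfolding c_def by simp
    qed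
    ultimately show ?thesis by simp
  qed
  have S: "(\<lambda>n. 3 * (c n * cos (0 * l n)) + 4 * (c n * cos (t * l n)) + c n * cos (2 * t * l n)) sums
     (3 * Re (log_zeta_series (Complex \<sigma> 0)) + 4 * Re (log_zeta_series (Complex \<sigma> t))
          + Re (log_zeta_series (Complex \<sigma> (2 * t))))"
    by (intro sums_add sums_mult Re)
  have nn: "3 * (c n * cos (0 * l n)) + 4 * (c n * cos (t * l n)) + c n * cos (2 * t * l n) \<ge> 0" for n
  proof -
    have eq: "cos (2 * t * l n) = 2 * cos (t * l n) ^ 2 - 1"
      using cos_double_cos[of "t * l n"] by (simp add: mult.assoc)
    have "3 * (c n * cos (0 * l n)) + 4 * (c n * cos (t * l n)) + c n * cos (2 * t * l n) =
        2 * c n * (1 + cos (t * l n)) ^ 2"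
      unfolding eq by (simp add: power2_eq_square algebra_simps)
    moreover have "c n \<ge> 0"
      unfolding c_def using log_coeff_bounds(1)[of "Suc n"] by (intro mult_nonneg_nonneg) auto
    ultimately show ?thesis by simp
  qed
  have "Complex \<sigma> 0 = of_real \<sigma>" by (simp add: complex_of_real_def)
  then show ?thesis using sums_le[OF nn sums_zero S] by simp
qed

lemma riemann_zeta_nonzero_Re_gt_1:
  assumes "Re s > 1" shows "riemann_zeta s \<noteq> 0"
  using zeta_series_eq_exp assms by (auto simp: riemann_zeta_eq_series)

text \<open>The classical argument of Hadamard and de la Vallee Poussin: by the inequality above,
  \<open>\<bar>\<zeta>(\<sigma>)\<bar>^3 \<bar>\<zeta>(\<sigma> + i t)\<bar>^4 \<bar>\<zeta>(\<sigma> + 2 i t)\<bar>\<close> is bounded below for \<open>\<sigma> > 1\<close>. If \<open>\<zeta>(1 + i t)\<close> were 0, then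
  as \<open>\<sigma> \<longlonglongrightarrow> 1\<close> the first factor would grow like \<open>(\<sigma> - 1)^(-3)\<close> and the second would be
  \<open>O((\<sigma> - 1)^4)\<close>, so the product would tend to 0.\<close>
lemma riemann_zeta_nonzero_Re_1:
  assumes t: "t \<noteq> 0"
  shows "riemann_zeta (Complex 1 t) \<noteq> 0"
proof
  assume zero: "riemann_zeta (Complex 1 t) = 0"
  obtain c where c: "c \<noteq> 0" "\<And>s. Re s > 1 \<Longrightarrow> zeta_series s = c * exp (log_zeta_series s)"
    using zeta_series_eq_exp by blast
  have ne: "Complex 1 u \<noteq> 1" if "u \<noteq> 0" for u using that by (auto simp: complex_eq_iff)
  have lim: "((\<lambda>\<sigma>. Complex \<sigma> u) \<longlongrightarrow> Complex 1 u) (at_right 1)" for u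
    by (intro tendsto_Complex tendsto_const) (simp add: tendsto_ident_at)
  have hd: "(riemann_zeta has_field_derivative deriv riemann_zeta (Complex 1 u)) (at (Complex 1 u))"
    if "u \<noteq> 0" for u
    using ne[OF that] by (intro holomorphic_derivI[OF riemann_zeta_holomorphic]) auto
  have A: "((\<lambda>\<sigma>. zeta_scaled (Complex \<sigma> 0)) \<longlongrightarrow> 1) (at_right 1)"
  proof -
    have one: "Complex 1 0 = 1" by (simp add: complex_eq_iff)
    have "isCont zeta_scaled (Complex 1 0)"
      using holomorphic_on_imp_continuous_on[OF zeta_scaled_holomorphic]
      by (auto simp: continuous_on_eq_continuous_at open_halfspace_Re_gt)
    from isCont_tendsto_compose[OF this lim[of 0]] show ?thesis
      unfolding one zeta_scaled_1 .
  qed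
  have B: "((\<lambda>\<sigma>. riemann_zeta (Complex \<sigma> t) / of_real (\<sigma> - 1)) \<longlongrightarrow> deriv riemann_zeta (Complex 1 t)) (at_right 1)"
  proof -
    have "((\<lambda>z. (riemann_zeta z - riemann_zeta (Complex 1 t)) / (z - Complex 1 t)) \<longlongrightarrow>
        deriv riemann_zeta (Complex 1 t)) (at (Complex 1 t))"
      using hd[OF t] by (simp add: has_field_derivative_iff)
    moreover have "filterlim (\<lambda>\<sigma>. Complex \<sigma> t) (at (Complex 1 t)) (at_right 1)"
      using lim[of t] by (auto simp: filterlim_at eventually_at_filter)
    ultimately have "((\<lambda>\<sigma>. (riemann_zeta (Complex \<sigma> t) - riemann_zeta (Complex 1 t)) / (Complex \<sigma> t - Complex 1 t)) \<longlongrightarrow>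
        deriv riemann_zeta (Complex 1 t)) (at_right 1)"
      by (rule filterlim_compose)
    moreover have "Complex \<sigma> t - Complex 1 t = of_real (\<sigma> - 1)" for \<sigma>
      by (simp add: complex_eq_iff)
    ultimately show ?thesis by (simp add: zero)
  qed
  have C: "((\<lambda>\<sigma>. riemann_zeta (Complex \<sigma> (2 * t))) \<longlongrightarrow> riemann_zeta (Complex 1 (2 * t))) (at_right 1)"
  proof -
    have "isCont riemann_zeta (Complex 1 (2 * t))"
      using hd[of "2 * t"] t by (intro DERIV_isCont) auto
    then show ?thesis using lim[of "2 * t"] by (rule isCont_tendsto_compose)
  qed
  have "((\<lambda>\<sigma>. norm (zeta_scaled (Complex \<sigma> 0)) ^ 3 * norm (riemann_zeta (Complex \<sigma> t) / of_real (\<sigma> - 1)) ^ 4 *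
      norm (riemann_zeta (Complex \<sigma> (2 * t))) * (\<sigma> - 1)) \<longlongrightarrow>
      norm (1::complex) ^ 3 * norm (deriv riemann_zeta (Complex 1 t)) ^ 4 *
      norm (riemann_zeta (Complex 1 (2 * t))) * (1 - 1)) (at_right 1)"
    by (intro tendsto_intros A B C) 
  then have "((\<lambda>\<sigma>. norm (zeta_scaled (Complex \<sigma> 0)) ^ 3 * norm (riemann_zeta (Complex \<sigma> t) / of_real (\<sigma> - 1)) ^ 4 *
      norm (riemann_zeta (Complex \<sigma> (2 * t))) * (\<sigma> - 1)) \<longlongrightarrow> 0) (at_right 1)" by simp
  moreover have "norm c ^ 8 \<le> norm (zeta_scaled (Complex \<sigma> 0)) ^ 3 * norm (riemann_zeta (Complex \<sigma> t) / of_real (\<sigma> - 1)) ^ 4 *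
      norm (riemann_zeta (Complex \<sigma> (2 * t))) * (\<sigma> - 1)" if \<sigma>: "\<sigma> > 1" for \<sigma>
  proof -
    have z: "norm (riemann_zeta (Complex \<sigma> u)) = norm c * exp (Re (log_zeta_series (Complex \<sigma> u)))" for u
      using \<sigma> by (simp add: riemann_zeta_eq_series c(2) norm_mult)
    define x where "x = \<sigma> - 1"
    have x: "x > 0" using \<sigma> by (simp add: x_def)
    have sc: "norm (zeta_scaled (Complex \<sigma> 0)) = x * norm (riemann_zeta (Complex \<sigma> 0))"
    proof -
      have "zeta_scaled (Complex \<sigma> 0) = (Complex \<sigma> 0 - 1) * riemann_zeta (Complex \<sigma> 0)"
        using \<sigma> by (intro zeta_scaled_eq) (auto simp: complex_eq_iff)
      also have "Complex \<sigma> 0 - 1 = of_real x" by (simp add: x_def complex_eq_iff)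
      finally show ?thesis using x by (simp add: norm_mult)
    qed
    define e0 e1 e2 where "e0 = Re (log_zeta_series (Complex \<sigma> 0))"
      and "e1 = Re (log_zeta_series (Complex \<sigma> t))" and "e2 = Re (log_zeta_series (Complex \<sigma> (2 * t)))"
    have "Complex \<sigma> 0 = of_real \<sigma>" by (simp add: complex_of_real_def)
    then have nn: "3 * e0 + 4 * e1 + e2 \<ge> 0"
      using log_zeta_three_four_one[OF \<sigma>, of t] by (simp add: e0_def e1_def e2_def)
    have "norm c ^ 8 * 1 \<le> norm c ^ 8 * exp (3 * e0 + 4 * e1 + e2)"
      using nn by (intro mult_left_mono) auto
    also have "exp (3 * e0 + 4 * e1 + e2) = exp e0 ^ 3 * exp e1 ^ 4 * exp e2"
      by (simp add: exp_add flip: exp_of_nat_mult)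
    also have "norm c ^ 8 * (exp e0 ^ 3 * exp e1 ^ 4 * exp e2) =
       (x * (norm c * exp e0)) ^ 3 * (norm c * exp e1 / x) ^ 4 * (norm c * exp e2) * x"
      using x by (simp add: field_simps eval_nat_numeral)
    also have "\<dots> = norm (zeta_scaled (Complex \<sigma> 0)) ^ 3 * norm (riemann_zeta (Complex \<sigma> t) / of_real (\<sigma> - 1)) ^ 4 *
      norm (riemann_zeta (Complex \<sigma> (2 * t))) * (\<sigma> - 1)"
      unfolding sc norm_divide z e0_def e1_def e2_def norm_of_real using x \<sigma> by (simp add: x_def)
    finally show ?thesis by simp
  qed
  ultimately have "norm c ^ 8 \<le> 0"
    by (intro tendsto_lowerbound[of _ _ "at_right (1::real)"])
       (auto simp: eventually_at_filter intro!: always_eventually)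
  with c(1) show False by simp
qed

section \<open>The reciprocal of the zeta function under the Riemann hypothesis\<close>

text \<open>Borel--Caratheodory. The Moebius map \<open>w \<mapsto> w / (2 M - w)\<close> takes the half plane \<open>Re w < M\<close> into
  the unit disc and fixes 0, so that Schwarz's lemma applies to its composition with \<open>f - f(c)\<close>.\<close>
lemma borel_caratheodory:
  fixes f :: "complex \<Rightarrow> complex"
  assumes hol: "f holomorphic_on ball c R" and R: "R > 0"
    and M: "\<And>z. z \<in> ball c R \<Longrightarrow> Re (f z - f c) < M"
    and \<rho>: "0 \<le> \<rho>" "\<rho> < 1" and z: "norm (z - c) \<le> \<rho> * R"
  shows "norm (f z - f c) \<le> 2 * M * \<rho> / (1 - \<rho>)"
proof -
  define g where "g = (\<lambda>w. f (c + of_real R * w) - f c)"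
  define h where "h = (\<lambda>w. g w / (of_real (2 * M) - g w))"
  have M0: "M > 0" using M[of c] R by simp
  have inb: "c + of_real R * w \<in> ball c R" if "norm w < 1" for w
    using that R by (simp add: dist_norm norm_mult)
  have Reg: "Re (g w) < M" if "norm w < 1" for w
    using M[OF inb[OF that]] by (simp add: g_def)
  have ne: "of_real (2 * M) - g w \<noteq> 0" if "norm w < 1" for w
  proof
    assume "of_real (2 * M) - g w = 0"
    then have "Re (g w) = 2 * M" by (metis Re_complex_of_real eq_iff_diff_eq_0)
    with Reg[OF that] M0 show False by simp
  qed
  have "g holomorphic_on ball 0 1"
    unfolding g_def using inb
    by (intro holomorphic_intros holomorphic_on_compose_gen[OF _ hol, unfolded o_def]) auto
  then have hh: "h holomorphic_on ball 0 1"
    unfolding h_def using ne by (intro holomorphic_intros) auto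
  have h1: "norm (h w) < 1" if w: "norm w < 1" for w
  proof -
    have "norm (g w) ^ 2 < norm (of_real (2 * M) - g w) ^ 2"
    proof -
      have "norm (of_real (2 * M) - g w) ^ 2 - norm (g w) ^ 2 = 4 * M * (M - Re (g w))"
        unfolding cmod_power2 by (simp add: power2_eq_square algebra_simps)
      also have "\<dots> > 0" using M0 Reg[OF w] by simp
      finally show ?thesis by simp
    qed
    then have "norm (g w) < norm (of_real (2 * M) - g w)"
      by (rule power_less_imp_less_base) simp
    then show ?thesis unfolding h_def norm_divide using ne[OF w] by simp
  qed
  define w where "w = (z - c) / of_real R"
  have w: "norm w \<le> \<rho>" using z R by (simp add: w_def norm_divide field_simps)
  have w1: "norm w < 1" using w \<rho> by simp
  have "h 0 = 0" by (simp add: h_def g_def)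
  then have "norm (h w) \<le> norm w"
    using Schwarz_Lemma(1)[OF hh _ h1 w1] by blast
  then have "norm (g w) \<le> norm w * norm (of_real (2 * M) - g w)"
    using ne[OF w1] unfolding h_def norm_divide by (simp add: field_simps)
  also have "\<dots> \<le> \<rho> * (2 * M + norm (g w))"
    using norm_triangle_ineq4[of "of_real (2 * M)" "g w"] M0 \<rho> w by (intro mult_mono) auto
  finally have "norm (g w) \<le> 2 * M * \<rho> / (1 - \<rho>)"
    using \<rho> by (simp add: field_simps)
  moreover have "g w = f z - f c" using R by (simp add: g_def w_def)
  ultimately show ?thesis by simp
qed

text \<open>The situation of \<open>\<zeta>\<close> in the upper half plane under the Riemann hypothesis: a function with a
  holomorphic logarithm \<open>l\<close> to the right of \<open>Re s = 1/2\<close>, of polynomial growth, whose logarithm is bounded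
  far to the right. It is stated for a general \<open>f\<close> so that the lower half plane can be treated by applying it
  to \<open>cnj (\<zeta> (cnj s))\<close>.\<close>
locale nonvanishing_quadrant =
  fixes f l :: "complex \<Rightarrow> complex" and K C0 :: real
  assumes l_hol: "l holomorphic_on {s. Re s > 1 / 2 \<and> Im s > 0}"
    and f_eq: "\<And>s. Re s > 1 / 2 \<Longrightarrow> Im s > 0 \<Longrightarrow> f s = exp (l s)"
    and f_bound: "\<And>s. Re s > 1 / 2 \<Longrightarrow> Im s \<ge> 1 \<Longrightarrow> norm (f s) \<le> K * (1 + norm s) ^ 2"
    and l_bound: "\<And>s. Re s \<ge> 5 \<Longrightarrow> Im s > 0 \<Longrightarrow> norm (l s) \<le> C0"
    and K1: "K \<ge> 1" and C0: "C0 \<ge> 0"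
begin

text \<open>Polynomial growth bounds \<open>Re l = ln \<bar>f\<bar>\<close> from above by a multiple of \<open>ln \<tau>\<close>. Borel--Caratheodory on a disc around
  \<open>5 + i \<tau>\<close> that reaches to \<open>Re s = 1/2 + \<delta>/2\<close> turns this into a bound for \<open>\<bar>l\<bar>\<close>.\<close>
lemma log_le_ln:
  assumes \<delta>: "0 < \<delta>" "\<delta> < 1"
  shows "\<exists>C>0. \<forall>s. 1 / 2 + \<delta> \<le> Re s \<and> Re s \<le> 5 \<and> Im s \<ge> 6 \<longrightarrow> norm (l s) \<le> C * ln (Im s)"
proof -
  define R \<rho> where "R = 9 / 2 - \<delta> / 2" and "\<rho> = (9 / 2 - \<delta>) / (9 / 2 - \<delta> / 2)"
  have R: "R > 0" using \<delta> by (simp add: R_def)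
  have \<rho>: "0 \<le> \<rho>" "\<rho> < 1" using \<delta> by (auto simp: \<rho>_def field_simps)
  (* On the disc norm f is at most K * (3 * \<tau>)^2, and Re l is at least - C0 at its centre. *)
  define A where "A = ln K + 2 * ln 3 + C0 + 3"
  have A: "A > 0" using K1 C0 by (auto simp: A_def intro!: add_nonneg_pos add_nonneg_nonneg)
  show ?thesis
  proof (intro exI[of _ "C0 + 2 * A * \<rho> / (1 - \<rho>) + 1"] conjI allI impI)
    show "C0 + 2 * A * \<rho> / (1 - \<rho>) + 1 > 0"
      using C0 A \<rho> by (intro add_nonneg_pos add_nonneg_nonneg) auto
    fix s assume s: "1 / 2 + \<delta> \<le> Re s \<and> Re s \<le> 5 \<and> Im s \<ge> 6"
    define \<tau> where "\<tau> = Im s"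
    have \<tau>: "\<tau> \<ge> 6" using s by (simp add: \<tau>_def)
    have ln\<tau>: "ln \<tau> \<ge> 1"
    proof -
      have "exp 1 \<le> \<tau>" using exp_le \<tau> by linarith
      then show ?thesis using \<tau> by (simp add: ln_ge_iff)
    qed
    define c where "c = Complex 5 \<tau>"
    have ball: "Re z > 1 / 2" "Im z \<ge> 1" "norm z \<le> \<tau> + 19 / 2" if z: "z \<in> ball c R" for z
    proof -
      have d: "norm (z - c) < 9 / 2 - \<delta> / 2" using z by (simp add: R_def dist_norm norm_minus_commute)
      have "\<bar>Re z - 5\<bar> < 9 / 2 - \<delta> / 2" "\<bar>Im z - \<tau>\<bar> < 9 / 2 - \<delta> / 2"
        using abs_Re_le_cmod[of "z - c"] abs_Im_le_cmod[of "z - c"] d by (auto simp: c_def)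
      then show "Re z > 1 / 2" "Im z \<ge> 1" using \<delta> \<tau> by (auto simp: abs_less_iff)
      have "norm c \<le> 5 + \<tau>" using cmod_le[of c] \<tau> by (simp add: c_def)
      then show "norm z \<le> \<tau> + 19 / 2"
        using norm_triangle_ineq[of "z - c" c] d \<delta> by simp
    qed
    define M where "M = A * ln \<tau>"
    have "norm (l s - l c) \<le> 2 * M * \<rho> / (1 - \<rho>)"
    proof (rule borel_caratheodory[of l c R M \<rho> s, OF _ R])
      show "l holomorphic_on ball c R"
        using ball(1,2) by (intro holomorphic_on_subset[OF l_hol]) force
      show "norm (s - c) \<le> \<rho> * R"
      proof -
        have "s - c = of_real (Re s - 5)" by (simp add: complex_eq_iff c_def \<tau>_def)
        then have "norm (s - c) = \<bar>Re s - 5\<bar>" by (simp only: norm_of_real)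
        also have "\<dots> \<le> 9 / 2 - \<delta>" using s by auto
        also have "\<dots> = \<rho> * R" using \<delta> by (simp add: \<rho>_def R_def)
        finally show ?thesis .
      qed
      fix z assume z: "z \<in> ball c R"
      have im: "Im z > 0" using ball(2)[OF z] by linarith
      have "exp (Re (l z)) = norm (f z)" using f_eq[OF ball(1)[OF z] im] by simp
      also have "\<dots> \<le> K * (1 + norm z) ^ 2" using f_bound[OF ball(1)[OF z] ball(2)[OF z]] .
      also have "\<dots> \<le> K * (3 * \<tau>) ^ 2"
        using ball(3)[OF z] \<tau> K1 by (intro mult_left_mono power_mono) auto
      also have "\<dots> = exp (ln K + 2 * (ln 3 + ln \<tau>))"
        using K1 \<tau> by (simp add: exp_add exp_double power_mult_distrib)
      finally have "Re (l z) \<le> ln K + 2 * (ln 3 + ln \<tau>)" by simp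
      moreover have "Re (l c) \<ge> - C0"
        using l_bound[of c] \<tau> abs_Re_le_cmod[of "l c"] by (simp add: c_def)
      moreover have "ln K + 2 * (ln 3 + ln \<tau>) + C0 < M"
      proof -
        have "(ln K + 2 * ln 3 + C0) * 1 \<le> (ln K + 2 * ln 3 + C0) * ln \<tau>"
          using K1 C0 ln\<tau> by (intro mult_left_mono add_nonneg_nonneg) auto
        then show ?thesis using ln\<tau> by (simp add: M_def A_def algebra_simps)
      qed
      ultimately show "Re (l z - l c) < M" by simp
    qed (use \<rho> in auto)
    also have "2 * M * \<rho> / (1 - \<rho>) = 2 * A * \<rho> / (1 - \<rho>) * ln \<tau>" by (simp add: M_def)
    finally have "norm (l s - l c) \<le> 2 * A * \<rho> / (1 - \<rho>) * ln \<tau>" .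
    moreover have "norm (l c) \<le> C0 * ln \<tau>"
    proof -
      have "norm (l c) \<le> C0 * 1" using l_bound[of c] \<tau> by (simp add: c_def)
      also have "\<dots> \<le> C0 * ln \<tau>" using C0 ln\<tau> by (intro mult_left_mono) auto
      finally show ?thesis .
    qed
    moreover have "norm (l s) \<le> norm (l s - l c) + norm (l c)"
      using norm_triangle_ineq[of "l s - l c" "l c"] by simp
    ultimately have "norm (l s) \<le> (C0 + 2 * A * \<rho> / (1 - \<rho>)) * ln \<tau>"
      by (simp add: distrib_right)
    then show "norm (l s) \<le> (C0 + 2 * A * \<rho> / (1 - \<rho>) + 1) * ln (Im s)"
      using ln\<tau> by (simp add: \<tau>_def distrib_right)
  qed
qed

text \<open>Littlewood's step. The logarithm is bounded on \<open>Re s = 5\<close> and \<open>O(L)\<close>, with \<open>L = ln t\<close>, on the line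
  \<open>Re s = 1/2 + \<delta>\<close>. Interpolating between the two lines as in the three lines theorem gives the exponent
  \<open>\<eta> < 1\<close> strictly between them. This gain over \<open>O(ln t)\<close> is essential: a bound \<open>C ln t\<close> for the
  logarithm would only give \<open>t^C\<close>, with an uncontrolled exponent, for the reciprocal of \<open>f\<close>.\<close>
lemma log_sublinear:
  assumes \<delta>: "0 < \<delta>" "\<delta> < 1"
  shows "\<exists>B>0. \<exists>\<eta><1. \<eta> > 0 \<and> (\<forall>s. 1 / 2 + 2 * \<delta> \<le> Re s \<and> Re s \<le> 5 \<and> Im s \<ge> 12 \<longrightarrow>
           norm (l s) \<le> B * ln (Im s) powr \<eta>)"
proof -
  obtain C1 where C1: "C1 > 0"
    "\<And>s. 1 / 2 + \<delta> \<le> Re s \<Longrightarrow> Re s \<le> 5 \<Longrightarrow> Im s \<ge> 6 \<Longrightarrow> norm (l s) \<le> C1 * ln (Im s)"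
    using log_le_ln[OF \<delta>] by blast
  define \<eta> where "\<eta> = (9 / 2 - 2 * \<delta>) / (9 / 2 - \<delta>)"
  have \<eta>: "0 < \<eta>" "\<eta> < 1" using \<delta> by (auto simp: \<eta>_def field_simps)
  define B where "B = (2 * C1 + C0) * exp 25"
  have B: "B > 0" using C1 C0 by (simp add: B_def)
  have "norm (l s) \<le> B * ln (Im s) powr \<eta>"
    if s: "1 / 2 + 2 * \<delta> \<le> Re s \<and> Re s \<le> 5 \<and> Im s \<ge> 12" for s
  proof -
    define t where "t = Im s"
    have t: "t \<ge> 12" using s by (simp add: t_def)
    define L where "L = ln t"
    have L: "L \<ge> 1"
    proof -
      have "exp 1 \<le> t" using exp_le t by linarith
      then show ?thesis using t by (simp add: ln_ge_iff L_def)
    qed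
    (* The width of the strip is 9/2 - \<delta>, so that L powr (\<kappa> * (Re z - 5)) interpolates
       between 1 / L and 1. *)
    define \<kappa> where "\<kappa> = 1 / (9 / 2 - \<delta>)"
    have \<kappa>: "\<kappa> > 0" "\<kappa> * (9 / 2 - \<delta>) = 1" using \<delta> by (auto simp: \<kappa>_def)
    (* The last factor is 1 in absolute value on Re z = 5 and 1 / L on Re z = 1/2 + \<delta>; the
       Gaussian factor makes the horizontal sides of the rectangle harmless. *)
    define F where "F = (\<lambda>z. l z * exp ((z - \<i> * of_real t) ^ 2) * exp (of_real (\<kappa> * ln L) * (z - 5)))"
    have nF: "norm (F z) = norm (l z) * exp (Re z ^ 2 - (Im z - t) ^ 2) * exp (\<kappa> * ln L * (Re z - 5))" for z
      by (simp add: F_def norm_mult Re_power2)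
    define S where "S = cbox (Complex (1 / 2 + \<delta>) (t / 2)) (Complex 5 (3 * t / 2))"
    have S: "z \<in> S \<longleftrightarrow> 1 / 2 + \<delta> \<le> Re z \<and> Re z \<le> 5 \<and> t / 2 \<le> Im z \<and> Im z \<le> 3 * t / 2" for z
      by (auto simp: S_def in_cbox_complex_iff)
    have SU: "S \<subseteq> {s. Re s > 1 / 2 \<and> Im s > 0}"
      using \<delta> t by (auto simp: S)
    have l2: "norm (l z) \<le> 2 * C1 * L" if z: "z \<in> S" for z
    proof -
      have "norm (l z) \<le> C1 * ln (Im z)" using z t by (intro C1(2)) (auto simp: S)
      also have "ln (Im z) \<le> ln (t * t)"
      proof (rule ln_mono)
        have "3 / 2 * t \<le> t * t" using t by (intro mult_right_mono) auto
        then show "Im z \<le> t * t" using z by (simp add: S)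
      qed (use z t in \<open>auto simp: S\<close>)
      also have "ln (t * t) = 2 * L" using t by (simp add: ln_mult L_def)
      finally show ?thesis using C1 by (simp add: mult_left_mono mult.left_commute)
    qed
    have "norm (F s) \<le> B"
    proof (rule maximum_modulus_frontier[where f = F and S = S and B = B])
      show "F holomorphic_on interior S"
        unfolding F_def using SU interior_subset[of S]
        by (intro holomorphic_intros holomorphic_on_subset[OF l_hol]) auto
      show "continuous_on (closure S) F"
        unfolding F_def using SU holomorphic_on_imp_continuous_on[OF l_hol]
        by (intro continuous_intros) (auto simp: S_def intro: continuous_on_subset)
      show "bounded S" by (simp add: S_def)
      show "s \<in> S" using s \<delta> by (auto simp: S t_def)
      fix z assume "z \<in> frontier S"
      then have zS: "z \<in> S" and zb: "z \<notin> box (Complex (1 / 2 + \<delta>) (t / 2)) (Complex 5 (3 * t / 2))"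
        by (auto simp: S_def frontier_cbox)
      from zb zS consider "Re z = 1 / 2 + \<delta>" | "Re z = 5" | "\<bar>Im z - t\<bar> = t / 2"
        by (auto simp: in_box_complex_iff S abs_if field_simps)
      then show "norm (F z) \<le> B"
      proof cases
        case 1
        have "norm (F z) \<le> (2 * C1 * L) * exp 25 * exp (\<kappa> * ln L * (Re z - 5))"
          unfolding nF
        proof (intro mult_right_mono mult_mono)
          have "Re z ^ 2 \<le> 5 ^ 2" using 1 \<delta> by (intro power_mono) auto
          then show "exp ((Re z)\<^sup>2 - (Im z - t)\<^sup>2) \<le> exp 25"
            by (simp add: add_increasing2 diff_le_eq)
        qed (use l2[OF zS] C1 L in auto)
        also have "\<kappa> * ln L * (Re z - 5) = - (\<kappa> * (9 / 2 - \<delta>)) * ln L"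
          unfolding 1 by (simp add: algebra_simps)
        also have "exp \<dots> = 1 / L" unfolding \<kappa>(2) using L by (simp add: exp_minus inverse_eq_divide)
        also have "2 * C1 * L * exp 25 * (1 / L) = 2 * C1 * exp 25" using L by simp
        also have "\<dots> \<le> B" using C0 by (simp add: B_def)
        finally show ?thesis .
      next
        case 2
        have "norm (F z) = norm (l z) * exp (25 - (Im z - t)\<^sup>2)" unfolding nF 2 by simp
        also have "\<dots> \<le> C0 * exp 25"
          using zS t 2 C0 by (intro mult_mono l_bound) (auto simp: S)
        also have "\<dots> \<le> B" using C1 by (simp add: B_def)
        finally show ?thesis .
      next
        case 3
        have "norm (F z) \<le> (2 * C1 * L) * (exp 25 * exp (- t)) * 1"
          unfolding nF
        proof (intro mult_mono)
          have "Re z ^ 2 \<le> 5 ^ 2" using zS \<delta> by (intro power_mono) (auto simp: S)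
          moreover have "(Im z - t) ^ 2 = t * (t / 4)"
            using 3 by (metis (no_types, opaque_lifting) power2_abs power2_eq_square
                times_divide_eq_right times_divide_times_eq num_double numeral_times_numeral)
          moreover have "t * 1 \<le> t * (t / 4)" using t by (intro mult_left_mono) auto
          ultimately show "exp ((Re z)\<^sup>2 - (Im z - t)\<^sup>2) \<le> exp 25 * exp (- t)"
            by (simp flip: exp_add)
          show "exp (\<kappa> * ln L * (Re z - 5)) \<le> 1"
            using zS \<kappa> L by (auto simp: S intro!: mult_nonneg_nonpos)
        qed (use l2[OF zS] C1 L in auto)
        also have "\<dots> = 2 * C1 * exp 25 * (L * exp (- t))" by simp
        also have "\<dots> \<le> 2 * C1 * exp 25 * 1"
        proof (intro mult_left_mono)
          have "L \<le> t" using t ln_le_minus_one[of t] by (simp add: L_def)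
          also have "t \<le> exp t" using exp_ge_add_one_self[of t] by linarith
          finally show "L * exp (- t) \<le> 1" by (simp add: exp_minus field_simps)
        qed (use C1 in auto)
        also have "\<dots> \<le> B" using C0 by (simp add: B_def)
        finally show ?thesis .
      qed
    qed
    then have "norm (l s) * exp (Re s ^ 2) * exp (\<kappa> * ln L * (Re s - 5)) \<le> B"
      unfolding nF by (simp add: t_def)
    moreover have "norm (l s) * 1 * exp (\<kappa> * ln L * (Re s - 5)) \<le>
        norm (l s) * exp (Re s ^ 2) * exp (\<kappa> * ln L * (Re s - 5))"
      by (intro mult_right_mono mult_left_mono) auto
    ultimately have *: "norm (l s) * exp (\<kappa> * ln L * (Re s - 5)) \<le> B" by simp
    have "norm (l s) = norm (l s) * exp (\<kappa> * ln L * (Re s - 5)) * exp (ln L * (\<kappa> * (5 - Re s)))"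
      by (simp add: mult.assoc algebra_simps flip: exp_add)
    also have "\<dots> \<le> B * exp (ln L * \<eta>)"
    proof (rule mult_mono[OF *])
      have "\<kappa> * (5 - Re s) \<le> \<kappa> * (9 / 2 - 2 * \<delta>)" using s \<kappa> by (intro mult_left_mono) auto
      also have "\<dots> = \<eta>" by (simp add: \<kappa>_def \<eta>_def)
      finally show "exp (ln L * (\<kappa> * (5 - Re s))) \<le> exp (ln L * \<eta>)"
        using L by (simp add: mult_left_mono)
    qed (use B in auto)
    also have "exp (ln L * \<eta>) = L powr \<eta>" using L by (simp add: powr_def mult.commute)
    finally show ?thesis by (simp add: L_def t_def)
  qed
  then show ?thesis using B \<eta> by blast
qed

text \<open>A power \<open>(ln t)^\<eta>\<close> with \<open>\<eta> < 1\<close> is eventually smaller than \<open>e ln t\<close>, for any \<open>e > 0\<close>.\<close>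
lemma inverse_bound:
  assumes \<delta>: "0 < \<delta>" "\<delta> < 2" and e: "e > 0"
  shows "\<exists>C>0. \<forall>s. 1 / 2 + \<delta> \<le> Re s \<and> Im s \<ge> 12 \<longrightarrow> norm (inverse (f s)) \<le> C * Im s powr e"
proof -
  obtain B \<eta> where B: "B > 0" "\<eta> < 1" "\<eta> > 0"
    "\<And>s. 1 / 2 + 2 * (\<delta> / 2) \<le> Re s \<Longrightarrow> Re s \<le> 5 \<Longrightarrow> Im s \<ge> 12 \<Longrightarrow> norm (l s) \<le> B * ln (Im s) powr \<eta>"
    using log_sublinear[of "\<delta> / 2"] \<delta> by auto
  (* Beyond X the power is below e * x. *)
  define X where "X = (B / e) powr (1 / (1 - \<eta>))"
  have X: "X > 0" using B e by (simp add: X_def)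
  have sub: "B * x powr \<eta> \<le> e * x + B * X powr \<eta>" if x: "x > 0" for x
  proof (cases "x \<le> X")
    case True
    have "B * x powr \<eta> \<le> B * X powr \<eta>"
      using True B x by (intro mult_left_mono powr_mono2) auto
    then show ?thesis using e x by (simp add: add_increasing)
  next
    case False
    have "B / e = X powr (1 - \<eta>)" using B e by (simp add: X_def powr_powr)
    also have "\<dots> \<le> x powr (1 - \<eta>)" using False X B by (intro powr_mono2) auto
    finally have "B \<le> e * x powr (1 - \<eta>)" using e by (simp add: field_simps)
    then have "B * x powr \<eta> \<le> e * x powr (1 - \<eta>) * x powr \<eta>" by (intro mult_right_mono) auto
    also have "\<dots> = e * x" using x by (simp add: mult.assoc flip: powr_add)
    finally show ?thesis using B by (simp add: add_increasing2)
  qed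
  define C where "C = exp (B * X powr \<eta>) + exp C0"
  show ?thesis
  proof (intro exI[of _ C] conjI allI impI)
    show "C > 0" by (simp add: C_def add_pos_pos)
    fix s assume s: "1 / 2 + \<delta> \<le> Re s \<and> Im s \<ge> 12"
    have ex: "exp (e * ln (Im s)) = Im s powr e" using s by (simp add: powr_def)
    have ln0: "ln (Im s) > 0" using s by simp
    have inv: "norm (inverse (f s)) \<le> exp (norm (l s))"
    proof -
      have "norm (inverse (f s)) = exp (- Re (l s))"
        using f_eq[of s] s \<delta> by (simp add: norm_inverse exp_minus)
      also have "\<dots> \<le> exp (norm (l s))" using abs_Re_le_cmod[of "l s"] by simp
      finally show ?thesis .
    qed
    show "norm (inverse (f s)) \<le> C * Im s powr e"
    proof (cases "Re s \<le> 5")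
      case True
      have "norm (l s) \<le> B * ln (Im s) powr \<eta>" using B(4)[of s] s True by simp
      also have "\<dots> \<le> e * ln (Im s) + B * X powr \<eta>" by (rule sub[OF ln0])
      finally have "exp (norm (l s)) \<le> exp (e * ln (Im s) + B * X powr \<eta>)" by simp
      also have "\<dots> = exp (B * X powr \<eta>) * Im s powr e" by (simp add: exp_add ex)
      also have "\<dots> \<le> C * Im s powr e" by (intro mult_right_mono) (auto simp: C_def)
      finally show ?thesis using inv by linarith
    next
      case False
      have "exp (norm (l s)) \<le> exp C0 * 1" using l_bound[of s] False s by simp
      also have "\<dots> \<le> C * Im s powr e"
        using s e by (intro mult_mono ge_one_powr_ge_zero) (auto simp: C_def intro: add_nonneg_nonneg)
      finally show ?thesis using inv by linarith
    qed
  qed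
qed

end

text \<open>The quadrant is convex, so \<open>f\<close> has a logarithm. Where \<open>f\<close> is close to 1, this logarithm differs from
  the principal one by a constant and is therefore bounded.\<close>
lemma nonvanishing_quadrant_exists:
  fixes f :: "complex \<Rightarrow> complex"
  assumes hol: "f holomorphic_on {s. Re s > 1 / 2 \<and> Im s > 0}"
    and nz: "\<And>s. Re s > 1 / 2 \<Longrightarrow> Im s > 0 \<Longrightarrow> f s \<noteq> 0"
    and bound: "\<And>s. Re s > 1 / 2 \<Longrightarrow> Im s \<ge> 1 \<Longrightarrow> norm (f s) \<le> K * (1 + norm s) ^ 2"
    and near1: "\<And>s. Re s \<ge> 4 \<Longrightarrow> Im s > 0 \<Longrightarrow> norm (f s - 1) \<le> 1 / 2"
    and K: "K \<ge> 1"
  shows "\<exists>l C0. nonvanishing_quadrant f l K C0"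
proof -
  define U where "U = {s. Re s > 1 / 2 \<and> Im s > 0}"
  define V where "V = {s. Re s > 4 \<and> Im s > 0}"
  have U: "open U" "convex U"
  proof -
    have eq: "U = {s. Re s > 1 / 2} \<inter> {s. Im s > 0}" by (auto simp: U_def)
    show "open U" "convex U" unfolding eq
      by (intro open_Int open_halfspace_Re_gt open_halfspace_Im_gt convex_Int
          convex_halfspace_Re_gt convex_halfspace_Im_gt)+
  qed
  have V: "open V" "convex V"
  proof -
    have eq: "V = {s. Re s > 4} \<inter> {s. Im s > 0}" by (auto simp: V_def)
    show "open V" "convex V" unfolding eq
      by (intro open_Int open_halfspace_Re_gt open_halfspace_Im_gt convex_Int
          convex_halfspace_Re_gt convex_halfspace_Im_gt)+
  qed
  have VU: "V \<subseteq> U" by (auto simp: V_def U_def)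
  have "f holomorphic_on U" using hol by (simp add: U_def)
  moreover have "contractible U" using U(2) by (rule convex_imp_contractible)
  moreover have "f z \<noteq> 0" if "z \<in> U" for z using that nz by (auto simp: U_def)
  ultimately have "\<exists>l. l holomorphic_on U \<and> (\<forall>z\<in>U. f z = exp (l z))"
    by (metis contractible_imp_holomorphic_log)
  then obtain l where l: "l holomorphic_on U" "\<And>z. z \<in> U \<Longrightarrow> f z = exp (l z)" by auto
  have nonpos: "exp (l z) \<notin> \<real>\<^sub>\<le>\<^sub>0" if z: "z \<in> V" for z
  proof -
    have "norm (f z - 1) \<le> 1 / 2" using z by (intro near1) (auto simp: V_def)
    then have "\<bar>Re (f z) - 1\<bar> \<le> 1 / 2" using abs_Re_le_cmod[of "f z - 1"] by simp
    then have "Re (f z) > 0" by (simp add: abs_if split: if_splits)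
    then show ?thesis using l(2) z VU by (force simp: complex_nonpos_Reals_iff)
  qed
  have "\<exists>c. \<forall>z\<in>V. l z - Ln (exp (l z)) = c"
  proof (rule has_field_derivative_zero_constant[OF V(2)])
    fix z assume z: "z \<in> V"
    have "(l has_field_derivative deriv l z) (at z)"
      using z VU by (intro holomorphic_derivI[OF l(1) U(1)]) auto
    then have "((\<lambda>z. l z - Ln (exp (l z))) has_field_derivative 0) (at z)"
      using nonpos[OF z] by (auto intro!: derivative_eq_intros)
    then show "((\<lambda>z. l z - Ln (exp (l z))) has_field_derivative 0) (at z within V)"
      by (rule has_field_derivative_at_within)
  qed
  then obtain c where c: "\<And>z. z \<in> V \<Longrightarrow> l z - Ln (exp (l z)) = c" by blast
  define C0 where "C0 = norm c + 2 + pi"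
  have lb: "norm (l s) \<le> C0" if s: "Re s \<ge> 5" "Im s > 0" for s
  proof -
    have sV: "s \<in> V" using s by (simp add: V_def)
    define w where "w = exp (l s)"
    have w0: "w \<noteq> 0" by (simp add: w_def)
    have fw: "f s = w" using l(2)[of s] sV VU by (auto simp: w_def)
    have "norm (w - 1) \<le> 1 / 2" using near1[of s] s fw by simp
    then have "norm w \<ge> 1 / 2" "norm w \<le> 3 / 2"
      using norm_triangle_ineq2[of 1 "1 - w"] norm_triangle_ineq[of "w - 1" 1]
      by (auto simp: norm_minus_commute)
    then have "ln (norm w) \<le> 2" "- ln (norm w) \<le> 2"
    proof -
      assume *: "norm w \<ge> 1 / 2" "norm w \<le> 3 / 2"
      show "ln (norm w) \<le> 2" using ln_le_minus_one[of "norm w"] w0 * by simp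
      have "- ln (norm w) = ln (1 / norm w)" using w0 by (simp add: ln_div)
      also have "\<dots> \<le> 1 / norm w - 1" using w0 by (intro ln_le_minus_one) simp
      also have "1 / norm w \<le> 2" using * w0 by (simp add: field_simps)
      finally show "- ln (norm w) \<le> 2" by simp
    qed
    then have "norm (Ln w) \<le> 2 + pi"
      using cmod_le[of "Ln w"] Im_Ln_le_pi[OF w0] mpi_less_Im_Ln[OF w0] Re_Ln[OF w0] by auto
    moreover have "l s = c + Ln w" using c[OF sV] by (simp add: w_def algebra_simps)
    ultimately show ?thesis
      using norm_triangle_ineq[of c "Ln w"] by (simp add: C0_def)
  qed
  have "nonvanishing_quadrant f l K C0"
    by unfold_locales (use l bound lb K in \<open>auto simp: U_def C0_def intro!: add_nonneg_nonneg\<close>)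
  then show ?thesis by blast
qed

lemma zeta_scaled_nonzero:
  assumes RH: riemann_hypothesis and s: "Re s > 1 / 2"
  shows "zeta_scaled s \<noteq> 0"
proof (cases "s = 1")
  case True
  then show ?thesis by (simp add: zeta_scaled_1)
next
  case False
  consider "Re s > 1" | "Re s = 1" | "Re s < 1" by linarith
  then have "riemann_zeta s \<noteq> 0"
  proof cases
    case 2
    then have "s = Complex 1 (Im s)" "Im s \<noteq> 0" using False by (auto simp: complex_eq_iff)
    then show ?thesis using riemann_zeta_nonzero_Re_1 by metis
  next
    case 3
    then show ?thesis using RH s by (auto simp: riemann_hypothesis_def)
  qed (rule riemann_zeta_nonzero_Re_gt_1)
  then show ?thesis using zeta_scaled_eq[of s] s False by simp
qed

lemma riemann_zeta_inverse_bound: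
  assumes RH: riemann_hypothesis and \<delta>: "0 < \<delta>" "\<delta> < 2" and e: "e > 0"
  shows "\<exists>C>0. \<forall>s. 1 / 2 + \<delta> \<le> Re s \<and> \<bar>Im s\<bar> \<ge> 12 \<longrightarrow>
           norm (inverse (riemann_zeta s)) \<le> C * \<bar>Im s\<bar> powr e"
proof -
  define U where "U = {s. Re s > 1 / 2 \<and> Im s > 0}"
  obtain K where K: "K > 0" "\<And>s. Re s \<ge> 1 / 2 \<Longrightarrow> norm (zeta_scaled s) \<le> K * (1 + norm s) ^ 2"
    using zeta_scaled_bound[of "1 / 2"] by auto
  have bound: "norm (riemann_zeta s) \<le> max 1 K * (1 + norm s) ^ 2" if s: "Re s > 1 / 2" "\<bar>Im s\<bar> \<ge> 1" for s
  proof -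
    have ne: "s \<noteq> 1" using s by auto
    have "1 \<le> norm (s - 1)" using abs_Im_le_cmod[of "s - 1"] s by simp
    then have "norm (riemann_zeta s) * 1 \<le> norm (riemann_zeta s) * norm (s - 1)"
      by (intro mult_left_mono) auto
    also have "\<dots> = norm (zeta_scaled s)" using zeta_scaled_eq[of s] s ne by (simp add: norm_mult)
    also have "\<dots> \<le> K * (1 + norm s) ^ 2" using K(2) s by simp
    also have "\<dots> \<le> max 1 K * (1 + norm s) ^ 2" by (intro mult_right_mono) auto
    finally show ?thesis by simp
  qed
  have nz: "riemann_zeta s \<noteq> 0" if s: "Re s > 1 / 2" "Im s \<noteq> 0" for s
  proof -
    have "s \<noteq> 1" using s by auto
    then show ?thesis using zeta_scaled_nonzero[OF RH s(1)] zeta_scaled_eq[of s] s by auto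
  qed
  (* The reflection of the zeta function handles the lower half plane. *)
  define g where "g = cnj \<circ> riemann_zeta \<circ> cnj"
  have gs: "g s = cnj (riemann_zeta (cnj s))" for s by (simp add: g_def)
  have "\<exists>l C0. nonvanishing_quadrant riemann_zeta l (max 1 K) C0"
    by (rule nonvanishing_quadrant_exists)
      (use nz bound norm_riemann_zeta_minus_1 in
        \<open>auto intro!: holomorphic_on_subset[OF riemann_zeta_holomorphic]\<close>)
  then obtain l1 C1 where "nonvanishing_quadrant riemann_zeta l1 (max 1 K) C1" by blast
  then obtain B1 where B1: "B1 > 0" "\<And>s. 1 / 2 + \<delta> \<le> Re s \<Longrightarrow> Im s \<ge> 12 \<Longrightarrow>
      norm (inverse (riemann_zeta s)) \<le> B1 * Im s powr e"
    using nonvanishing_quadrant.inverse_bound[of riemann_zeta l1 "max 1 K" C1 \<delta> e] \<delta> e by blast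
  have "\<exists>l C0. nonvanishing_quadrant g l (max 1 K) C0"
  proof (rule nonvanishing_quadrant_exists)
    have "open U"
    proof -
      have eq: "U = {s. Re s > 1 / 2} \<inter> {s. Im s > 0}" by (auto simp: U_def)
      show ?thesis unfolding eq by (intro open_Int open_halfspace_Re_gt open_halfspace_Im_gt)
    qed
    then have "g holomorphic_on U"
      unfolding g_def
      by (intro holomorphic_on_compose_cnj_cnj holomorphic_on_subset[OF riemann_zeta_holomorphic])
         (auto simp: U_def)
    then show "g holomorphic_on {s. Re s > 1 / 2 \<and> Im s > 0}" by (simp add: U_def)
    show "norm (g s - 1) \<le> 1 / 2" if "Re s \<ge> 4" "Im s > 0" for s
    proof -
      have "g s - 1 = cnj (riemann_zeta (cnj s) - 1)" by (simp add: gs)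
      then show ?thesis using norm_riemann_zeta_minus_1[of "cnj s"] that by (simp only: complex_mod_cnj complex_cnj(1) cnj.sel)
    qed
    show "norm (g s) \<le> max 1 K * (1 + norm s) ^ 2" if "Re s > 1 / 2" "Im s \<ge> 1" for s
      using bound[of "cnj s"] that by (simp add: gs)
    show "g s \<noteq> 0" if "Re s > 1 / 2" "Im s > 0" for s
      using nz[of "cnj s"] that by (simp add: gs)
  qed simp
  then obtain l2 C2 where "nonvanishing_quadrant g l2 (max 1 K) C2" by blast
  then obtain B2 where B2: "B2 > 0" "\<And>s. 1 / 2 + \<delta> \<le> Re s \<Longrightarrow> Im s \<ge> 12 \<Longrightarrow>
      norm (inverse (g s)) \<le> B2 * Im s powr e"
    using nonvanishing_quadrant.inverse_bound[of g l2 "max 1 K" C2 \<delta> e] \<delta> e by blast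
  show ?thesis
  proof (intro exI[of _ "B1 + B2"] conjI allI impI)
    show "B1 + B2 > 0" using B1 B2 by simp
    fix s assume s: "1 / 2 + \<delta> \<le> Re s \<and> \<bar>Im s\<bar> \<ge> 12"
    show "norm (inverse (riemann_zeta s)) \<le> (B1 + B2) * \<bar>Im s\<bar> powr e"
    proof (cases "Im s \<ge> 0")
      case True
      then have "norm (inverse (riemann_zeta s)) \<le> B1 * \<bar>Im s\<bar> powr e" using B1(2)[of s] s by simp
      also have "\<dots> \<le> (B1 + B2) * \<bar>Im s\<bar> powr e" using B2 by (intro mult_right_mono) auto
      finally show ?thesis .
    next
      case False
      then have "norm (inverse (riemann_zeta s)) \<le> B2 * \<bar>Im s\<bar> powr e"
        using B2(2)[of "cnj s"] s by (simp add: gs norm_inverse)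
      also have "\<dots> \<le> (B1 + B2) * \<bar>Im s\<bar> powr e" using B1 by (intro mult_right_mono) auto
      finally show ?thesis .
    qed
  qed
qed

text \<open>Uniform version on a vertical strip, where a neighbourhood of the real axis is covered by compactness.
  One factor \<open>\<bar>s\<bar>^(-1)\<close> is gained from \<open>s - 1\<close>.\<close>
lemma zeta_scaled_inverse_bound:
  assumes RH: riemann_hypothesis and \<delta>: "0 < \<delta>" "\<delta> < 2" and e: "0 < e" "e < 1"
  shows "\<exists>C>0. \<forall>s. 1 / 2 + \<delta> \<le> Re s \<and> Re s \<le> 4 \<longrightarrow>
           norm (inverse (zeta_scaled s)) \<le> C * (1 + norm s) powr (e - 1)"
proof -
  obtain B where B: "B > 0" "\<And>s. 1 / 2 + \<delta> \<le> Re s \<Longrightarrow> \<bar>Im s\<bar> \<ge> 12 \<Longrightarrow>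
      norm (inverse (riemann_zeta s)) \<le> B * \<bar>Im s\<bar> powr e"
    using riemann_zeta_inverse_bound[OF RH \<delta> e(1)] by blast
  define S where "S = cbox (Complex (1 / 2 + \<delta>) (- 12)) (Complex 4 12)"
  have S: "s \<in> S \<longleftrightarrow> 1 / 2 + \<delta> \<le> Re s \<and> Re s \<le> 4 \<and> \<bar>Im s\<bar> \<le> 12" for s
    by (auto simp: S_def in_cbox_complex_iff)
  have "continuous_on S (\<lambda>s. inverse (zeta_scaled s))"
    using zeta_scaled_nonzero[OF RH] \<delta>
    by (intro continuous_intros continuous_on_subset[OF holomorphic_on_imp_continuous_on[OF zeta_scaled_holomorphic]])
       (auto simp: S)
  then have "compact ((\<lambda>s. inverse (zeta_scaled s)) ` S)"
    by (rule compact_continuous_image) (simp add: S_def)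
  then obtain D where D: "\<And>s. s \<in> S \<Longrightarrow> norm (inverse (zeta_scaled s)) \<le> D"
    using compact_imp_bounded[THEN bounded_iff[THEN iffD1]] by (metis image_eqI)
  (* 17 bounds 1 + norm s on the compact part and (1 + norm s) / norm (s - 1) outside it. *)
  define C where "C = 17 * \<bar>D\<bar> + 17 * B"
  have p: "(1 + norm s) powr (e - 1) \<ge> 1 / 17" if "norm s \<le> 16" for s :: complex
  proof -
    have "1 / 17 \<le> (17::real) powr (-1)" by (simp add: powr_minus)
    also have "\<dots> \<le> 17 powr (e - 1)" using e by (intro powr_mono) auto
    also have "\<dots> \<le> (1 + norm s) powr (e - 1)"
      using that e by (intro powr_mono2') (auto intro: add_pos_nonneg)
    finally show ?thesis .
  qed
  show ?thesis
  proof (intro exI[of _ "C"] conjI allI impI)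
    show "C > 0" using B by (simp add: C_def add_nonneg_pos)
    fix s assume s: "1 / 2 + \<delta> \<le> Re s \<and> Re s \<le> 4"
    have ns: "norm s \<le> 4 + \<bar>Im s\<bar>" using cmod_le[of s] s \<delta> by simp
    show "norm (inverse (zeta_scaled s)) \<le> C * (1 + norm s) powr (e - 1)"
    proof (cases "\<bar>Im s\<bar> \<le> 12")
      case True
      have "norm (inverse (zeta_scaled s)) \<le> \<bar>D\<bar>" using D[of s] s True by (simp add: S)
      also have "\<dots> = 17 * \<bar>D\<bar> * (1 / 17)" by simp
      also have "\<dots> \<le> C * (1 + norm s) powr (e - 1)"
        using B p[of s] ns True by (intro mult_mono) (auto simp: C_def)
      finally show ?thesis .
    next
      case False
      then have ne: "s \<noteq> 1" by auto
      have d: "norm (s - 1) \<ge> (1 + norm s) / 17"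
      proof -
        define x where "x = \<bar>Im s\<bar>"
        have "x \<le> norm (s - 1)" "norm s \<le> 4 + x" "x > 12"
          using abs_Im_le_cmod[of "s - 1"] ns False by (simp_all add: x_def)
        then show ?thesis by simp
      qed
      have "Re s > 0" using s \<delta> by linarith
      then have "zeta_scaled s = (s - 1) * riemann_zeta s" using ne by (rule zeta_scaled_eq)
      then have "norm (inverse (zeta_scaled s)) = norm (inverse (riemann_zeta s)) / norm (s - 1)"
        by (simp only: norm_mult norm_inverse divide_inverse inverse_mult_distrib mult.commute)
      also have "\<dots> \<le> (B * \<bar>Im s\<bar> powr e) / ((1 + norm s) / 17)"
        using B s False d by (intro frac_le B(2)) (auto intro: add_pos_nonneg)
      also have "\<dots> \<le> (B * (1 + norm s) powr e) / ((1 + norm s) / 17)"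
        using B e abs_Im_le_cmod[of s]
        by (intro divide_right_mono mult_left_mono powr_mono2) auto
      also have "\<dots> = 17 * B * (1 + norm s) powr (e - 1)"
        by (simp add: powr_diff)
      also have "\<dots> \<le> C * (1 + norm s) powr (e - 1)" by (intro mult_right_mono) (auto simp: C_def)
      finally show ?thesis .
    qed
  qed
qed

section \<open>A Perron formula with quadratic weights\<close>

lemma contour_integral_rectpath_split:
  fixes f :: "complex \<Rightarrow> complex"
  assumes le: "Re a1 \<le> Re a3" "Im a1 \<le> Im a3"
    and cont: "continuous_on (path_image (rectpath a1 a3)) f"
  defines "a2 \<equiv> Complex (Re a3) (Im a1)" and "a4 \<equiv> Complex (Re a1) (Im a3)"
  shows "contour_integral (rectpath a1 a3) f =
     contour_integral (linepath a1 a2) f + contour_integral (linepath a2 a3) f +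
     contour_integral (linepath a3 a4) f + contour_integral (linepath a4 a1) f"
proof -
  have im: "path_image (rectpath a1 a3) =
      closed_segment a1 a2 \<union> closed_segment a2 a3 \<union> closed_segment a3 a4 \<union> closed_segment a4 a1"
    by (simp add: rectpath_def Let_def path_image_join Un_assoc a2_def a4_def)
  have I: "(f has_contour_integral contour_integral (linepath u v) f) (linepath u v)"
    if "closed_segment u v \<subseteq> path_image (rectpath a1 a3)" for u v
    by (intro has_contour_integral_integral contour_integrable_continuous_linepath
        continuous_on_subset[OF cont] that)
  have "(f has_contour_integral (contour_integral (linepath a1 a2) f + (contour_integral (linepath a2 a3) f +
     (contour_integral (linepath a3 a4) f + contour_integral (linepath a4 a1) f)))) (rectpath a1 a3)"
    unfolding rectpath_def Let_def a2_def[symmetric] a4_def[symmetric]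
    by (intro has_contour_integral_join I) (auto simp: im)
  then show ?thesis using contour_integral_unique by (simp add: add.assoc)
qed

text \<open>The integral of \<open>max(0, 1 - 1 / y)^2 y^(-s - 1)\<close> over \<open>y > 0\<close>. Its cubic decay is what makes the contour integrals
  below converge absolutely.\<close>
definition perron_kernel :: "complex \<Rightarrow> complex" where
  "perron_kernel s = 2 / (s * (s + 1) * (s + 2))"

lemma norm_cpowr_le:
  fixes s :: complex and y :: real
  assumes "y > 0" "y \<ge> 1 \<and> Re s \<le> c \<or> y \<le> 1 \<and> Re s \<ge> c"
  shows "norm (of_real y powr s) \<le> y powr c"
proof -
  have "norm (of_real y powr s) = y powr Re s"
    using assms by (subst norm_powr_real_powr) auto
  also have "\<dots> \<le> y powr c"
  proof (cases "y \<ge> 1 \<and> Re s \<le> c")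
    case True then show ?thesis by (intro powr_mono) auto
  next
    case False
    then have "y \<le> 1" "c \<le> Re s" using assms by auto
    then show ?thesis using assms by (intro powr_mono') auto
  qed
  finally show ?thesis .
qed

lemma norm_perron_integrand_le:
  fixes s :: complex and y :: real
  assumes "y > 0" "y \<ge> 1 \<and> Re s \<le> 2 \<or> y \<le> 1 \<and> Re s \<ge> 2"
    and T: "T \<ge> 4" and s: "\<bar>Im s\<bar> \<ge> T \<or> \<bar>Re s\<bar> \<ge> T"
  shows "norm (of_real y powr s * perron_kernel s) \<le> 16 * y\<^sup>2 / T ^ 3"
proof -
  have j: "norm (s + of_real j) \<ge> T / 2" if "0 \<le> j" "j \<le> 2" for j :: real
    using abs_Re_le_cmod[of "s + of_real j"] abs_Im_le_cmod[of "s + of_real j"] s that T by auto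
  have "(T / 2) ^ 3 \<le> norm s * norm (s + 1) * norm (s + 2)"
    unfolding power3_eq_cube using j[of 0] j[of 1] j[of 2] T by (intro mult_mono) auto
  then have "norm (perron_kernel s) \<le> 2 / (T / 2) ^ 3"
    unfolding perron_kernel_def norm_divide norm_mult using T by (intro frac_le) auto
  moreover have "norm (of_real y powr s) \<le> y\<^sup>2"
    using norm_cpowr_le[OF assms(1,2)] assms(1) by (simp add: powr_numeral)
  ultimately have "norm (of_real y powr s * perron_kernel s) \<le> y\<^sup>2 * (2 / (T / 2) ^ 3)"
    unfolding norm_mult by (intro mult_mono) auto
  also have "\<dots> = 16 * y\<^sup>2 / T ^ 3" using T by (simp add: field_simps power_divide)
  finally show ?thesis .
qed

lemma perron_kernel_holomorphic:
  assumes "0 \<notin> S" "-1 \<notin> S" "-2 \<notin> S"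
  shows "perron_kernel holomorphic_on S"
proof -
  have "s + 1 \<noteq> 0" "s + 2 \<noteq> 0" "s \<noteq> 0" if "s \<in> S" for s
    using that assms by (auto simp: add_eq_0_iff2)
  then show ?thesis unfolding perron_kernel_def[abs_def] by (intro holomorphic_intros) auto
qed

text \<open>If \<open>f\<close> is at most \<open>B\<close> on three sides of a rectangle, then the integral over the remaining vertical
  side is close to the integral over the whole boundary. Here \<open>r\<close> is the abscissa of the vertical
  side that is estimated, \<open>r'\<close> that of the one that is kept, and \<open>\<epsilon>\<close> is the orientation of the latter
  in the boundary.\<close>
lemma perron_rect_sides:
  fixes f :: "complex \<Rightarrow> complex"
  assumes le: "Re a1 \<le> Re a3" "Im a1 \<le> Im a3" and B: "B \<ge> 0"
    and len: "2 * (Re a3 - Re a1) + (Im a3 - Im a1) \<le> L"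
    and hol: "continuous_on (path_image (rectpath a1 a3)) f"
    and bnd: "\<And>s. s \<in> cbox a1 a3 \<Longrightarrow> Im s = Im a1 \<or> Im s = Im a3 \<or> Re s = r \<Longrightarrow> norm (f s) \<le> B"
    and r: "r = Re a1 \<and> r' = Re a3 \<and> \<epsilon> = 1 \<or> r = Re a3 \<and> r' = Re a1 \<and> \<epsilon> = -1"
  shows "norm (contour_integral (rectpath a1 a3) f -
           \<epsilon> * contour_integral (linepath (Complex r' (Im a1)) (Complex r' (Im a3))) f) \<le> B * L"
proof -
  define a2 a4 where "a2 = Complex (Re a3) (Im a1)" and "a4 = Complex (Re a1) (Im a3)"
  have im: "path_image (rectpath a1 a3) =
      closed_segment a1 a2 \<union> closed_segment a2 a3 \<union> closed_segment a3 a4 \<union> closed_segment a4 a1"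
    by (simp add: rectpath_def Let_def path_image_join Un_assoc a2_def a4_def)
  have img: "path_image (rectpath a1 a3) \<subseteq> cbox a1 a3"
    using le by (intro path_image_rectpath_subset_cbox) auto
  have split: "contour_integral (rectpath a1 a3) f =
     contour_integral (linepath a1 a2) f + contour_integral (linepath a2 a3) f +
     contour_integral (linepath a3 a4) f + contour_integral (linepath a4 a1) f"
    using contour_integral_rectpath_split[OF le hol] by (simp add: a2_def a4_def)
  have side: "norm (contour_integral (linepath u v) f) \<le> B * norm (v - u)"
    if sub: "closed_segment u v \<subseteq> path_image (rectpath a1 a3)"
      and uv: "Im u = Im v \<and> (Im u = Im a1 \<or> Im u = Im a3) \<or> Re u = r \<and> Re v = r" for u v
  proof (rule contour_integral_bound_linepath[OF _ B])
    show "f contour_integrable_on linepath u v"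
      using sub by (intro contour_integrable_continuous_linepath continuous_on_subset[OF hol])
    fix s assume s: "s \<in> closed_segment u v"
    then obtain x where x: "s = (1 - x) *\<^sub>R u + x *\<^sub>R v" by (auto simp: closed_segment_def)
    have "Im s = Im a1 \<or> Im s = Im a3 \<or> Re s = r"
      using uv by (auto simp: x algebra_simps)
    then show "norm (f s) \<le> B" using s sub img by (intro bnd) auto
  qed
  have n1: "norm (a2 - a1) = Re a3 - Re a1" "norm (a4 - a3) = Re a3 - Re a1"
    using le by (auto simp: a2_def a4_def cmod_def)
  have n2: "norm (a3 - a2) = Im a3 - Im a1" "norm (a1 - a4) = Im a3 - Im a1"
    using le by (auto simp: a2_def a4_def cmod_def)
  have h: "norm (contour_integral (linepath a1 a2) f) \<le> B * (Re a3 - Re a1)"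
      "norm (contour_integral (linepath a3 a4) f) \<le> B * (Re a3 - Re a1)"
    using side[of a1 a2] side[of a3 a4] unfolding n1 im by (auto simp: a2_def a4_def)
  have v: "\<exists>J. norm J \<le> B * (Im a3 - Im a1) \<and>
      contour_integral (linepath a2 a3) f + contour_integral (linepath a4 a1) f =
      J + \<epsilon> * contour_integral (linepath (Complex r' (Im a1)) (Complex r' (Im a3))) f"
    using r
  proof
    assume r: "r = Re a1 \<and> r' = Re a3 \<and> \<epsilon> = 1"
    have "norm (contour_integral (linepath a4 a1) f) \<le> B * (Im a3 - Im a1)"
      using side[of a4 a1] r unfolding n2 im by (auto simp: a4_def)
    moreover have "Complex r' (Im a1) = a2" "Complex r' (Im a3) = a3"
      using r by (auto simp: a2_def)
    ultimately show ?thesis using r by (intro exI[of _ "contour_integral (linepath a4 a1) f"]) simp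
  next
    assume r: "r = Re a3 \<and> r' = Re a1 \<and> \<epsilon> = -1"
    have "norm (contour_integral (linepath a2 a3) f) \<le> B * (Im a3 - Im a1)"
      using side[of a2 a3] r unfolding n2 im by (auto simp: a2_def)
    moreover have "Complex r' (Im a1) = a1" "Complex r' (Im a3) = a4"
      using r by (auto simp: a4_def)
    moreover have "contour_integral (linepath a4 a1) f = - contour_integral (linepath a1 a4) f"
    proof -
      have "continuous_on (closed_segment a1 a4) f"
        by (rule continuous_on_subset[OF hol]) (auto simp: im closed_segment_commute)
      then show ?thesis using contour_integral_reverse_linepath[of a1 a4 f] by simp
    qed
    ultimately show ?thesis using r by (intro exI[of _ "contour_integral (linepath a2 a3) f"]) simp
  qed
  then obtain J where J: "norm J \<le> B * (Im a3 - Im a1)"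
      "contour_integral (linepath a2 a3) f + contour_integral (linepath a4 a1) f =
      J + \<epsilon> * contour_integral (linepath (Complex r' (Im a1)) (Complex r' (Im a3))) f" by blast
  have "contour_integral (rectpath a1 a3) f -
           \<epsilon> * contour_integral (linepath (Complex r' (Im a1)) (Complex r' (Im a3))) f =
     contour_integral (linepath a1 a2) f + contour_integral (linepath a3 a4) f + J"
    using J(2) unfolding split by (simp add: algebra_simps)
  also have "norm \<dots> \<le> B * (Re a3 - Re a1) + B * (Re a3 - Re a1) + B * (Im a3 - Im a1)"
    by (intro norm_triangle_le add_mono h J)
  also have "\<dots> = B * (2 * (Re a3 - Re a1) + (Im a3 - Im a1))" by (simp add: algebra_simps)
  also have "\<dots> \<le> B * L" using len B by (rule mult_left_mono)
  finally show ?thesis .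
qed

lemma perron_kernel_eq:
  assumes "s \<noteq> 0" "s \<noteq> -1" "s \<noteq> -2"
  shows "perron_kernel s = 1 / (s - 0) - 2 * (1 / (s - (-1))) + 1 / (s - (-2))"
proof -
  have "s + 1 \<noteq> 0" "s + 2 \<noteq> 0" using assms by (auto simp: eq_neg_iff_add_eq_0)
  then show ?thesis using assms unfolding perron_kernel_def by (simp add: divide_simps) algebra
qed

text \<open>The integral over the line \<open>Re s = 2\<close> is completed to a large rectangle: to the right if \<open>y \<le> 1\<close>, where there
  are no poles, and to the left otherwise, where the poles at \<open>0\<close>, \<open>-1\<close>, \<open>-2\<close> contribute
  \<open>1 - 2 / y + 1 / y^2\<close>. On the new sides the integrand is \<open>O(y^2 / T^3)\<close> and their length is \<open>O(T)\<close>.\<close>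
lemma perron_formula:
  fixes y T :: real
  assumes y: "0 < y" and T: "T \<ge> 4"
  defines "f \<equiv> \<lambda>s. of_real y powr s * perron_kernel s"
  shows "norm (contour_integral (linepath (Complex 2 (- T)) (Complex 2 T)) f
           - 2 * pi * \<i> * of_real ((max 0 (1 - 1 / y))\<^sup>2)) \<le> 96 * y\<^sup>2 / T\<^sup>2"
proof (cases "y \<le> 1")
  case True
  define a1 a3 where "a1 = Complex 2 (- T)" and "a3 = Complex (2 + T) T"
  define S where "S = {s. Re s > 1}"
  have hol: "f holomorphic_on S"
    unfolding f_def using y
    by (intro holomorphic_intros perron_kernel_holomorphic) (auto simp: S_def)
  have sub: "cbox a1 a3 \<subseteq> S" by (auto simp: S_def a1_def a3_def in_cbox_complex_iff)
  have img: "path_image (rectpath a1 a3) \<subseteq> cbox a1 a3"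
    using T by (intro path_image_rectpath_subset_cbox) (auto simp: a1_def a3_def)
  have "(f has_contour_integral 0) (rectpath a1 a3)"
    by (rule Cauchy_theorem_convex_simple[OF hol])
      (use sub img in \<open>auto simp: S_def intro: convex_halfspace_Re_gt\<close>)
  then have 0: "contour_integral (rectpath a1 a3) f = 0" by (rule contour_integral_unique)
  have "norm (contour_integral (rectpath a1 a3) f -
           (-1) * contour_integral (linepath (Complex 2 (Im a1)) (Complex 2 (Im a3))) f)
        \<le> 16 * y\<^sup>2 / T ^ 3 * (6 * T)"
  proof (rule perron_rect_sides[where r = "2 + T"])
    show "continuous_on (path_image (rectpath a1 a3)) f"
      using sub img by (intro holomorphic_on_imp_continuous_on holomorphic_on_subset[OF hol]) auto
    fix s assume s: "s \<in> cbox a1 a3" "Im s = Im a1 \<or> Im s = Im a3 \<or> Re s = 2 + T"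
    show "norm (f s) \<le> 16 * y\<^sup>2 / T ^ 3"
      unfolding f_def using s y True T
      by (intro norm_perron_integrand_le) (auto simp: a1_def a3_def in_cbox_complex_iff)
  qed (use T in \<open>auto simp: a1_def a3_def\<close>)
  moreover have "max 0 (1 - 1 / y) = 0" using True y by (simp add: max_def field_simps)
  moreover have "16 * y\<^sup>2 / T ^ 3 * (6 * T) = 96 * y\<^sup>2 / T\<^sup>2"
    using T by (simp add: power2_eq_square power3_eq_cube)
  ultimately show ?thesis unfolding 0 by (simp add: a1_def a3_def)
next
  case False
  then have y1: "y > 1" by simp
  define a1 a3 where "a1 = Complex (- T) (- T)" and "a3 = Complex 2 T"
  define P where "P = path_image (rectpath a1 a3)"
  have img: "P \<subseteq> cbox a1 a3 - box a1 a3"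
    unfolding P_def using T by (subst path_image_rectpath_cbox_minus_box) (auto simp: a1_def a3_def)
  have box: "0 \<in> box a1 a3" "-1 \<in> box a1 a3" "-2 \<in> box a1 a3"
    using T by (auto simp: a1_def a3_def in_box_complex_iff)
  have nP: "0 \<notin> P" "-1 \<notin> P" "-2 \<notin> P" using img box by auto
  define g where "g = (\<lambda>s. of_real y powr s :: complex)"
  have hg: "g holomorphic_on UNIV" unfolding g_def using y by (intro holomorphic_intros) auto
  have I: "((\<lambda>w. g w / (w - z)) has_contour_integral (2 * pi * \<i> * g z)) (rectpath a1 a3)"
    if "z \<in> box a1 a3" for z
    using Cauchy_integral_formula_convex_simple[of UNIV g z "rectpath a1 a3"] hg that img
      winding_number_rectpath[OF that] by (auto simp: P_def)
  have "((\<lambda>w. g w / (w - 0) - 2 * (g w / (w - (-1))) + g w / (w - (-2))) has_contour_integral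
     (2 * pi * \<i> * g 0 - 2 * (2 * pi * \<i> * g (-1)) + 2 * pi * \<i> * g (-2))) (rectpath a1 a3)"
    by (intro has_contour_integral_add has_contour_integral_diff has_contour_integral_lmul I box)
  then have "(f has_contour_integral
     (2 * pi * \<i> * g 0 - 2 * (2 * pi * \<i> * g (-1)) + 2 * pi * \<i> * g (-2))) (rectpath a1 a3)"
  proof (rule has_contour_integral_eq)
    fix w assume "w \<in> path_image (rectpath a1 a3)"
    then have "w \<noteq> 0" "w \<noteq> -1" "w \<noteq> -2" using nP by (auto simp: P_def)
    then show "g w / (w - 0) - 2 * (g w / (w - (-1))) + g w / (w - (-2)) = f w"
      unfolding f_def g_def perron_kernel_eq[OF \<open>w \<noteq> 0\<close> \<open>w \<noteq> -1\<close> \<open>w \<noteq> -2\<close>]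
      by (simp add: algebra_simps)
  qed
  moreover have "2 * pi * \<i> * g 0 - 2 * (2 * pi * \<i> * g (-1)) + 2 * pi * \<i> * g (-2) =
      2 * pi * \<i> * of_real ((max 0 (1 - 1 / y))\<^sup>2)"
  proof -
    have "max 0 (1 - 1 / y) = 1 - 1 / y" using y1 by (simp add: field_simps)
    moreover have "g 0 = 1" "g (-1) = of_real (1 / y)" "g (-2) = of_real (1 / y\<^sup>2)"
      using y powr_of_real[of y "-1"] powr_of_real[of y "-2"]
      by (simp_all add: g_def powr_minus powr_numeral divide_inverse)
    ultimately show ?thesis
      by (simp add: power2_eq_square algebra_simps)
  qed
  ultimately have R: "contour_integral (rectpath a1 a3) f = 2 * pi * \<i> * of_real ((max 0 (1 - 1 / y))\<^sup>2)"
    using contour_integral_unique by simp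
  have "norm (contour_integral (rectpath a1 a3) f -
           1 * contour_integral (linepath (Complex 2 (Im a1)) (Complex 2 (Im a3))) f)
        \<le> 16 * y\<^sup>2 / T ^ 3 * (6 * T)"
  proof (rule perron_rect_sides[where r = "- T"])
    have "of_real y \<noteq> (0 :: complex)" using y by simp
    then have "f holomorphic_on P"
      unfolding f_def using nP by (intro holomorphic_intros perron_kernel_holomorphic)
    then show "continuous_on (path_image (rectpath a1 a3)) f"
      unfolding P_def by (rule holomorphic_on_imp_continuous_on)
    fix s assume s: "s \<in> cbox a1 a3" "Im s = Im a1 \<or> Im s = Im a3 \<or> Re s = - T"
    show "norm (f s) \<le> 16 * y\<^sup>2 / T ^ 3"
      unfolding f_def using s y y1 T
      by (intro norm_perron_integrand_le) (auto simp: a1_def a3_def in_cbox_complex_iff)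
  qed (use T in \<open>auto simp: a1_def a3_def\<close>)
  moreover have "16 * y\<^sup>2 / T ^ 3 * (6 * T) = 96 * y\<^sup>2 / T\<^sup>2"
    using T by (simp add: power2_eq_square power3_eq_cube)
  ultimately show ?thesis unfolding R by (simp add: a1_def a3_def norm_minus_commute)
qed

section \<open>Continuation and growth of the zeta function without its pole\<close>

text \<open>The coefficients of \<open>(1 - q^(1 - s)) \<zeta>(s)\<close>. They are periodic with mean 0, so the series can be summed
  by parts twice with bounded sums.\<close>
definition period_coeff :: "nat \<Rightarrow> nat \<Rightarrow> complex" where
  "period_coeff q n = 1 - (if q dvd n then of_nat q else 0)"

text \<open>The partial sums of \<open>period_coeff q\<close> are \<open>n mod q\<close>, with mean \<open>(q - 1) / 2\<close>. This is the closed form of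
  the partial sums of \<open>n mod q - (q - 1) / 2\<close>, which are again periodic.\<close>
definition period_sum2 :: "nat \<Rightarrow> nat \<Rightarrow> real" where
  "period_sum2 q n = real (n mod q) * (real (n mod q) + 2 - real q) / 2"

definition second_diff :: "nat \<Rightarrow> complex \<Rightarrow> complex" where
  "second_diff n s = of_nat n powr (- s) - 2 * of_nat (Suc n) powr (- s) + of_nat (Suc (Suc n)) powr (- s)"

text \<open>The continuation of \<open>(1 - q^(1 - s)) \<zeta>(s)\<close> that results from two summations by parts.\<close>
definition poleless_zeta :: "nat \<Rightarrow> complex \<Rightarrow> complex" where
  "poleless_zeta q s = of_real ((real q - 1) / 2) + (\<Sum>n. of_real (period_sum2 q (Suc n)) * second_diff (Suc n) s)"

lemma period_sum2_bound:
  assumes "q > 0"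
  shows "\<bar>period_sum2 q n\<bar> \<le> (real q + 2)\<^sup>2"
proof -
  define r where "r = n mod q"
  have r: "real r \<le> real q" using assms by (simp add: r_def less_imp_le)
  have "\<bar>period_sum2 q n\<bar> = real r * \<bar>real r + 2 - real q\<bar> / 2"
    by (simp add: period_sum2_def r_def abs_mult)
  also have "\<dots> \<le> real r * \<bar>real r + 2 - real q\<bar>" by simp
  also have "\<dots> \<le> (real q + 2) * (real q + 2)" using r by (intro mult_mono) auto
  finally show ?thesis by (simp add: power2_eq_square)
qed

lemma period_sum2_step:
  assumes "q > 0"
  shows "period_sum2 q (Suc n) - period_sum2 q n = real (Suc n mod q) - (real q - 1) / 2"
proof (cases "Suc (n mod q) = q")
  case True
  then have "real (n mod q) = real q - 1" "Suc n mod q = 0" by (auto simp: mod_Suc of_nat_diff)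
  then show ?thesis by (simp add: period_sum2_def)
next
  case False
  then have "Suc n mod q = Suc (n mod q)" by (simp add: mod_Suc)
  then show ?thesis by (simp add: period_sum2_def field_simps)
qed

lemma period_coeff_step:
  assumes "q > 0"
  shows "period_coeff q (Suc n) = of_nat (Suc n mod q) - of_nat (n mod q)"
proof (cases "Suc (n mod q) = q")
  case True
  then have "q dvd Suc n" "Suc n mod q = 0" by (auto simp: mod_Suc dvd_eq_mod_eq_0)
  moreover have "(of_nat q :: complex) = of_nat (n mod q) + 1" by (subst True[symmetric]) simp
  ultimately show ?thesis by (simp add: period_coeff_def)
next
  case False
  then have "Suc n mod q = Suc (n mod q)" by (simp add: mod_Suc)
  moreover from this have "\<not> q dvd Suc n" by (simp add: dvd_eq_mod_eq_0)
  ultimately show ?thesis by (simp add: period_coeff_def)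
qed

lemma double_abel_summation:
  fixes x :: "nat \<Rightarrow> complex"
  assumes q: "q > 0"
  shows "(\<Sum>n<N. period_coeff q (Suc n) * x (Suc n)) =
    of_real ((real q - 1) / 2) * x 1 +
    (\<Sum>n<N. of_real (period_sum2 q (Suc n)) * (x (Suc n) - 2 * x (Suc (Suc n)) + x (Suc (Suc (Suc n))))) +
    of_real (real (N mod q) - (real q - 1) / 2) * x (Suc N) +
    of_real (period_sum2 q N) * (x (Suc N) - x (Suc (Suc N)))"
proof (induction N)
  case 0
  then show ?case by (simp add: period_sum2_def)
next
  case (Suc N)
  define E where "E = (\<lambda>n. of_real (period_sum2 q n) :: complex)"
  define \<kappa> :: complex where "\<kappa> = of_real ((real q - 1) / 2)"
  define c where "c = (\<lambda>n. of_nat (n mod q) :: complex)"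
  have E: "E N = E (Suc N) - (c (Suc N) - \<kappa>)"
    using arg_cong[OF period_sum2_step[OF q, of N], of "of_real :: real \<Rightarrow> complex"]
    unfolding E_def c_def \<kappa>_def of_real_diff of_real_of_nat_eq by (simp add: algebra_simps)
  show ?case
    using Suc unfolding sum.lessThan_Suc period_coeff_step[OF q] of_real_diff of_real_of_nat_eq
      E_def[symmetric, THEN fun_cong] c_def[symmetric, THEN fun_cong] \<kappa>_def[symmetric] E
    by (simp add: algebra_simps)
qed

lemma norm_powr_diff_le:
  fixes s :: complex and x :: real
  assumes x: "x > 0" and s: "Re s \<ge> -1"
  shows "norm (of_real x powr (- s) - of_real (x + 1) powr (- s)) \<le> norm s * x powr (- Re s - 1)"
proof -
  define S where "S = closed_segment (of_real x) (of_real (x + 1) :: complex)"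
  have S: "\<exists>r\<ge>x. z = of_real r" if "z \<in> S" for z
  proof -
    from that obtain u where u: "0 \<le> u" "z = (1 - u) *\<^sub>R of_real x + u *\<^sub>R of_real (x + 1)"
      unfolding S_def closed_segment_def by auto
    then show ?thesis
      by (intro exI[of _ "x + u"]) (auto simp: algebra_simps scaleR_conv_of_real)
  qed
  have "norm (of_real x powr (- s) - of_real (x + 1) powr (- s)) \<le>
      norm s * x powr (- Re s - 1) * norm (of_real x - of_real (x + 1) :: complex)"
  proof (rule field_differentiable_bound[where S = S and f = "\<lambda>z. z powr (- s)" and f' = "\<lambda>z. - s * z powr (- s - 1)"])
    show "convex S" "of_real x \<in> S" "of_real (x + 1) \<in> S" by (auto simp: S_def)
    fix z assume "z \<in> S"
    then obtain r where r: "r \<ge> x" "z = of_real r" using S by blast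
    have "z \<notin> \<real>\<^sub>\<le>\<^sub>0" using r x by simp
    then show "((\<lambda>z. z powr - s) has_field_derivative - s * z powr (- s - 1)) (at z within S)"
      by (auto intro!: derivative_eq_intros simp: powr_diff field_simps)
    have "norm (z powr (- s - 1)) = r powr (- Re s - 1)"
      using r x by (subst norm_powr_real_powr) auto
    also have "\<dots> \<le> x powr (- Re s - 1)" using r x s by (intro powr_mono2') auto
    finally show "norm (- s * z powr (- s - 1)) \<le> norm s * x powr (- Re s - 1)"
      by (simp add: norm_mult mult_left_mono)
  qed
  then show ?thesis by simp
qed

lemma norm_powr_second_diff_le:
  fixes s :: complex and x :: real
  assumes x: "x > 0" and s: "Re s \<ge> -1"
  shows "norm (of_real x powr (- s) - 2 * of_real (x + 1) powr (- s) + of_real (x + 2) powr (- s))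
     \<le> norm s * norm (s + 1) * x powr (- Re s - 2)"
proof -
  define S where "S = closed_segment (of_real x) (of_real (x + 1) :: complex)"
  define f where "f = (\<lambda>z. z powr (- s) - (z + 1) powr (- s))"
  have S: "\<exists>r\<ge>x. z = of_real r" if "z \<in> S" for z
  proof -
    from that obtain u where u: "0 \<le> u" "z = (1 - u) *\<^sub>R of_real x + u *\<^sub>R of_real (x + 1)"
      unfolding S_def closed_segment_def by auto
    then show ?thesis
      by (intro exI[of _ "x + u"]) (auto simp: algebra_simps scaleR_conv_of_real)
  qed
  have "norm (f (of_real x) - f (of_real (x + 1))) \<le>
      norm s * norm (s + 1) * x powr (- Re s - 2) * norm (of_real x - of_real (x + 1) :: complex)"
  proof (rule field_differentiable_bound[where S = S and
      f' = "\<lambda>z. - s * (z powr (- s - 1) - (z + 1) powr (- s - 1))"])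
    show "convex S" "of_real x \<in> S" "of_real (x + 1) \<in> S" by (auto simp: S_def)
    fix z assume "z \<in> S"
    then obtain r where r: "r \<ge> x" "z = of_real r" using S by blast
    have nz: "z \<notin> \<real>\<^sub>\<le>\<^sub>0" "z + 1 \<notin> \<real>\<^sub>\<le>\<^sub>0" 
    proof -
      show "z \<notin> \<real>\<^sub>\<le>\<^sub>0" using r x by simp
      have "z + 1 = of_real (r + 1)" using r by simp
      then show "z + 1 \<notin> \<real>\<^sub>\<le>\<^sub>0" using r x by (simp only: nonpos_Reals_of_real_iff)
    qed
    show "(f has_field_derivative - s * (z powr (- s - 1) - (z + 1) powr (- s - 1))) (at z within S)"
      unfolding f_def using nz
      by (auto intro!: derivative_eq_intros simp: powr_diff field_simps)
    have "norm (z powr (- (s + 1)) - (z + 1) powr (- (s + 1))) \<le> norm (s + 1) * r powr (- Re (s + 1) - 1)"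
      using norm_powr_diff_le[of r "s + 1"] r x s by simp
    also have "- Re (s + 1) - 1 = - Re s - 2" by simp
    also have "norm (s + 1) * r powr (- Re s - 2) \<le> norm (s + 1) * x powr (- Re s - 2)"
      using r x s by (intro mult_left_mono powr_mono2') auto
    finally have "norm (z powr (- s - 1) - (z + 1) powr (- s - 1)) \<le> norm (s + 1) * x powr (- Re s - 2)"
      by simp
    then show "norm (- s * (z powr (- s - 1) - (z + 1) powr (- s - 1))) \<le> norm s * norm (s + 1) * x powr (- Re s - 2)"
      by (simp add: norm_mult mult_left_mono mult.assoc)
  qed
  then show ?thesis by (simp add: f_def algebra_simps)
qed

text \<open>The geometric mean of the bounds \<open>O(\<bar>s\<bar> n^(-\<sigma> - 1))\<close> from first differences and \<open>O(\<bar>s\<bar>^2 n^(-\<sigma> - 2))\<close>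
  from second differences. The first is not summable for \<open>\<sigma> < 0\<close>, and the second costs \<open>\<bar>s\<bar>^2\<close>, which would
  leave an integrand that is not absolutely integrable on the shifted line. The mean is summable for
  \<open>\<sigma> > -1/2\<close> and costs only \<open>\<bar>s\<bar>^(3/2)\<close>.\<close>
lemma second_diff_bound:
  assumes n: "n > 0" and s: "Re s \<ge> -1"
  shows "norm (second_diff n s) \<le> 2 * (1 + norm s) powr (3 / 2) * real n powr (- Re s - 3 / 2)"
proof -
  define x where "x = real n"
  have x: "x > 0" using n by (simp add: x_def)
  have D: "second_diff n s = of_real x powr (- s) - 2 * of_real (x + 1) powr (- s) + of_real (x + 2) powr (- s)"
    by (simp add: second_diff_def x_def algebra_simps)
  have b2: "norm (second_diff n s) \<le> norm s * norm (s + 1) * x powr (- Re s - 2)"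
    unfolding D by (rule norm_powr_second_diff_le[OF x s])
  have b1: "norm (second_diff n s) \<le> 2 * norm s * x powr (- Re s - 1)"
  proof -
    have "second_diff n s = (of_real x powr (- s) - of_real (x + 1) powr (- s)) -
        (of_real (x + 1) powr (- s) - of_real (x + 1 + 1) powr (- s))"
      unfolding D by (simp add: algebra_simps)
    also have "norm \<dots> \<le> norm s * x powr (- Re s - 1) + norm s * (x + 1) powr (- Re s - 1)"
      using x s by (intro order.trans[OF norm_triangle_ineq4] add_mono norm_powr_diff_le) auto
    also have "(x + 1) powr (- Re s - 1) \<le> x powr (- Re s - 1)"
      using x s by (intro powr_mono2') auto
    finally show ?thesis by (simp add: mult_left_mono)
  qed
  define A where "A = 1 + norm s"
  have A: "A \<ge> 1" by (simp add: A_def)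
  have "norm (second_diff n s) ^ 2 \<le> (2 * norm s * x powr (- Re s - 1)) * (norm s * norm (s + 1) * x powr (- Re s - 2))"
    unfolding power2_eq_square by (intro mult_mono b1 b2) auto
  also have "\<dots> = 2 * (norm s * norm s * norm (s + 1)) * (x powr (- Re s - 1) * x powr (- Re s - 2))" by simp
  also have "x powr (- Re s - 1) * x powr (- Re s - 2) = (x powr (- Re s - 3 / 2)) ^ 2"
    by (simp add: power2_eq_square flip: powr_add)
  also have "2 * (norm s * norm s * norm (s + 1)) * (x powr (- Re s - 3 / 2)) ^ 2 \<le>
      4 * (A * A * A) * (x powr (- Re s - 3 / 2)) ^ 2"
  proof (intro mult_right_mono)
    have "norm s * norm s * norm (s + 1) \<le> A * A * A"
      using norm_triangle_ineq[of s 1] by (intro mult_mono) (auto simp: A_def)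
    also have "2 * \<dots> \<le> 4 * (A * A * A)" using A by simp
    finally show "2 * (norm s * norm s * norm (s + 1)) \<le> 4 * (A * A * A)" by simp
  qed auto
  also have "A * A * A = (A powr (3 / 2)) ^ 2"
  proof -
    have "(A powr (3 / 2)) ^ 2 = A powr 3" by (simp add: power2_eq_square flip: powr_add)
    then show ?thesis using A by (simp add: powr_numeral power3_eq_cube)
  qed
  finally have "norm (second_diff n s) ^ 2 \<le> (2 * A powr (3 / 2) * x powr (- Re s - 3 / 2)) ^ 2"
    by (simp add: power_mult_distrib)
  then show ?thesis unfolding A_def x_def by (rule power2_le_imp_le) auto
qed

lemma poleless_zeta_holomorphic:
  assumes q: "q > 0" shows "poleless_zeta q holomorphic_on {s. Re s > -1/2}"
  unfolding poleless_zeta_def[abs_def]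
proof (intro holomorphic_on_add holomorphic_on_const holomorphic_on_suminf)
  show "open {s. Re s > -1/2}" by (rule open_halfspace_Re_gt)
  show "(\<lambda>s. of_real (period_sum2 q (Suc n)) * second_diff (Suc n) s) holomorphic_on {s. Re s > -1/2}" for n
    unfolding second_diff_def by (intro holomorphic_intros)
  fix K assume K: "compact K" "K \<subseteq> {s. Re s > -1/2}"
  then obtain b where b: "b > -1/2" "\<forall>s\<in>K. Re s \<ge> b"
    using compact_Re_bound by blast
  obtain R where R: "\<forall>s\<in>K. norm s \<le> R" using compact_imp_bounded[OF K(1)] by (auto simp: bounded_iff)
  define B where "B = (real q + 2)\<^sup>2 * (2 * (1 + R) powr (3 / 2))"
  show "\<exists>M. summable M \<and> (\<forall>n. \<forall>s\<in>K. norm (of_real (period_sum2 q (Suc n)) * second_diff (Suc n) s) \<le> M n)"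
  proof (intro exI[of _ "\<lambda>n. B * real (Suc n) powr (- b - 3 / 2)"] conjI allI ballI)
    have "- b - 3 / 2 < - 1" using b(1) by (simp add: field_simps)
    then show "summable (\<lambda>n. B * real (Suc n) powr (- b - 3 / 2))"
      by (intro summable_mult summable_Suc_powr)
    fix n s assume s: "s \<in> K"
    have Rs: "b \<le> Re s" using b s by auto
    have "norm (second_diff (Suc n) s) \<le> 2 * (1 + norm s) powr (3 / 2) * real (Suc n) powr (- Re s - 3 / 2)"
      using Rs b by (intro second_diff_bound) auto
    also have "\<dots> \<le> 2 * (1 + R) powr (3 / 2) * real (Suc n) powr (- b - 3 / 2)"
      using R s Rs by (intro mult_mono powr_mono2 powr_mono) auto
    finally have "\<bar>period_sum2 q (Suc n)\<bar> * norm (second_diff (Suc n) s) \<le>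
        (real q + 2)\<^sup>2 * (2 * (1 + R) powr (3 / 2) * real (Suc n) powr (- b - 3 / 2))"
      using period_sum2_bound[OF q] by (intro mult_mono) auto
    then show "norm (of_real (period_sum2 q (Suc n)) * second_diff (Suc n) s) \<le> B * real (Suc n) powr (- b - 3 / 2)"
      by (simp add: norm_mult B_def mult.assoc)
  qed
qed

lemma poleless_zeta_bound:
  assumes q: "q > 0" and b: "b > -1/2"
  shows "\<exists>C>0. \<forall>s. Re s \<ge> b \<longrightarrow> norm (poleless_zeta q s) \<le> C * (1 + norm s) powr (3 / 2)"
proof -
  define S where "S = (\<Sum>n. real (Suc n) powr (- b - 3 / 2))"
  have "- b - 3 / 2 < - 1" using b by (simp add: field_simps)
  then have sm: "summable (\<lambda>n. real (Suc n) powr (- b - 3 / 2))"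
    by (rule summable_Suc_powr)
  have S: "S \<ge> 0" unfolding S_def by (intro suminf_nonneg sm) auto
  define C where "C = real q + (real q + 2)\<^sup>2 * 2 * S"
  show ?thesis
  proof (intro exI[of _ C] conjI allI impI)
    show "C > 0" using q S by (simp add: C_def add_pos_nonneg)
    fix s assume s: "Re s \<ge> b"
    define P where "P = (1 + norm s) powr (3 / 2)"
    have P: "P \<ge> 1" unfolding P_def by (intro ge_one_powr_ge_zero) auto
    have n: "norm (of_real (period_sum2 q (Suc n)) * second_diff (Suc n) s) \<le>
        (real q + 2)\<^sup>2 * 2 * P * real (Suc n) powr (- b - 3 / 2)" for n
    proof -
      have "norm (second_diff (Suc n) s) \<le> 2 * P * real (Suc n) powr (- Re s - 3 / 2)"
        unfolding P_def using s b by (intro second_diff_bound) auto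
      also have "\<dots> \<le> 2 * P * real (Suc n) powr (- b - 3 / 2)"
        using s P by (intro mult_left_mono powr_mono) auto
      finally have "\<bar>period_sum2 q (Suc n)\<bar> * norm (second_diff (Suc n) s) \<le>
        (real q + 2)\<^sup>2 * (2 * P * real (Suc n) powr (- b - 3 / 2))"
        using period_sum2_bound[OF q] by (intro mult_mono) auto
      then show ?thesis by (simp add: norm_mult mult.assoc)
    qed
    have sm2: "summable (\<lambda>n. norm (of_real (period_sum2 q (Suc n)) * second_diff (Suc n) s))"
      by (rule summable_comparison_test'[OF summable_mult[OF sm], of 0]) (use n in auto)
    have "norm (\<Sum>n. of_real (period_sum2 q (Suc n)) * second_diff (Suc n) s) \<le>
        (\<Sum>n. norm (of_real (period_sum2 q (Suc n)) * second_diff (Suc n) s))"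
      by (rule summable_norm[OF sm2])
    also have "\<dots> \<le> (\<Sum>n. (real q + 2)\<^sup>2 * 2 * P * real (Suc n) powr (- b - 3 / 2))"
      by (intro suminf_le n sm2 summable_mult sm)
    also have "\<dots> = (real q + 2)\<^sup>2 * 2 * P * S" unfolding S_def by (rule suminf_mult[OF sm])
    finally have "norm (\<Sum>n. of_real (period_sum2 q (Suc n)) * second_diff (Suc n) s) \<le> (real q + 2)\<^sup>2 * 2 * P * S" .
    then have "norm (poleless_zeta q s) \<le> \<bar>(real q - 1) / 2\<bar> + (real q + 2)\<^sup>2 * 2 * P * S"
      unfolding poleless_zeta_def by (intro norm_triangle_le) (simp only: norm_of_real add_left_mono)
    also have "\<bar>(real q - 1) / 2\<bar> \<le> real q * P"
    proof -
      have "\<bar>(real q - 1) / 2\<bar> \<le> real q * 1" using q by auto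
      also have "\<dots> \<le> real q * P" using P by (intro mult_left_mono) auto
      finally show ?thesis .
    qed
    finally show "norm (poleless_zeta q s) \<le> C * (1 + norm s) powr (3 / 2)"
      by (simp add: C_def P_def algebra_simps)
  qed
qed

text \<open>Both sides are limits of the partial sums of the series with coefficients \<open>period_coeff q\<close>: the right one by splitting
  off the multiples of \<open>q\<close>, the left one because the boundary terms of the summation by parts vanish in the
  limit.\<close>
lemma poleless_zeta_eq:
  assumes q: "q > 0" and s: "Re s > 1"
  shows "poleless_zeta q s = (1 - of_nat q * of_nat q powr (- s)) * zeta_series s"
proof -
  define x where "x = (\<lambda>n. of_nat n powr (- s) :: complex)"
  have nx: "norm (x (Suc n)) = real (Suc n) powr (- Re s)" for n
    by (simp add: x_def norm_nat_powr del: of_nat_Suc)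
  have x0: "x \<longlonglongrightarrow> 0"
  proof -
    have "summable (\<lambda>n. norm (x (Suc n)))" unfolding nx using s by (intro summable_Suc_powr) auto
    then have "(\<lambda>n. norm (x (Suc n))) \<longlonglongrightarrow> 0" by (rule summable_LIMSEQ_zero)
    then have "(\<lambda>n. x (Suc n)) \<longlonglongrightarrow> 0" by (rule tendsto_norm_zero_cancel)
    then show ?thesis by (rule LIMSEQ_imp_Suc)
  qed
  have "summable (\<lambda>n. norm (x (Suc n)))" unfolding nx using s by (intro summable_Suc_powr) auto
  from has_sum_of_abs_summable_Suc[OF this]
  have hx: "(x has_sum zeta_series s) {1..}" by (simp add: x_def zeta_series_def)
  have "((\<lambda>m. x (q * m)) has_sum (of_nat q powr (- s) * zeta_series s)) {1..}"
  proof -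
    have "x (q * m) = of_nat q powr (- s) * x m" for m
      using powr_times_real[of "of_nat q" "of_nat m" "- s"] by (simp add: x_def)
    then show ?thesis using has_sum_cmult_right[OF hx, of "of_nat q powr (- s)"] by simp
  qed
  moreover have "bij_betw (\<lambda>m. q * m) {1..} {n\<in>{1..}. q dvd n}"
    using q by (intro bij_betwI[where g = "\<lambda>n. n div q"]) (auto simp: Suc_le_eq elim!: dvdE)
  ultimately have "(x has_sum (of_nat q powr (- s) * zeta_series s)) {n\<in>{1..}. q dvd n}"
    using has_sum_reindex_bij_betw[of "\<lambda>m. q * m" "{1..}" "{n\<in>{1..}. q dvd n}" x] by simp
  then have "((\<lambda>n. if q dvd n then x n else 0) has_sum (of_nat q powr (- s) * zeta_series s)) {1..}"
    by (rule has_sum_cong_neutral[THEN iffD1, rotated -1]) auto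
  then have "((\<lambda>n. x n + (- of_nat q) * (if q dvd n then x n else 0)) has_sum
      (zeta_series s + (- of_nat q) * (of_nat q powr (- s) * zeta_series s))) {1..}"
    by (intro has_sum_add hx has_sum_cmult_right)
  then have "((\<lambda>n. x (Suc n) + (- of_nat q) * (if q dvd Suc n then x (Suc n) else 0)) has_sum
      (zeta_series s + (- of_nat q) * (of_nat q powr (- s) * zeta_series s))) UNIV"
    by (rule has_sum_reindex_bij_betw[OF bij_betw_Suc_UNIV, THEN iffD2])
  from has_sum_imp_sums[OF this]
  have "(\<lambda>n. period_coeff q (Suc n) * x (Suc n)) sums
      (zeta_series s + (- of_nat q) * (of_nat q powr (- s) * zeta_series s))"
    by (rule sums_cong[THEN iffD1, rotated]) (auto simp: period_coeff_def algebra_simps)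
  then have L1: "(\<lambda>N. \<Sum>n<N. period_coeff q (Suc n) * x (Suc n)) \<longlonglongrightarrow>
      (zeta_series s + (- of_nat q) * (of_nat q powr (- s) * zeta_series s))" by (simp add: sums_def)
  have sm: "summable (\<lambda>n. of_real (period_sum2 q (Suc n)) * second_diff (Suc n) s)"
  proof (rule summable_comparison_test'[where N = 0])
    show "summable (\<lambda>n. ((real q + 2)\<^sup>2 * (2 * (1 + norm s) powr (3 / 2))) * real (Suc n) powr (- Re s - 3 / 2))"
      using s by (intro summable_mult summable_Suc_powr) auto
    fix n
    have "\<bar>period_sum2 q (Suc n)\<bar> * norm (second_diff (Suc n) s) \<le>
        (real q + 2)\<^sup>2 * (2 * (1 + norm s) powr (3 / 2) * real (Suc n) powr (- Re s - 3 / 2))"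
      using period_sum2_bound[OF q] s by (intro mult_mono second_diff_bound) auto
    then show "norm (of_real (period_sum2 q (Suc n)) * second_diff (Suc n) s) \<le>
        ((real q + 2)\<^sup>2 * (2 * (1 + norm s) powr (3 / 2))) * real (Suc n) powr (- Re s - 3 / 2)"
      by (simp add: norm_mult mult.assoc)
  qed
  have bz: "(\<lambda>N. of_real (b N) * y N) \<longlonglongrightarrow> 0" if "\<And>N. \<bar>b N\<bar> \<le> B" "y \<longlonglongrightarrow> 0"
    for b :: "nat \<Rightarrow> real" and B and y :: "nat \<Rightarrow> complex"
  proof (rule Lim_null_comparison[where g = "\<lambda>N. B * norm (y N)"])
    show "(\<lambda>N. B * norm (y N)) \<longlonglongrightarrow> 0" by (intro tendsto_mult_right_zero tendsto_norm_zero that)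
    show "\<forall>\<^sub>F N in sequentially. norm (of_real (b N) * y N) \<le> B * norm (y N)"
      using that(1) by (intro always_eventually allI) (simp add: norm_mult mult_right_mono)
  qed
  have x1: "(\<lambda>N. x (Suc N)) \<longlonglongrightarrow> 0" by (rule LIMSEQ_Suc[OF x0])
  have x2: "(\<lambda>N. x (Suc (Suc N))) \<longlonglongrightarrow> 0" by (rule LIMSEQ_Suc[OF x1])
  have t1: "(\<lambda>N. of_real (real (N mod q) - (real q - 1) / 2) * x (Suc N)) \<longlonglongrightarrow> 0"
  proof (rule bz[where B = "real q + 1", OF _ x1])
    fix N
    have "N mod q < q" using q by simp
    then have "real (N mod q) \<le> real q" by linarith
    then show "\<bar>real (N mod q) - (real q - 1) / 2\<bar> \<le> real q + 1" by (simp add: abs_le_iff field_simps)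
  qed
  have t2: "(\<lambda>N. of_real (period_sum2 q N) * (x (Suc N) - x (Suc (Suc N)))) \<longlonglongrightarrow> 0"
    using tendsto_diff[OF x1 x2] by (intro bz[OF period_sum2_bound[OF q]]) simp
  have "(\<lambda>N. of_real ((real q - 1) / 2) * x 1 +
    (\<Sum>n<N. of_real (period_sum2 q (Suc n)) * second_diff (Suc n) s) +
    of_real (real (N mod q) - (real q - 1) / 2) * x (Suc N) +
    of_real (period_sum2 q N) * (x (Suc N) - x (Suc (Suc N)))) \<longlonglongrightarrow>
    of_real ((real q - 1) / 2) * x 1 + (\<Sum>n. of_real (period_sum2 q (Suc n)) * second_diff (Suc n) s) + 0 + 0"
    by (intro tendsto_add tendsto_const summable_LIMSEQ sm t1 t2)
  moreover have sd: "second_diff n s = x n - 2 * x (Suc n) + x (Suc (Suc n))" for n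
    by (simp add: second_diff_def x_def)
  moreover have "x 1 = 1" by (simp add: x_def)
  ultimately have L2: "(\<lambda>N. \<Sum>n<N. period_coeff q (Suc n) * x (Suc n)) \<longlonglongrightarrow> poleless_zeta q s"
    unfolding double_abel_summation[OF q] poleless_zeta_def sd by (simp only: mult_1_right add_0_right)
  show ?thesis using LIMSEQ_unique[OF L2 L1] by (simp add: algebra_simps)
qed

section \<open>Vertical contours\<close>

text \<open>Apply the Perron formula with \<open>y = Y / n\<close> to each term. Its error \<open>O(y^2 / T^2)\<close> remains summable
  against the coefficients.\<close>
lemma perron_formula_dirichlet:
  fixes v :: "nat \<Rightarrow> real" and Y :: real
  assumes sm: "summable (\<lambda>n. \<bar>v (Suc n)\<bar> * real (Suc n) powr (- 2))" and Y: "Y > 0"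
  defines "F \<equiv> \<lambda>s. (\<Sum>n. of_real (v (Suc n)) * of_nat (Suc n) powr (- s)) * of_real Y powr s * perron_kernel s"
  shows "\<exists>K. \<forall>T\<ge>4. F contour_integrable_on linepath (Complex 2 (- T)) (Complex 2 T) \<and>
     norm (contour_integral (linepath (Complex 2 (- T)) (Complex 2 T)) F
       - 2 * pi * \<i> * of_real (\<Sum>n. v (Suc n) * (max 0 (1 - real (Suc n) / Y))\<^sup>2)) \<le> K / T\<^sup>2"
proof -
  define a where "a = (\<lambda>n. \<bar>v (Suc n)\<bar> * real (Suc n) powr (- 2))"
  have sma: "summable a" using sm by (simp add: a_def)
  define K where "K = 96 * Y\<^sup>2 * (\<Sum>n. a n)"
  define g where "g = (\<lambda>n s. of_real (v (Suc n)) * (of_real (Y / real (Suc n)) powr s * perron_kernel s))"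
  have geq: "g n s = of_real (v (Suc n)) * of_nat (Suc n) powr (- s) * of_real Y powr s * perron_kernel s" for n s
  proof -
    have "of_real (Y / real (Suc n)) powr s = of_real Y powr s * of_real (inverse (real (Suc n))) powr s"
      using Y powr_times_real[of "of_real Y" "of_real (inverse (real (Suc n)))" s]
      by (simp add: divide_inverse del: of_nat_Suc)
    also have "(of_real (inverse (real (Suc n))) :: complex) powr s = of_nat (Suc n) powr (- s)"
    proof -
      have "Ln (of_real (inverse (real (Suc n)))) = - Ln (of_nat (Suc n) :: complex)"
        by (simp add: Ln_of_real Ln_of_nat ln_inverse del: of_nat_Suc of_real_inverse)
      then show ?thesis by (simp add: powr_def del: of_nat_Suc)
    qed
    finally show ?thesis unfolding g_def by (simp only: mult_ac)
  qed
  have B: "summable (\<lambda>n. v (Suc n) * (max 0 (1 - real (Suc n) / Y))\<^sup>2)"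
  proof (rule summable_finite[of "{n. real n < Y}"])
    have "{n. real n < Y} \<subseteq> {..nat \<lceil>Y\<rceil>}" by (auto simp: le_nat_iff) linarith
    then show "finite {n. real n < Y}" by (rule finite_subset) simp
    fix n assume "n \<notin> {n. real n < Y}"
    then have "1 - real (Suc n) / Y \<le> 0" using Y by (simp add: field_simps)
    then show "v (Suc n) * (max 0 (1 - real (Suc n) / Y))\<^sup>2 = 0" by (simp add: max_def)
  qed
  show ?thesis
  proof (intro exI[of _ K] allI impI)
    fix T :: real assume T: "T \<ge> 4"
    define L where "L = closed_segment (Complex 2 (- T)) (Complex 2 T)"
    have Re: "Re s = 2" if "s \<in> L" for s
      using that T by (auto simp: L_def closed_segment_same_Re)
    have nL: "0 \<notin> L" "-1 \<notin> L" "-2 \<notin> L" using Re[of 0] Re[of "-1"] Re[of "-2"] by auto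
    have conty: "continuous_on L (\<lambda>s. of_real y powr s * perron_kernel s)" if "y > 0" for y
    proof -
      have "of_real y \<noteq> (0 :: complex)" using that by simp
      then show ?thesis
        by (intro holomorphic_on_imp_continuous_on holomorphic_intros perron_kernel_holomorphic nL)
    qed
    have contk: "continuous_on L (\<lambda>s. of_real Y powr s * perron_kernel s)"
      by (rule conty[OF Y])
    have cont: "continuous_on L (g n)" for n
      unfolding g_def using Y by (intro continuous_on_mult continuous_on_const conty) simp
    have "compact ((\<lambda>s. of_real Y powr s * perron_kernel s) ` L)"
      by (rule compact_continuous_image[OF contk]) (simp add: L_def)
    then have "bounded ((\<lambda>s. of_real Y powr s * perron_kernel s) ` L)" by (rule compact_imp_bounded)
    then obtain D where D: "\<And>s. s \<in> L \<Longrightarrow> norm (of_real Y powr s * perron_kernel s) \<le> D"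
      unfolding bounded_iff by auto
    have gb: "norm (g n s) \<le> a n * D" if "s \<in> L" for n s
    proof -
      have "norm (g n s) = \<bar>v (Suc n)\<bar> * real (Suc n) powr (- Re s) * norm (of_real Y powr s * perron_kernel s)"
        unfolding geq by (simp add: norm_mult norm_nat_powr mult.assoc del: of_nat_Suc)
      also have "\<dots> \<le> a n * D" unfolding Re[OF that] a_def by (intro mult_left_mono D that) auto
      finally show ?thesis .
    qed
    have ul: "uniform_limit L (\<lambda>N s. \<Sum>n<N. g n s) F sequentially"
    proof -
      have "uniform_limit L (\<lambda>N s. \<Sum>n<N. g n s) (\<lambda>s. \<Sum>n. g n s) sequentially"
        by (rule Weierstrass_m_test[OF gb summable_mult2[OF sma]])
      moreover have "(\<Sum>n. g n s) = F s" if "s \<in> L" for s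
      proof -
        have s1: "summable (\<lambda>n. of_real (v (Suc n)) * of_nat (Suc n) powr (- s))"
          by (rule summable_norm_cancel)
            (use sm Re[OF that] in \<open>simp add: norm_mult norm_nat_powr del: of_nat_Suc\<close>)
        from suminf_mult2[OF s1, of "of_real Y powr s * perron_kernel s"]
        show ?thesis unfolding F_def geq by (simp only: mult.assoc)
      qed
      ultimately show ?thesis by (subst uniform_limit_cong'[of L _ "\<lambda>N s. \<Sum>n<N. g n s" F "\<lambda>s. \<Sum>n. g n s"]) auto
    qed
    obtain J where J: "(F has_contour_integral J) (linepath (Complex 2 (- T)) (Complex 2 T))"
      "(\<lambda>n. contour_integral (linepath (Complex 2 (- T)) (Complex 2 T)) (g n)) sums J"
      using contour_integral_sums_linepath[OF ul[unfolded L_def] cont[unfolded L_def]] by blast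
    define r where "r = (\<lambda>n. v (Suc n) * (max 0 (1 - real (Suc n) / Y))\<^sup>2)"
    have rs: "(\<lambda>n. 2 * pi * \<i> * of_real (r n)) sums (2 * pi * \<i> * of_real (\<Sum>n. r n))"
      using B by (intro sums_mult sums_of_real summable_sums) (simp add: r_def)
    have d: "norm (contour_integral (linepath (Complex 2 (- T)) (Complex 2 T)) (g n) - 2 * pi * \<i> * of_real (r n))
        \<le> 96 * Y\<^sup>2 / T\<^sup>2 * a n" for n
    proof -
      define y where "y = Y / real (Suc n)"
      have y: "y > 0" using Y by (simp add: y_def)
      have "contour_integral (linepath (Complex 2 (- T)) (Complex 2 T)) (g n) =
          of_real (v (Suc n)) * contour_integral (linepath (Complex 2 (- T)) (Complex 2 T)) (\<lambda>s. of_real y powr s * perron_kernel s)"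
        unfolding g_def y_def[symmetric]
      proof (rule contour_integral_lmul)
        from conty[OF y] show "(\<lambda>s. of_real y powr s * perron_kernel s) contour_integrable_on linepath (Complex 2 (- T)) (Complex 2 T)"
          unfolding L_def by (rule contour_integrable_continuous_linepath)
      qed
      also have "\<dots> - 2 * pi * \<i> * of_real (r n) = of_real (v (Suc n)) *
          (contour_integral (linepath (Complex 2 (- T)) (Complex 2 T)) (\<lambda>s. of_real y powr s * perron_kernel s)
           - 2 * pi * \<i> * of_real ((max 0 (1 - 1 / y))\<^sup>2))"
        by (simp add: r_def y_def algebra_simps)
      also have "norm \<dots> \<le> \<bar>v (Suc n)\<bar> * (96 * y\<^sup>2 / T\<^sup>2)"
        unfolding norm_mult norm_of_real by (intro mult_left_mono perron_formula y T) auto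
      also have "\<dots> = 96 * Y\<^sup>2 / T\<^sup>2 * a n"
        by (simp add: y_def a_def power_divide powr_minus powr_numeral field_simps del: of_nat_Suc)
      finally show ?thesis .
    qed
    have "norm (J - 2 * pi * \<i> * of_real (\<Sum>n. r n)) \<le> (\<Sum>n. 96 * Y\<^sup>2 / T\<^sup>2 * a n)"
      using norm_suminf_le[OF d summable_mult[OF sma]] sums_unique[OF sums_diff[OF J(2) rs]] by simp
    also have "\<dots> = K / T\<^sup>2"
      using suminf_mult[OF sma, of "96 * Y\<^sup>2 / T\<^sup>2"] by (simp add: K_def)
    finally show "F contour_integrable_on linepath (Complex 2 (- T)) (Complex 2 T) \<and>
     norm (contour_integral (linepath (Complex 2 (- T)) (Complex 2 T)) F
       - 2 * pi * \<i> * of_real (\<Sum>n. v (Suc n) * (max 0 (1 - real (Suc n) / Y))\<^sup>2)) \<le> K / T\<^sup>2"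
      using J(1) contour_integral_unique[OF J(1)]
      by (auto simp: r_def contour_integrable_on_def)
  qed
qed

lemma integral_one_plus_abs_powr_le:
  fixes T :: real
  assumes T: "T \<ge> 0"
  shows "(\<lambda>t. (1 + \<bar>t\<bar>) powr (- 5 / 4)) integrable_on {- T..T}"
    and "integral {- T..T} (\<lambda>t. (1 + \<bar>t\<bar>) powr (- 5 / 4)) \<le> 8"
proof -
  define A where "A = (\<lambda>t :: real. - 4 * (1 + t) powr (- 1 / 4))"
  have pos: "((\<lambda>t. (1 + t) powr (- 5 / 4)) has_integral (A T - A 0)) {0..T}"
  proof (rule fundamental_theorem_of_calculus[OF T])
    fix t assume "t \<in> {0..T}"
    then show "(A has_vector_derivative (1 + t) powr (- 5 / 4)) (at t within {0..T})"
      unfolding A_def has_real_derivative_iff_has_vector_derivative[symmetric]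
      by (auto intro!: derivative_eq_intros)
  qed
  have right: "((\<lambda>t. (1 + \<bar>t\<bar>) powr (- 5 / 4)) has_integral (A T - A 0)) {0..T}"
    by (rule has_integral_eq[OF _ pos]) auto
  have "((\<lambda>t. (1 + \<bar>- t\<bar>) powr (- 5 / 4)) has_integral (A T - A 0)) {-T..-0}"
    using has_integral_reflect_lemma_real[OF right] by simp
  then have left: "((\<lambda>t. (1 + \<bar>t\<bar>) powr (- 5 / 4)) has_integral (A T - A 0)) {-T..0}" by simp
  have all: "((\<lambda>t. (1 + \<bar>t\<bar>) powr (- 5 / 4)) has_integral ((A T - A 0) + (A T - A 0))) {- T..T}"
    by (rule has_integral_combine[OF _ _ left right]) (use T in auto)
  then show "(\<lambda>t. (1 + \<bar>t\<bar>) powr (- 5 / 4)) integrable_on {- T..T}" by (rule has_integral_integrable)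
  have "A T \<le> 0" "A 0 = -4" by (auto simp: A_def)
  then show "integral {- T..T} (\<lambda>t. (1 + \<bar>t\<bar>) powr (- 5 / 4)) \<le> 8"
    using integral_unique[OF all] by simp
qed

text \<open>The line \<open>Re s = 2\<close> is replaced by \<open>Re s = b\<close>. The first term bounds the integral over the new line,
  uniformly in \<open>T\<close> because the integrand is absolutely integrable; the second one bounds the horizontal segments and tends
  to 0.\<close>
lemma contour_shift_bound:
  fixes f :: "complex \<Rightarrow> complex"
  assumes hol: "f holomorphic_on S" and S: "{s. b \<le> Re s \<and> Re s \<le> 2} \<subseteq> S"
    and b: "b < 2" and Y: "Y \<ge> 1" and M: "M \<ge> 0"
    and bnd: "\<And>s. b \<le> Re s \<Longrightarrow> Re s \<le> 2 \<Longrightarrow> norm (f s) \<le> M * Y powr (Re s) * (1 + \<bar>Im s\<bar>) powr (- 5 / 4)"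
    and T: "T > 0"
  shows "norm (contour_integral (linepath (Complex 2 (- T)) (Complex 2 T)) f) \<le>
      8 * M * Y powr b + 2 * (2 - b) * (M * Y powr 2) * (1 + T) powr (- 5 / 4)"
proof -
  define a1 a2 a3 a4 where "a1 = Complex b (- T)" and "a2 = Complex 2 (- T)"
    and "a3 = Complex 2 T" and "a4 = Complex b T"
  have img: "path_image (rectpath a1 a3) \<subseteq> cbox a1 a3"
    using T b by (intro path_image_rectpath_subset_cbox) (auto simp: a1_def a3_def)
  have cS: "cbox a1 a3 \<subseteq> S" using S by (auto simp: a1_def a3_def in_cbox_complex_iff)
  have cont: "continuous_on (cbox a1 a3) f"
    by (rule holomorphic_on_imp_continuous_on[OF holomorphic_on_subset[OF hol cS]])
  have "(f has_contour_integral 0) (rectpath a1 a3)"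
    by (rule Cauchy_theorem_convex_simple[OF holomorphic_on_subset[OF hol cS]])
      (use img in \<open>auto simp: convex_box\<close>)
  then have 0: "contour_integral (rectpath a1 a3) f = 0" by (rule contour_integral_unique)
  have split: "contour_integral (rectpath a1 a3) f =
     contour_integral (linepath a1 a2) f + contour_integral (linepath a2 a3) f +
     contour_integral (linepath a3 a4) f + contour_integral (linepath a4 a1) f"
    using contour_integral_rectpath_split[of a1 a3 f] b T continuous_on_subset[OF cont img]
    by (simp add: a1_def a2_def a3_def a4_def)
  define H where "H = M * Y powr 2 * (1 + T) powr (- 5 / 4)"
  have H: "H \<ge> 0" using M by (simp add: H_def)
  have fH: "norm (f s) \<le> H" if "b \<le> Re s" "Re s \<le> 2" "\<bar>Im s\<bar> = T" for s
  proof -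
    have "norm (f s) \<le> M * Y powr (Re s) * (1 + \<bar>Im s\<bar>) powr (- 5 / 4)" by (rule bnd[OF that(1,2)])
    also have "\<dots> \<le> M * Y powr 2 * (1 + \<bar>Im s\<bar>) powr (- 5 / 4)"
      using that M Y by (intro mult_right_mono mult_left_mono powr_mono) auto
    finally show ?thesis by (simp add: H_def that(3))
  qed
  have seg: "closed_segment u v \<subseteq> cbox a1 a3" if "u \<in> cbox a1 a3" "v \<in> cbox a1 a3" for u v
    using that by (intro closed_segment_subset convex_box)
  have corner: "a1 \<in> cbox a1 a3" "a2 \<in> cbox a1 a3" "a3 \<in> cbox a1 a3" "a4 \<in> cbox a1 a3"
    using b T by (auto simp: a1_def a2_def a3_def a4_def in_cbox_complex_iff)
  have hor: "norm (contour_integral (linepath u v) f) \<le> H * (2 - b)"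
    if uv: "u \<in> cbox a1 a3" "v \<in> cbox a1 a3" "Im u = Im v" "\<bar>Im u\<bar> = T" "\<bar>Re u - Re v\<bar> = 2 - b" for u v
  proof -
    have "norm (contour_integral (linepath u v) f) \<le> H * norm (v - u)"
    proof (rule contour_integral_bound_linepath[OF _ H])
      show "f contour_integrable_on linepath u v"
        using seg[OF uv(1,2)] by (intro contour_integrable_continuous_linepath continuous_on_subset[OF cont])
      fix s assume s: "s \<in> closed_segment u v"
      then have "s \<in> cbox a1 a3" using seg[OF uv(1,2)] by auto
      moreover have "Im s = Im u"
        using s uv(3) by (simp add: closed_segment_same_Im)
      ultimately show "norm (f s) \<le> H"
        using uv(4) by (intro fH) (auto simp: a1_def a3_def in_cbox_complex_iff)
    qed
    also have "norm (v - u) = 2 - b"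
    proof -
      have "v - u = of_real (Re v - Re u)" using uv(3) by (simp add: complex_eq_iff)
      then show ?thesis using uv(5) by (simp only: norm_of_real abs_minus_commute)
    qed
    finally show ?thesis .
  qed
  have h: "norm (contour_integral (linepath a1 a2) f) \<le> H * (2 - b)"
    "norm (contour_integral (linepath a3 a4) f) \<le> H * (2 - b)"
    using b T by (intro hor corner; simp add: a1_def a2_def a3_def a4_def)+
  have left: "norm (contour_integral (linepath a4 a1) f) \<le> 8 * M * Y powr b"
  proof -
    have c4: "continuous_on (closed_segment a1 a4) f"
      by (rule continuous_on_subset[OF cont seg[OF corner(1,4)]])
    then have "contour_integral (linepath a4 a1) f = - contour_integral (linepath a1 a4) f"
      using contour_integral_reverse_linepath[of a1 a4 f] by simp
    also have "contour_integral (linepath a1 a4) f = \<i> * integral {- T..T} (\<lambda>x. f (Complex b x))"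
      by (rule contour_integral_linepath_same_Re) (use T in \<open>auto simp: a1_def a4_def\<close>)
    finally have "norm (contour_integral (linepath a4 a1) f) = norm (integral {- T..T} (\<lambda>x. f (Complex b x)))"
      by (simp add: norm_mult)
    also have "\<dots> \<le> integral {- T..T} (\<lambda>t. M * Y powr b * (1 + \<bar>t\<bar>) powr (- 5 / 4))"
    proof (rule integral_norm_bound_integral)
      have "f contour_integrable_on linepath a1 a4"
        by (rule contour_integrable_continuous_linepath[OF c4])
      then obtain J where "(f has_contour_integral J) (linepath a1 a4)"
        by (auto simp: contour_integrable_on_def)
      then have "((\<lambda>x. f (Complex b x)) has_integral (- \<i> * J)) {- T..T}"
        by (subst (asm) has_contour_integral_linepath_same_Re_iff[where c = b and a = "- T" and b = T])
          (use T in \<open>auto simp: a1_def a4_def\<close>)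
      then show "(\<lambda>x. f (Complex b x)) integrable_on {- T..T}" by (rule has_integral_integrable)
      show "(\<lambda>t. M * Y powr b * (1 + \<bar>t\<bar>) powr (- 5 / 4)) integrable_on {- T..T}"
        using integrable_on_cmult_left[OF integral_one_plus_abs_powr_le(1)[of T], of "M * Y powr b"] T by simp
      show "norm (f (Complex b t)) \<le> M * Y powr b * (1 + \<bar>t\<bar>) powr (- 5 / 4)" for t
        using bnd[of "Complex b t"] b by simp
    qed
    also have "\<dots> = M * Y powr b * integral {- T..T} (\<lambda>t. (1 + \<bar>t\<bar>) powr (- 5 / 4))"
      by (rule integral_mult_right)
    also have "\<dots> \<le> M * Y powr b * 8"
      using T M by (intro mult_left_mono integral_one_plus_abs_powr_le) auto
    finally show ?thesis by simp
  qed
  have "contour_integral (linepath a2 a3) f = - (contour_integral (linepath a4 a1) f +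
      (contour_integral (linepath a1 a2) f + contour_integral (linepath a3 a4) f))"
    using 0 split by (simp add: algebra_simps eq_neg_iff_add_eq_0)
  then have "norm (contour_integral (linepath a2 a3) f) \<le> 8 * M * Y powr b + (H * (2 - b) + H * (2 - b))"
    using norm_triangle_mono[OF left norm_triangle_mono[OF h]] by (simp only: norm_minus_cancel)
  also have "\<dots> = 8 * M * Y powr b + 2 * (2 - b) * (M * Y powr 2) * (1 + T) powr (- 5 / 4)"
    by (simp only: H_def) algebra
  finally show ?thesis by (simp only: a2_def a3_def)
qed

section \<open>Sine sums over reduced fractions\<close>

text \<open>For \<open>\<psi> = \<pi>/2 - \<pi> a / (q b)\<close> the rotation is \<open>a / b\<close> and \<open>cos \<psi> = sin (\<pi> a / (q b))\<close>. So this is the sum of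
  \<open>cos^2 \<psi>\<close> over the incidence angles whose rotation number has denominator \<open>b\<close>.\<close>
definition sine_sum :: "nat \<Rightarrow> nat \<Rightarrow> real" where
  "sine_sum q b = (\<Sum>a | a < q * b \<and> coprime a b. (sin (pi * real a / real (q * b)))\<^sup>2)"

lemma sine_sum_bounds: "0 \<le> sine_sum q b" "sine_sum q b \<le> real (q * b)"
proof -
  show "0 \<le> sine_sum q b" unfolding sine_sum_def by (intro sum_nonneg) auto
  have "sine_sum q b \<le> (\<Sum>a | a < q * b \<and> coprime a b. 1)"
    unfolding sine_sum_def by (intro sum_mono) (simp add: abs_square_le_1)
  also have "\<dots> \<le> (\<Sum>a<q * b. 1)" by (intro sum_mono2) auto
  finally show "sine_sum q b \<le> real (q * b)" by simp
qed

lemma sum_sin_squared: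
  assumes "N > 0"
  shows "(\<Sum>a<N. (sin (pi * real a / real N))\<^sup>2) = (real N - of_bool (N = 1)) / 2"
proof (cases "N = 1")
  case False
  then have N: "N \<ge> 2" using assms by simp
  define z where "z = cis (2 * pi / real N)"
  have "cos (2 * pi / real N) < cos 0"
    using N by (intro cos_monotone_0_pi) (auto simp: field_simps)
  then have "z \<noteq> 1" by (auto simp: z_def complex_eq_iff)
  then have "(\<Sum>a<N. z ^ a) = (z ^ N - 1) / (z - 1)" by (rule geometric_sum)
  also have "z ^ N = cis (real N * (2 * pi / real N))" unfolding z_def by (rule Complex.DeMoivre)
  also have "real N * (2 * pi / real N) = 2 * pi" using assms by simp
  finally have "(\<Sum>a<N. z ^ a) = 0" by simp
  then have "Re (\<Sum>a<N. z ^ a) = 0" by simp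
  then have c: "(\<Sum>a<N. cos (2 * (pi * real a / real N))) = 0"
    by (simp add: z_def Complex.DeMoivre mult_ac)
  have "(\<Sum>a<N. (sin (pi * real a / real N))\<^sup>2) = (\<Sum>a<N. (1 - cos (2 * (pi * real a / real N))) / 2)"
  proof (intro sum.cong refl)
    show "(sin y)\<^sup>2 = (1 - cos (2 * y)) / 2" for y :: real by (simp add: cos_double_sin)
  qed
  also have "\<dots> = (real N - (\<Sum>a<N. cos (2 * (pi * real a / real N)))) / 2"
    by (simp add: sum_subtractf flip: sum_divide_distrib)
  finally show ?thesis using False c by simp
qed simp

text \<open>Reducing the fractions \<open>a / b\<close> to lowest terms decomposes the set of all \<open>a < q b\<close> according to the
  reduced denominator \<open>d\<close>.\<close>
lemma sum_divisors_sine_sum: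
  assumes q: "q > 0" and b: "b > 0"
  shows "(\<Sum>d | d dvd b. sine_sum q d) = (real (q * b) - of_bool (q * b = 1)) / 2"
proof -
  define A where "A = (\<lambda>d. {a. a < q * d \<and> coprime a d})"
  have fin: "finite {d. d dvd b}" using b by simp
  have "(\<Sum>d | d dvd b. sine_sum q d) =
      (\<Sum>(d,a)\<in>Sigma {d. d dvd b} A. (sin (pi * real a / real (q * d)))\<^sup>2)"
    unfolding sine_sum_def A_def using fin by (subst sum.Sigma) auto
  also have "\<dots> = (\<Sum>a<q * b. (sin (pi * real a / real (q * b)))\<^sup>2)"
  proof (rule sum.reindex_bij_witness[where i = "\<lambda>a. (b div gcd a b, a div gcd a b)"
        and j = "\<lambda>(d,a). a * (b div d)"])
    fix x assume x: "x \<in> Sigma {d. d dvd b} A"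
    obtain d a where da: "x = (d, a)" by (cases x)
    obtain e where e: "b = d * e" using x da by (auto elim: dvdE)
    have pos: "d > 0" "e > 0" using e b by auto
    have a: "a < q * d" "coprime a d" using x da by (auto simp: A_def)
    have g: "gcd (a * e) (d * e) = e" using gcd_mult_distrib_nat[of e a d] a(2) by (simp add: mult.commute)
    show "(case x of (d, a) \<Rightarrow> a * (b div d)) \<in> {..<q * b}"
      using a(1) pos by (simp add: da e)
    show "(b div gcd (case x of (d, a) \<Rightarrow> a * (b div d)) b,
         (case x of (d, a) \<Rightarrow> a * (b div d)) div gcd (case x of (d, a) \<Rightarrow> a * (b div d)) b) = x"
      using pos g by (simp add: da e)
    show "(sin (pi * real (case x of (d, a) \<Rightarrow> a * (b div d)) / real (q * b)))\<^sup>2 =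
         (case x of (d, a) \<Rightarrow> (sin (pi * real a / real (q * d)))\<^sup>2)"
      using pos q by (simp add: da e field_simps)
  next
    fix a assume a: "a \<in> {..<q * b}"
    define g where "g = gcd a b"
    have g: "g > 0" using b by (simp add: g_def)
    have "g dvd a" "g dvd b" by (simp_all add: g_def)
    then obtain a' b' where ab: "a = a' * g" "b = b' * g"
      by (metis dvd_def mult.commute)
    have cop: "coprime a' b'"
    proof -
      have "g * gcd a' b' = gcd (g * a') (g * b')" by (rule gcd_mult_distrib_nat)
      also have "\<dots> = g * 1" unfolding mult.commute[of g] ab[symmetric] by (simp add: g_def)
      finally show ?thesis using g by (simp add: coprime_iff_gcd_eq_1)
    qed
    show "(b div gcd a b, a div gcd a b) \<in> Sigma {d. d dvd b} A"
      unfolding g_def[symmetric] using g a cop by (auto simp: A_def ab)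
    show "(case (b div gcd a b, a div gcd a b) of (d, a) \<Rightarrow> a * (b div d)) = a"
      unfolding g_def[symmetric] using g b by (auto simp: ab)
  qed
  also have "\<dots> = (real (q * b) - of_bool (q * b = 1)) / 2"
    using q b by (intro sum_sin_squared) simp
  finally show ?thesis .
qed

definition hole_coeff :: "nat \<Rightarrow> nat \<Rightarrow> real" where
  "hole_coeff q n = 2 * sine_sum q n / real (q * n)"

lemma hole_coeff_bounds: "0 \<le> hole_coeff q n" "hole_coeff q n \<le> 2"
  using sine_sum_bounds[of q n] by (auto simp: hole_coeff_def divide_le_eq zero_le_divide_iff)

text \<open>Convolution with \<open>\<zeta>(s + 1)\<close> replaces \<open>sine_sum\<close> by its divisor sums, which are \<open>q n / 2\<close> except when
  \<open>q n = 1\<close>. That exception accounts for the term \<open>[q = 1]\<close>.\<close>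
lemma hole_coeff_dirichlet_series:
  assumes q: "q > 0" and s: "Re s > 1"
  shows "zeta_series (s + 1) * (\<Sum>n. of_real (hole_coeff q (Suc n)) * of_nat (Suc n) powr (- s)) =
     zeta_series s - of_bool (q = 1)"
proof -
  define v where "v = (\<lambda>d. of_real (2 * sine_sum q d / real q) :: complex)"
  have shift: "v (Suc n) * of_nat (Suc n) powr (- (s + 1)) =
      of_real (hole_coeff q (Suc n)) * of_nat (Suc n) powr (- s)" for n
  proof -
    have "(of_nat (Suc n) :: complex) powr (- (s + 1)) = of_nat (Suc n) powr (- s) / of_nat (Suc n)"
      using powr_diff[of "of_nat (Suc n) :: complex" "- s" 1] by (simp del: of_nat_Suc)
    moreover have "of_real (hole_coeff q (Suc n)) = v (Suc n) / of_nat (Suc n)"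
      using q by (simp add: v_def hole_coeff_def del: of_nat_Suc mult_Suc_right)
    ultimately show ?thesis by simp
  qed
  have sm: "summable (\<lambda>n. norm (v (Suc n) * of_nat (Suc n) powr (- (s + 1))))"
    unfolding shift
  proof (rule summable_comparison_test'[where N = 0])
    show "summable (\<lambda>n. 2 * real (Suc n) powr (- Re s))"
      using s by (intro summable_mult summable_Suc_powr) auto
    show "norm (norm (of_real (hole_coeff q (Suc n)) * of_nat (Suc n) powr (- s) :: complex)) \<le>
        2 * real (Suc n) powr (- Re s)" for n
      using hole_coeff_bounds[of q "Suc n"]
      by (simp add: norm_mult norm_nat_powr mult_right_mono del: of_nat_Suc)
  qed
  have s1: "Re (s + 1) > 1" using s by simp
  from dirichlet_convolution_sums[OF s1 sm]
  have A: "(\<lambda>n. (\<Sum>d | d dvd Suc n. v d) * of_nat (Suc n) powr (- (s + 1))) sums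
      (zeta_series (s + 1) * (\<Sum>n. of_real (hole_coeff q (Suc n)) * of_nat (Suc n) powr (- s)))"
    unfolding shift .
  have coeff: "(\<Sum>d | d dvd Suc n. v d) * of_nat (Suc n) powr (- (s + 1)) =
      of_nat (Suc n) powr (- s) - (if n = 0 then of_bool (q = 1) else 0)" for n
  proof -
    have "(\<Sum>d | d dvd Suc n. v d) = of_real (2 / real q * (\<Sum>d | d dvd Suc n. sine_sum q d))"
      by (simp add: v_def sum_distrib_left)
    also have "2 / real q * (\<Sum>d | d dvd Suc n. sine_sum q d) = real (Suc n) - (if n = 0 then of_bool (q = 1) else 0)"
    proof -
      have "q * Suc n = 1 \<longleftrightarrow> n = 0 \<and> q = 1" by (simp only: nat_mult_eq_1_iff) auto
      then show ?thesis
        using q sum_divisors_sine_sum[OF q, of "Suc n"] by (auto simp: field_simps simp del: mult_Suc_right)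
    qed
    finally have e: "(\<Sum>d | d dvd Suc n. v d) = of_nat (Suc n) - (if n = 0 then of_bool (q = 1) else 0)"
      by simp
    have "(of_nat (Suc n) :: complex) powr (- (s + 1)) = of_nat (Suc n) powr (- s) / of_nat (Suc n)"
      using powr_diff[of "of_nat (Suc n) :: complex" "- s" 1] by (simp del: of_nat_Suc)
    then show ?thesis unfolding e
      by (cases "n = 0") (simp, simp add: field_simps del: of_nat_Suc)
  qed
  have "(\<lambda>n. of_nat (Suc n) powr (- s) - (if n = 0 then of_bool (q = 1) else 0)) sums
      (zeta_series s - of_bool (q = 1))"
    using sums_single[of 0 "\<lambda>_. of_bool (q = 1) :: complex"] by (intro sums_diff zeta_series_sums s) simp
  then show ?thesis using A unfolding coeff by (rule sums_unique2[symmetric])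
qed

section \<open>Square-root cancellation for the difference of hole sums\<close>

text \<open>For \<open>x = q \<Delta> / (2 \<pi>)\<close> this is the limit of \<open>t P_q(t, \<Delta>)\<close> up to the factor \<open>\<pi> / 2\<close>. Only the finitely many
  denominators \<open>b\<close> with \<open>b x < 1\<close>, for which the translates of the hole leave gaps, contribute.\<close>
definition hole_sum :: "nat \<Rightarrow> real \<Rightarrow> real" where
  "hole_sum q x = (\<Sum>n. hole_coeff q (Suc n) * (max 0 (1 - real (Suc n) * x))\<^sup>2)"

text \<open>The exponents add up to \<open>3/2 + (1/4 - 1) - 2 = -5/4\<close>: the numerator, the reciprocal of \<open>\<zeta>(s + 1)\<close>, and the kernel
  without the factor \<open>1 / s\<close>, which is absorbed in \<open>zeta_scaled (s + 1) = s \<zeta>(s + 1)\<close>.\<close>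
lemma mellin_integrand_bound:
  assumes RH: riemann_hypothesis and q: "q > 0" and \<delta>: "0 < \<delta>" "\<delta> < 1 / 2"
  defines "G \<equiv> \<lambda>s. (poleless_zeta q s - 1) * inverse (zeta_scaled (s + 1)) * (2 / ((s + 1) * (s + 2)))"
  shows "\<exists>M\<ge>0. \<forall>s. - 1 / 2 + \<delta> \<le> Re s \<and> Re s \<le> 2 \<longrightarrow> norm (G s) \<le> M * (1 + \<bar>Im s\<bar>) powr (- 5 / 4)"
proof -
  define b where "b = - 1 / 2 + \<delta>"
  have b: "b > - 1 / 2" using \<delta> by (simp add: b_def)
  obtain C where C: "C > 0" "\<And>s. Re s \<ge> b \<Longrightarrow> norm (poleless_zeta q s) \<le> C * (1 + norm s) powr (3 / 2)"
    using poleless_zeta_bound[OF q b] by auto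
  obtain D where D: "D > 0" "\<And>s. 1 / 2 + \<delta> \<le> Re s \<Longrightarrow> Re s \<le> 4 \<Longrightarrow>
      norm (inverse (zeta_scaled s)) \<le> D * (1 + norm s) powr (1 / 4 - 1)"
    using zeta_scaled_inverse_bound[OF RH, of \<delta> "1 / 4"] \<delta> by auto
  (* 98 = 2 * 7^2, because 1 + norm s is at most 7 * norm (s + j) for j = 1, 2. *)
  define M where "M = (C + 1) * (2 * D) * 98"
  show ?thesis
  proof (intro exI[of _ M] conjI allI impI)
    show "M \<ge> 0" using C D by (simp add: M_def)
    fix s assume s: "- 1 / 2 + \<delta> \<le> Re s \<and> Re s \<le> 2"
    define N where "N = 1 + norm s"
    have N: "N \<ge> 1" by (simp add: N_def)
    have h: "norm (poleless_zeta q s - 1) \<le> (C + 1) * N powr (3 / 2)"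
    proof -
      have "norm (poleless_zeta q s - 1) \<le> C * N powr (3 / 2) + 1"
        using norm_triangle_ineq4[of "poleless_zeta q s" 1] C(2)[of s] s by (simp add: b_def N_def)
      also have "1 \<le> N powr (3 / 2)" using N by (intro ge_one_powr_ge_zero) auto
      finally show ?thesis by (simp add: distrib_right)
    qed
    have i: "norm (inverse (zeta_scaled (s + 1))) \<le> 2 * D * N powr (- 3 / 4)"
    proof -
      have "norm (inverse (zeta_scaled (s + 1))) \<le> D * (1 + norm (s + 1)) powr (1 / 4 - 1)"
        using s by (intro D(2)) auto
      also have "\<dots> \<le> D * (N / 2) powr (- 3 / 4)"
      proof -
        define m where "m = norm (s + 1)"
        have "norm s \<le> m + 1" using norm_triangle_ineq4[of "s + 1" 1] by (simp add: m_def)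
        moreover have "m \<ge> 0" by (simp add: m_def)
        ultimately have "N / 2 \<le> 1 + m" by (simp add: N_def)
        then have "N / 2 \<le> 1 + norm (s + 1)" by (simp only: m_def)
        then show ?thesis using D N by (intro mult_left_mono) (auto intro!: powr_mono2')
      qed
      also have "(N / 2) powr (- 3 / 4) = N powr (- 3 / 4) * (1 / 2) powr (- 3 / 4)"
        using N powr_mult[of N "1 / 2" "- 3 / 4"] by simp
      also have "D * (N powr (- 3 / 4) * (1 / 2) powr (- 3 / 4)) \<le> D * (N powr (- 3 / 4) * 2)"
      proof (intro mult_left_mono)
        have "(1 / 2 :: real) powr (- 3 / 4) \<le> (1 / 2) powr (- 1)" by (intro powr_mono') auto
        then show "(1 / 2 :: real) powr (- 3 / 4) \<le> 2" by (simp add: powr_minus)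
      qed (use D in auto)
      finally show ?thesis by (simp only: mult_ac)
    qed
    have k: "norm (2 / ((s + 1) * (s + 2))) \<le> 98 * N powr (- 2)"
    proof -
      have "N \<le> 7 * norm (s + of_real j)" if "1 \<le> j" "j \<le> 2" for j
      proof -
        have "Re s + j \<ge> 1 / 2" using s that \<delta> by simp
        then have "norm (s + of_real j) \<ge> 1 / 2" using abs_Re_le_cmod[of "s + of_real j"] by simp
        moreover have "norm s \<le> norm (s + of_real j) + j"
          using norm_triangle_ineq4[of "s + of_real j" "of_real j"] that by simp
        ultimately show ?thesis using that by (simp add: N_def)
      qed
      from this[of 1] this[of 2] have "N * N \<le> (7 * norm (s + 1)) * (7 * norm (s + 2))"
        using N by (intro mult_mono) auto
      then have "N ^ 2 \<le> 49 * norm ((s + 1) * (s + 2))" by (simp add: norm_mult power2_eq_square)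
      moreover have "N ^ 2 > 0" using N by simp
      ultimately have "2 / norm ((s + 1) * (s + 2)) \<le> 98 / N ^ 2"
        by (simp add: divide_simps split: if_splits)
      moreover have "N powr (- 2) = 1 / N ^ 2" using N by (simp add: powr_minus powr_numeral inverse_eq_divide)
      ultimately show ?thesis by (simp add: norm_divide)
    qed
    have "norm (G s) \<le> ((C + 1) * N powr (3 / 2)) * (2 * D * N powr (- 3 / 4)) * (98 * N powr (- 2))"
      unfolding G_def norm_mult using C D
      by (intro mult_mono h i k[unfolded norm_mult norm_divide] mult_nonneg_nonneg) (use k in \<open>auto simp: norm_divide norm_mult\<close>)
    also have "\<dots> = M * (N powr (3 / 2) * N powr (- 3 / 4) * N powr (- 2))" by (simp add: M_def)
    also have "N powr (3 / 2) * N powr (- 3 / 4) * N powr (- 2) = N powr (- 5 / 4)"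
      by (simp flip: powr_add)
    also have "M * N powr (- 5 / 4) \<le> M * (1 + \<bar>Im s\<bar>) powr (- 5 / 4)"
      using C D abs_Im_le_cmod[of s]
      by (intro mult_left_mono powr_mono2') (auto simp: M_def N_def)
    finally show "norm (G s) \<le> M * (1 + \<bar>Im s\<bar>) powr (- 5 / 4)" .
  qed
qed

lemma summable_hole_coeff: "summable (\<lambda>n. \<bar>hole_coeff q (Suc n)\<bar> * real (Suc n) powr (- 2))"
proof (rule summable_comparison_test'[where N = 0])
  show "summable (\<lambda>n. 2 * real (Suc n) powr (- 2))"
    by (intro summable_mult summable_Suc_powr) auto
  show "norm (\<bar>hole_coeff q (Suc n)\<bar> * real (Suc n) powr (- 2)) \<le> 2 * real (Suc n) powr (- 2)" for n
    using hole_coeff_bounds[of q "Suc n"] by (simp add: abs_mult mult_right_mono del: of_nat_Suc)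
qed

text \<open>Rescaling \<open>Y\<close> to \<open>Y / q\<close> and multiplying by \<open>q\<close> contributes the factor \<open>q^(1 - s)\<close>.\<close>
lemma mellin_integrand_eq:
  assumes q: "q \<ge> 2" and Y: "Y > 0" and s: "Re s > 1"
  defines "D \<equiv> \<lambda>r s. (\<Sum>n. of_real (hole_coeff r (Suc n)) * of_nat (Suc n) powr (- s))"
  shows "D 1 s * of_real Y powr s * perron_kernel s - of_nat q * (D q s * of_real (Y / real q) powr s * perron_kernel s)
     = of_real Y powr s * ((poleless_zeta q s - 1) * inverse (zeta_scaled (s + 1)) * (2 / ((s + 1) * (s + 2))))"
proof -
  define z where "z = zeta_series (s + 1)"
  have s1: "Re (s + 1) > 1" using s by simp
  have z0: "z \<noteq> 0" using riemann_zeta_nonzero_Re_gt_1[OF s1] riemann_zeta_eq_series[OF s1] by (simp add: z_def)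
  have sn: "s \<noteq> 0" using s by auto
  have zs: "zeta_scaled (s + 1) = s * z"
    using zeta_scaled_eq[of "s + 1"] s1 sn riemann_zeta_eq_series[OF s1] by (simp add: z_def)
  have D1: "D 1 s = (zeta_series s - 1) / z"
    using hole_coeff_dirichlet_series[of 1 s] s z0 by (simp add: D_def z_def field_simps)
  have Dq: "D q s = zeta_series s / z"
    using hole_coeff_dirichlet_series[of q s] s z0 q by (simp add: D_def z_def field_simps)
  have Yq: "of_real (Y / real q) powr s = of_real Y powr s * of_nat q powr (- s)"
  proof -
    have "(of_real (Y / real q) :: complex) powr s = of_real Y powr s * of_real (inverse (real q)) powr s"
      using Y powr_times_real[of "of_real Y" "of_real (inverse (real q))" s] q
      by (simp add: divide_inverse)
    also have "(of_real (inverse (real q)) :: complex) powr s = of_nat q powr (- s)"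
    proof -
      have "Ln (of_real (inverse (real q))) = - Ln (of_nat q :: complex)"
        using q by (simp add: Ln_of_real Ln_of_nat ln_inverse del: of_real_inverse)
      then show ?thesis using q by (simp add: powr_def)
    qed
    finally show ?thesis .
  qed
  have k: "perron_kernel s = 1 / s * (2 / ((s + 1) * (s + 2)))"
    by (simp add: perron_kernel_def)
  have H: "poleless_zeta q s = (1 - of_nat q * of_nat q powr (- s)) * zeta_series s"
    using q s by (intro poleless_zeta_eq) auto
  have "D 1 s * of_real Y powr s * perron_kernel s - of_nat q * (D q s * of_real (Y / real q) powr s * perron_kernel s)
     = of_real Y powr s * perron_kernel s * (D 1 s - of_nat q * of_nat q powr (- s) * D q s)"
    unfolding Yq by (simp add: algebra_simps)
  also have "D 1 s - of_nat q * of_nat q powr (- s) * D q s = (poleless_zeta q s - 1) / z"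
    unfolding D1 Dq H using z0 by (simp add: field_simps)
  finally show ?thesis unfolding k zs by (simp add: divide_inverse mult_ac)
qed

text \<open>Write the difference as an integral over \<open>Re s = 2\<close> with \<open>Y = 1 / x\<close>, and move the line of integration to
  \<open>Re s = -1/2 + \<delta>\<close>, where \<open>Y^s\<close> has size \<open>x^(1/2 - \<delta>)\<close>.\<close>
theorem hole_sum_difference_bound:
  assumes RH: riemann_hypothesis and q: "q \<ge> 2" and \<delta>: "0 < \<delta>" "\<delta> < 1 / 2"
  shows "\<exists>C. \<forall>x. 0 < x \<and> x \<le> 1 \<longrightarrow>
     \<bar>hole_sum 1 x - real q * hole_sum q (real q * x)\<bar> \<le> C * x powr (1 / 2 - \<delta>)"
proof -
  define b where "b = - 1 / 2 + \<delta>"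
  have b: "- 1 / 2 < b" "b < 0" using \<delta> by (auto simp: b_def)
  define G where "G = (\<lambda>s. (poleless_zeta q s - 1) * inverse (zeta_scaled (s + 1)) * (2 / ((s + 1) * (s + 2))))"
  obtain M where M: "M \<ge> 0" "\<And>s. b \<le> Re s \<Longrightarrow> Re s \<le> 2 \<Longrightarrow> norm (G s) \<le> M * (1 + \<bar>Im s\<bar>) powr (- 5 / 4)"
    using mellin_integrand_bound[OF RH _ \<delta>, of q] q unfolding G_def b_def by auto
  define S where "S = {s. Re s > - 1 / 2}"
  have holG: "G holomorphic_on S"
  proof -
    have "s + 1 \<noteq> 0" "s + 2 \<noteq> 0" if "s \<in> S" for s
      using that by (auto simp: S_def add_eq_0_iff2)
    moreover have "zeta_scaled (s + 1) \<noteq> 0" if "s \<in> S" for s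
      using that by (intro zeta_scaled_nonzero[OF RH]) (simp add: S_def)
    moreover have "poleless_zeta q holomorphic_on S"
      using poleless_zeta_holomorphic[of q] q by (simp add: S_def)
    moreover have "(\<lambda>s. zeta_scaled (s + 1)) holomorphic_on S"
      by (intro holomorphic_on_compose_gen[OF _ zeta_scaled_holomorphic, unfolded o_def] holomorphic_intros)
         (auto simp: S_def)
    ultimately show ?thesis unfolding G_def by (intro holomorphic_intros) auto
  qed
  show ?thesis
  proof (intro exI[of _ "8 * M"] allI impI)
    fix x :: real assume x: "0 < x \<and> x \<le> 1"
    define Y where "Y = 1 / x"
    have Y: "Y \<ge> 1" using x by (simp add: Y_def)
    define f where "f = (\<lambda>s. of_real Y powr s * G s)"
    define D where "D = (\<lambda>r s. (\<Sum>n. of_real (hole_coeff r (Suc n)) * of_nat (Suc n) powr (- s)) :: complex)"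
    define F where "F = (\<lambda>r Z s. D r s * of_real Z powr s * perron_kernel s)"
    define h where "h = hole_sum 1 x - real q * hole_sum q (real q * x)"
    have P: "\<exists>K. \<forall>T\<ge>4. F r Z contour_integrable_on linepath (Complex 2 (- T)) (Complex 2 T) \<and>
       norm (contour_integral (linepath (Complex 2 (- T)) (Complex 2 T)) (F r Z)
         - 2 * pi * \<i> * of_real (hole_sum r (1 / Z))) \<le> K / T\<^sup>2" if "Z > 0" for r Z
      using perron_formula_dirichlet[OF summable_hole_coeff that, of r]
      unfolding F_def D_def hole_sum_def by (simp only: times_divide_eq_right mult_1_right)
    have "1 / Y = x" "1 / (Y / real q) = real q * x" using x q by (auto simp: Y_def)
    with P[of Y 1] P[of "Y / real q" q] Y q obtain K1 K2 where
      K1: "\<And>T. T \<ge> 4 \<Longrightarrow> F 1 Y contour_integrable_on linepath (Complex 2 (- T)) (Complex 2 T) \<and>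
       norm (contour_integral (linepath (Complex 2 (- T)) (Complex 2 T)) (F 1 Y)
         - 2 * pi * \<i> * of_real (hole_sum 1 x)) \<le> K1 / T\<^sup>2" and
      K2: "\<And>T. T \<ge> 4 \<Longrightarrow> F q (Y / real q) contour_integrable_on linepath (Complex 2 (- T)) (Complex 2 T) \<and>
       norm (contour_integral (linepath (Complex 2 (- T)) (Complex 2 T)) (F q (Y / real q))
         - 2 * pi * \<i> * of_real (hole_sum q (real q * x))) \<le> K2 / T\<^sup>2"
      by auto
    have holf: "f holomorphic_on S" unfolding f_def using Y by (intro holomorphic_intros holG) auto
    have main: "norm (2 * pi * \<i> * of_real h) \<le> 8 * M * Y powr b +
        2 * (2 - b) * (M * Y powr 2) * (1 + T) powr (- 5 / 4) + (K1 + real q * K2) / T\<^sup>2" if T: "T \<ge> 4" for T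
    proof -
      let ?L = "linepath (Complex 2 (- T)) (Complex 2 T)"
      have "contour_integral ?L f = contour_integral ?L (\<lambda>s. F 1 Y s - of_nat q * F q (Y / real q) s)"
      proof (rule contour_integral_cong[OF refl])
        fix s assume "s \<in> path_image ?L"
        then have "Re s = 2" using T by (auto simp: closed_segment_same_Re)
        then show "f s = F 1 Y s - of_nat q * F q (Y / real q) s"
          unfolding f_def F_def D_def G_def using q Y by (subst mellin_integrand_eq) auto
      qed
      also have "\<dots> = contour_integral ?L (F 1 Y) - of_nat q * contour_integral ?L (F q (Y / real q))"
        using K1[OF T] K2[OF T]
        by (simp add: contour_integral_diff contour_integrable_lmul contour_integral_lmul)
      finally have I: "contour_integral ?L f = \<dots>" .
      define u v where "u = contour_integral ?L (F 1 Y) - 2 * pi * \<i> * of_real (hole_sum 1 x)"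
        and "v = of_nat q * (contour_integral ?L (F q (Y / real q)) - 2 * pi * \<i> * of_real (hole_sum q (real q * x)))"
      have u: "norm u \<le> K1 / T\<^sup>2" using K1[OF T] by (simp add: u_def)
      have v: "norm v \<le> real q * (K2 / T\<^sup>2)"
        unfolding v_def norm_mult norm_of_nat using K2[OF T] by (intro mult_left_mono) auto
      have "2 * pi * \<i> * of_real h = contour_integral ?L f - (u - v)"
        unfolding I h_def u_def v_def by (simp add: algebra_simps)
      also have "norm \<dots> \<le> norm (contour_integral ?L f) + (norm u + norm v)"
        by (rule order.trans[OF norm_triangle_ineq4 add_left_mono[OF norm_triangle_ineq4]])
      also have "\<dots> \<le> norm (contour_integral ?L f) + (K1 / T\<^sup>2 + real q * (K2 / T\<^sup>2))"
        by (intro add_left_mono add_mono u v)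
      also have "norm (contour_integral ?L f) \<le> 8 * M * Y powr b +
          2 * (2 - b) * (M * Y powr 2) * (1 + T) powr (- 5 / 4)"
      proof (rule contour_shift_bound[OF holf _ _ Y M(1)])
        show "{s. b \<le> Re s \<and> Re s \<le> 2} \<subseteq> S" using b by (auto simp: S_def)
        show "norm (f s) \<le> M * Y powr Re s * (1 + \<bar>Im s\<bar>) powr (- 5 / 4)" if "b \<le> Re s" "Re s \<le> 2" for s
        proof -
          have "norm (f s) = Y powr Re s * norm (G s)"
            using Y by (simp add: f_def norm_mult norm_powr_real_powr)
          also have "\<dots> \<le> Y powr Re s * (M * (1 + \<bar>Im s\<bar>) powr (- 5 / 4))"
            by (intro mult_left_mono M that) auto
          finally show ?thesis by (simp only: mult_ac)
        qed
      qed (use b T in auto)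
      finally show ?thesis by (simp add: add_divide_distrib)
    qed
    have lim: "((\<lambda>T. 8 * M * Y powr b + 2 * (2 - b) * (M * Y powr 2) * (1 + T) powr (- 5 / 4) + (K1 + real q * K2) / T\<^sup>2)
        \<longlongrightarrow> 8 * M * Y powr b + 2 * (2 - b) * (M * Y powr 2) * 0 + 0) at_top"
      by (intro tendsto_intros; real_asymp)
    have "norm (2 * pi * \<i> * of_real h) \<le> 8 * M * Y powr b + 2 * (2 - b) * (M * Y powr 2) * 0 + 0"
      by (rule tendsto_lowerbound[OF lim eventually_mono[OF eventually_ge_at_top[of 4] main]]) simp_all
    then have "norm (2 * pi * \<i> * of_real h) \<le> 8 * M * Y powr b" by simp
    then have "2 * pi * \<bar>h\<bar> \<le> 8 * M * Y powr b" by (simp add: norm_mult)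
    moreover have "1 * \<bar>h\<bar> \<le> 2 * pi * \<bar>h\<bar>" using pi_gt3 by (intro mult_right_mono) auto
    moreover have "Y powr b = x powr (1 / 2 - \<delta>)"
    proof -
      have "Y powr b = x powr (- b)" using x by (simp add: Y_def powr_minus powr_divide inverse_eq_divide)
      then show ?thesis by (simp add: b_def)
    qed
    ultimately show "\<bar>hole_sum 1 x - real q * hole_sum q (real q * x)\<bar> \<le> 8 * M * x powr (1 / 2 - \<delta>)"
      by (simp add: h_def)
  qed
qed

section \<open>Survival under a circle rotation\<close>

definition rotation_hits :: "real \<Rightarrow> real \<Rightarrow> real \<Rightarrow> nat \<Rightarrow> bool" where
  "rotation_hits \<epsilon> u \<rho> i \<longleftrightarrow> (\<exists>m::int. \<bar>u + real i * \<rho> - of_int m\<bar> \<le> \<epsilon>)"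

lemma rotation_hits_uminus: "rotation_hits \<epsilon> (- u) (- \<rho>) i \<longleftrightarrow> rotation_hits \<epsilon> u \<rho> i"
proof -
  have *: "rotation_hits \<epsilon> (- u) (- \<rho>) i" if "rotation_hits \<epsilon> u \<rho> i" for u \<rho>
  proof -
    from that obtain m :: int where "\<bar>u + real i * \<rho> - of_int m\<bar> \<le> \<epsilon>"
      by (auto simp: rotation_hits_def)
    then show ?thesis unfolding rotation_hits_def
      by (intro exI[of _ "- m"]) (simp add: abs_le_iff)
  qed
  from *[of u \<rho>] *[of "- u" "- \<rho>"] show ?thesis by auto
qed

text \<open>A point at distance \<open>d\<close> before the interval of radius \<open>\<epsilon>\<close> around \<open>c / b\<close>, and thus in a gap, needs more than
  \<open>T\<close> steps of drift \<open>\<eta>\<close> to reach it. Until then all its iterates lie in translates of the same gap.\<close>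
lemma rotation_survives:
  fixes a c :: int and b :: nat
  assumes b: "b > 0" and \<eta>: "\<eta> \<ge> 0" and \<rho>: "\<rho> = of_int a / real b + \<eta>"
    and u: "u = of_int c / real b - \<epsilon> - d"
    and d: "T * \<eta> < d" "d < 1 / real b - 2 * \<epsilon>" and i: "real i \<le> T"
  shows "\<not> rotation_hits \<epsilon> u \<rho> i"
proof
  assume "rotation_hits \<epsilon> u \<rho> i"
  then obtain m :: int where m: "\<bar>u + real i * \<rho> - of_int m\<bar> \<le> \<epsilon>" by (auto simp: rotation_hits_def)
  define k where "k = c + int i * a - m * int b"
  have eq: "u + real i * \<rho> - of_int m = of_int k / real b - \<epsilon> - d + real i * \<eta>"
    using b by (simp add: u \<rho> k_def field_simps)
  have i\<eta>: "0 \<le> real i * \<eta>" "real i * \<eta> \<le> T * \<eta>" using i \<eta> by (auto intro: mult_right_mono)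
  show False
  proof (cases "k \<ge> 1")
    case True
    then have "1 / real b \<le> of_int k / real b" using b by (intro divide_right_mono) auto
    then show False using m i\<eta> d unfolding eq by linarith
  next
    case False
    then have "of_int k / real b \<le> 0" using b by (intro divide_nonpos_pos) auto
    then show False using m i\<eta> d unfolding eq by linarith
  qed
qed

lemma int_cong_solution:
  fixes a c :: int and b :: nat
  assumes "b > 0" "coprime a (int b)"
  shows "\<exists>i<b. \<exists>m. c + int i * a = m * int b"
proof -
  from assms(2) obtain x where x: "[a * x = 1] (mod int b)"
    using cong_solve_coprime_int by blast
  define i where "i = nat ((- c * x) mod int b)"
  have i: "int i = (- c * x) mod int b" using assms(1) by (simp add: i_def)
  have "[int i * a = - c * x * a] (mod int b)"
    unfolding i by (intro cong_mult cong_refl) (simp add: cong_def)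
  also have "- c * x * a = - c * (a * x)" by simp
  also have "[- c * (a * x) = - c * 1] (mod int b)" by (intro cong_mult cong_refl x)
  finally have "[c + int i * a = c + - c * 1] (mod int b)" by (intro cong_add cong_refl)
  then have "int b dvd c + int i * a" by (simp add: cong_iff_dvd_diff)
  moreover have "int i < int b" unfolding i using assms(1) by simp
  ultimately show ?thesis by (auto simp: dvd_def mult.commute)
qed

text \<open>Here \<open>d\<close> ranges over a full period, so the point may also start inside the preceding translate of the hole. Every
  \<open>b\<close> steps the orbit returns to the copy of the gap that precedes the actual hole, having moved by
  \<open>b \<eta> \<le> 2 \<epsilon>\<close>, which is too little to jump over the hole. So it falls into the hole at most \<open>b\<close> steps
  after it has drifted by \<open>d\<close>. If it starts inside a translate of the hole, more than \<open>b \<eta>\<close> before the end of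
  it, then it falls into the hole within the first \<open>b\<close> steps.\<close>
lemma rotation_survives_imp:
  fixes a c :: int and b :: nat
  assumes b: "b > 0" and ab: "coprime a (int b)" and \<eta>: "\<eta> \<ge> 0"
    and \<rho>: "\<rho> = of_int a / real b + \<eta>" and small: "real b * \<eta> \<le> 2 * \<epsilon>" and T: "T \<ge> real b"
    and u: "u = of_int c / real b - \<epsilon> - d" and d: "0 \<le> d" "d \<le> 1 / real b"
    and surv: "\<And>i. real i \<le> T \<Longrightarrow> \<not> rotation_hits \<epsilon> u \<rho> i"
  shows "(T - real b) * \<eta> \<le> d" and "d \<le> 1 / real b - 2 * \<epsilon> + real b * \<eta>"
proof -
  show "(T - real b) * \<eta> \<le> d"
  proof (rule ccontr)
    assume "\<not> (T - real b) * \<eta> \<le> d"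
    then have less: "d < (T - real b) * \<eta>" by simp
    then have \<eta>0: "\<eta> > 0" using d \<eta> by (cases "\<eta> = 0") auto
    obtain i0 m where i0: "i0 < b" "c + int i0 * a = m * int b"
      using int_cong_solution[OF b ab] by blast
    define P where "P = (\<lambda>j. d \<le> real (i0 + j * b) * \<eta>)"
    have "\<exists>j. P j"
    proof -
      obtain j :: nat where "d / \<eta> \<le> real j" using real_arch_simple by blast
      then have "d \<le> real j * \<eta>" using \<eta>0 by (simp add: field_simps)
      also have "\<dots> \<le> real (i0 + j * b) * \<eta>"
        using b \<eta>0 by (intro mult_right_mono) (auto simp flip: of_nat_mult of_nat_add intro: trans_le_add2)
      finally show ?thesis by (auto simp: P_def)
    qed
    (* The first return to the right copy of the gap after drifting by at least d. *)
    define j where "j = (LEAST j. P j)"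
    have Pj: "P j" unfolding j_def by (rule LeastI_ex) fact
    define i where "i = i0 + j * b"
    have hi: "d \<le> real i * \<eta>" using Pj by (simp add: P_def i_def)
    have lo: "real i * \<eta> \<le> d + 2 * \<epsilon> \<and> real i \<le> T"
    proof (cases j)
      case 0
      have "real i0 \<le> real b" using i0(1) by simp
      then have "real i0 * \<eta> \<le> real b * \<eta>" "real i0 \<le> T" using \<eta> T by (auto intro: mult_right_mono)
      then show ?thesis using 0 small d by (simp add: i_def)
    next
      case (Suc j')
      have "\<not> P j'" using not_less_Least[of j' P] Suc by (simp add: j_def)
      then have "(real i - real b) * \<eta> < d" by (simp add: P_def i_def Suc algebra_simps)
      moreover from this have "(real i - real b) * \<eta> < (T - real b) * \<eta>" using less by linarith
      then have "real i - real b < T - real b" using \<eta>0 by (simp add: mult_less_cancel_right)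
      ultimately show ?thesis using small by (simp add: algebra_simps)
    qed
    define m' where "m' = m + int j * a"
    have "c + int i * a = m' * int b" using i0(2) by (simp add: i_def m'_def algebra_simps)
    then have "of_int c + real i * of_int a = of_int m' * real b" by (metis of_int_add of_int_mult of_int_of_nat_eq)
    then have "(of_int c + real i * of_int a) / real b = of_int m'" using b by simp
    then have "u + real i * \<rho> - of_int m' = - \<epsilon> - d + real i * \<eta>"
      by (simp add: u \<rho> add_divide_distrib algebra_simps)
    then have "rotation_hits \<epsilon> u \<rho> i"
      unfolding rotation_hits_def using hi lo by (intro exI[of _ m']) (simp add: abs_le_iff)
    with surv lo show False by blast
  qed
  show "d \<le> 1 / real b - 2 * \<epsilon> + real b * \<eta>"
  proof (rule ccontr)
    assume "\<not> d \<le> 1 / real b - 2 * \<epsilon> + real b * \<eta>"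
    then have less: "1 / real b - 2 * \<epsilon> + real b * \<eta> < d" by simp
    obtain i m where i: "i < b" "(c - 1) + int i * a = m * int b"
      using int_cong_solution[OF b ab] by blast
    have "of_int c - 1 + real i * of_int a = of_int m * real b"
      using arg_cong[OF i(2), of "of_int :: int \<Rightarrow> real"] by simp
    then have "(of_int c - 1 + real i * of_int a) / real b = of_int m" using b by simp
    then have eq: "u + real i * \<rho> - of_int m = 1 / real b - \<epsilon> - d + real i * \<eta>"
      by (simp add: u \<rho> add_divide_distrib diff_divide_distrib algebra_simps)
    have "real i * \<eta> \<le> real b * \<eta>" "real i * \<eta> \<ge> 0" using i(1) \<eta> by (auto intro: mult_right_mono)
    then have "rotation_hits \<epsilon> u \<rho> i"
      unfolding rotation_hits_def using less d by (intro exI[of _ m]) (simp add: eq abs_le_iff)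
    moreover have "real i \<le> T" using i(1) T by linarith
    ultimately show False using surv by blast
  qed
qed

lemma borel_measurable_frac [measurable]: "(frac :: real \<Rightarrow> real) \<in> borel_measurable borel"
  unfolding frac_def by measurable

lemma sets_borel_shift:
  fixes W :: "real set"
  assumes "W \<in> sets borel" shows "(\<lambda>x. r + x) ` W \<in> sets borel"
proof -
  have "(\<lambda>x. r + x) ` W = (\<lambda>x. x - r) -` W \<inter> space borel"
    by (auto intro!: image_eqI[of _ _ "x - r" for x])
  also have "\<dots> \<in> sets borel" using assms by (intro measurable_sets[of _ borel borel]) auto
  finally show ?thesis .
qed

text \<open>An interval of length 1 is cut at the integer that it contains, and the right part is translated back by 1.\<close>
lemma frac_interval_unit:
  fixes J :: "real set"
  assumes J: "J \<in> sets borel"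
  shows "measure lborel {v\<in>{A<..A + 1}. frac v \<in> J} = measure lborel (J \<inter> {0..<1})"
proof -
  define n where "n = (of_int \<lfloor>A\<rfloor> :: real)"
  define a where "a = frac A"
  have A: "A = n + a" by (simp add: n_def a_def frac_def)
  have a: "0 \<le> a" "a < 1" by (auto simp: a_def frac_lt_1)
  define U V where "U = J \<inter> {a<..<1}" and "V = J \<inter> {0..a}"
  have UV: "U \<in> sets borel" "V \<in> sets borel" using J by (auto simp: U_def V_def)
  have fr: "frac v = v - n" if "n \<le> v" "v < n + 1" for v
  proof -
    have "\<lfloor>v\<rfloor> = \<lfloor>A\<rfloor>" using that unfolding n_def by linarith
    then show ?thesis by (simp add: frac_def n_def)
  qed
  have fr1: "frac v = v - (n + 1)" if "n + 1 \<le> v" "v < n + 2" for v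
  proof -
    have "\<lfloor>v\<rfloor> = \<lfloor>A\<rfloor> + 1" using that unfolding n_def by linarith
    then show ?thesis by (simp add: frac_def n_def)
  qed
  have eq: "{v\<in>{A<..A + 1}. frac v \<in> J} = (\<lambda>x. n + x) ` U \<union> (\<lambda>x. (n + 1) + x) ` V"
  proof (intro equalityI subsetI)
    fix v assume v: "v \<in> {v\<in>{A<..A + 1}. frac v \<in> J}"
    show "v \<in> (\<lambda>x. n + x) ` U \<union> (\<lambda>x. (n + 1) + x) ` V"
    proof (cases "v < n + 1")
      case True
      then show ?thesis using v fr[of v] A a by (auto simp: U_def intro!: UnI1 image_eqI[of _ _ "v - n"])
    next
      case False
      then show ?thesis using v fr1[of v] A a by (auto simp: V_def intro!: UnI2 image_eqI[of _ _ "v - (n + 1)"])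
    qed
  next
    fix v assume "v \<in> (\<lambda>x. n + x) ` U \<union> (\<lambda>x. (n + 1) + x) ` V"
    then show "v \<in> {v\<in>{A<..A + 1}. frac v \<in> J}"
      using fr[of v] fr1[of v] A a by (auto simp: U_def V_def)
  qed
  have em: "emeasure lborel ((\<lambda>x. r + x) ` W) = emeasure lborel W" if "W \<in> sets borel" for r :: real and W
  proof -
    have "emeasure lborel ((\<lambda>x. r + x) ` W) = emeasure (distr lborel borel ((+) r)) ((\<lambda>x. r + x) ` W)"
      by (simp add: lborel_distr_plus)
    also have "\<dots> = emeasure lborel ((+) r -` ((\<lambda>x. r + x) ` W) \<inter> space lborel)"
      using that by (intro emeasure_distr) (auto intro!: sets_borel_shift)
    also have "(+) r -` ((\<lambda>x. r + x) ` W) \<inter> space lborel = W" by auto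
    finally show ?thesis .
  qed
  have "emeasure lborel {v\<in>{A<..A + 1}. frac v \<in> J} =
      emeasure lborel ((\<lambda>x. n + x) ` U) + emeasure lborel ((\<lambda>x. (n + 1) + x) ` V)"
    unfolding eq
  proof (rule plus_emeasure[symmetric])
    show "(\<lambda>x. n + x) ` U \<inter> (\<lambda>x. (n + 1) + x) ` V = {}" by (auto simp: U_def V_def)
    show "(\<lambda>x. n + x) ` U \<in> sets lborel" "(\<lambda>x. (n + 1) + x) ` V \<in> sets lborel"
      using UV by (auto intro!: sets_borel_shift)
  qed
  also have "\<dots> = emeasure lborel (U \<union> V)"
    unfolding em[OF UV(1)] em[OF UV(2)] using UV by (intro plus_emeasure) (auto simp: U_def V_def)
  also have "U \<union> V = J \<inter> {0..<1}" using a by (auto simp: U_def V_def)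
  finally show ?thesis by (simp add: measure_def)
qed

lemma measure_frac_interval:
  fixes J :: "real set" and N :: nat
  assumes J: "J \<in> sets borel"
  shows "measure lborel {v\<in>{A<..A + real N}. frac v \<in> J} = real N * measure lborel (J \<inter> {0..<1})"
proof (induction N)
  case (Suc N)
  define B where "B = (\<lambda>a b. {v\<in>{a<..b}. frac v \<in> J})"
  have B: "B a b \<in> sets borel" for a b
    unfolding B_def using J by measurable
  have fin: "emeasure lborel (B a b) < \<infinity>" for a b
  proof -
    have "emeasure lborel (B a b) \<le> emeasure lborel {a..b}"
      by (rule emeasure_mono) (auto simp: B_def)
    also have "\<dots> < \<infinity>" by (simp add: emeasure_lborel_Icc_eq)
    finally show ?thesis .
  qed
  have "{v\<in>{A<..A + real (Suc N)}. frac v \<in> J} = B A (A + real N) \<union> B (A + real N) (A + real N + 1)"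
    by (auto simp: B_def)
  also have "measure lborel \<dots> = measure lborel (B A (A + real N)) + measure lborel (B (A + real N) (A + real N + 1))"
  proof (rule measure_Union)
    show "emeasure lborel (B A (A + real N)) \<noteq> \<infinity>" using fin[of A "A + real N"] by auto
    show "emeasure lborel (B (A + real N) (A + real N + 1)) \<noteq> \<infinity>"
      using fin[of "A + real N" "A + real N + 1"] by auto
    show "B A (A + real N) \<inter> B (A + real N) (A + real N + 1) = {}" by (auto simp: B_def)
  qed (simp_all add: B)
  also have "\<dots> = real N * measure lborel (J \<inter> {0..<1}) + measure lborel (J \<inter> {0..<1})"
    unfolding B_def Suc frac_interval_unit[OF J] by simp
  finally show ?case by (simp add: distrib_right)
qed simp

lemma measure_frac_circle:
  fixes J :: "real set" and m :: nat
  assumes J: "J \<in> sets borel" and m: "m > 0"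
  shows "measure lborel {\<beta>\<in>{- pi<..pi}. frac (real m / (2 * pi) * \<beta> + w) \<in> J} = 2 * pi * measure lborel (J \<inter> {0..<1})"
proof -
  define k where "k = real m / (2 * pi)"
  have k: "k > 0" using m by (simp add: k_def)
  define A where "A = w - k * pi"
  have Am: "A + real m = w + k * pi" by (simp add: A_def k_def)
  define E where "E = {v\<in>{A<..A + real m}. frac v \<in> J}"
  have E: "E \<in> sets borel" unfolding E_def using J by measurable
  have "real m * measure lborel (J \<inter> {0..<1}) = measure lborel E"
    unfolding E_def by (rule measure_frac_interval[OF J, symmetric])
  also have "\<dots> = (\<integral>v. indicator E v \<partial>lborel)" using E by simp
  also have "\<dots> = \<bar>k\<bar> *\<^sub>R (\<integral>\<beta>. indicator E (w + k * \<beta>) \<partial>lborel)"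
    using k by (intro lborel_integral_real_affine) simp
  also have "(\<lambda>\<beta>. indicator E (w + k * \<beta>) :: real) = indicator {\<beta>\<in>{- pi<..pi}. frac (real m / (2 * pi) * \<beta> + w) \<in> J}"
  proof
    fix \<beta>
    have iff: "(w + k * \<beta> \<in> {A<..A + real m}) = (\<beta> \<in> {- pi<..pi})"
    proof -
      have "A < w + k * \<beta> \<longleftrightarrow> k * (- pi) < k * \<beta>" by (simp add: A_def)
      also have "\<dots> \<longleftrightarrow> - pi < \<beta>" using k by (simp only: mult_less_cancel_left_pos)
      finally have 1: "A < w + k * \<beta> \<longleftrightarrow> - pi < \<beta>" .
      have "w + k * \<beta> \<le> A + real m \<longleftrightarrow> k * \<beta> \<le> k * pi" by (simp add: Am)
      also have "\<dots> \<longleftrightarrow> \<beta> \<le> pi" using k by (simp only: mult_le_cancel_left_pos)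
      finally show ?thesis using 1 by simp
    qed
    have shift: "real m / (2 * pi) * \<beta> + w = w + k * \<beta>" by (simp add: k_def)
    show "indicator E (w + k * \<beta>) = (indicator {\<beta>\<in>{- pi<..pi}. frac (real m / (2 * pi) * \<beta> + w) \<in> J} \<beta> :: real)"
      unfolding E_def indicator_def mem_Collect_eq shift iff by (rule refl)
  qed
  finally have "real m * measure lborel (J \<inter> {0..<1}) =
      k * measure lborel {\<beta>\<in>{- pi<..pi}. frac (real m / (2 * pi) * \<beta> + w) \<in> J}" using k by simp
  then show ?thesis using m by (simp add: k_def field_simps)
qed

section \<open>Integrals of tents\<close>

text \<open>The sum of the two halves of the tent counts the value at 0 twice, which a multiple of the indicator of
  \<open>{0}\<close> corrects.\<close>
lemma tent_has_integral:
  fixes A B :: real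
  assumes B: "B > 0"
  shows "has_bochner_integral lborel (\<lambda>v. max 0 (A - B * \<bar>v\<bar>)) ((max 0 A)\<^sup>2 / B)"
proof (cases "A \<le> 0")
  case True
  have "max 0 (A - B * \<bar>v\<bar>) = 0" for v
  proof -
    have "0 \<le> B * \<bar>v\<bar>" using B by simp
    then show ?thesis using True by (intro max_absorb1) linarith
  qed
  then show ?thesis using True by (simp add: has_bochner_integral_zero max_def)
next
  case False
  then have A: "A > 0" by simp
  define r where "r = A / B"
  have r: "r > 0" "B * r = A" using A B by (auto simp: r_def)
  have "has_bochner_integral lborel (\<lambda>v. (A - B * v) * indicator {0..r} v) ((A * r - B * r\<^sup>2 / 2) - (A * 0 - B * 0\<^sup>2 / 2))"
    by (rule has_bochner_integral_FTC_Icc_real) (use r in \<open>auto intro!: derivative_eq_intros\<close>)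
  moreover have "has_bochner_integral lborel (\<lambda>v. (A + B * v) * indicator {-r..0} v) ((A * 0 + B * 0\<^sup>2 / 2) - (A * (- r) + B * (- r)\<^sup>2 / 2))"
    by (rule has_bochner_integral_FTC_Icc_real) (use r in \<open>auto intro!: derivative_eq_intros\<close>)
  moreover have "has_bochner_integral lborel (\<lambda>v :: real. A * indicator {0} v) (A * measure lborel {0::real})"
  proof -
    have "has_bochner_integral lborel (indicator {0::real} :: real \<Rightarrow> real) (measure lborel {0::real})"
      by (rule has_bochner_integral_real_indicator) simp_all
    then show ?thesis by (intro has_bochner_integral_mult_right) simp
  qed
  ultimately have H: "has_bochner_integral lborel
     (\<lambda>v. (A - B * v) * indicator {0..r} v + (A + B * v) * indicator {-r..0} v - A * indicator {0} v)
     (((A * r - B * r\<^sup>2 / 2) - (A * 0 - B * 0\<^sup>2 / 2)) + ((A * 0 + B * 0\<^sup>2 / 2) - (A * (- r) + B * (- r)\<^sup>2 / 2)) - A * measure lborel {0::real})"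
    by (intro has_bochner_integral_add has_bochner_integral_diff)
  have f_eq: "(A - B * v) * indicator {0..r} v + (A + B * v) * indicator {-r..0} v - A * indicator {0} v =
      max 0 (A - B * \<bar>v\<bar>)" for v
  proof -
    have "A - B * \<bar>v\<bar> \<ge> 0 \<longleftrightarrow> \<bar>v\<bar> \<le> r" using B r by (simp add: r_def field_simps)
    then show ?thesis using A r(1) by (auto simp: indicator_def max_def abs_if split: if_splits)
  qed
  have v_eq: "((A * r - B * r\<^sup>2 / 2) - (A * 0 - B * 0\<^sup>2 / 2)) + ((A * 0 + B * 0\<^sup>2 / 2) - (A * (- r) + B * (- r)\<^sup>2 / 2)) - A * measure lborel {0::real} = (max 0 A)\<^sup>2 / B"
    using A B by (simp add: r_def power2_eq_square field_simps)
  show ?thesis using H unfolding f_eq v_eq .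
qed

lemma tent_bound:
  fixes w \<kappa> g c t x :: real
  assumes w: "0 \<le> w" "w \<le> 1" and \<kappa>: "\<kappa> \<ge> 0" and c: "c > 0" and t: "t \<ge> 4 * \<kappa>" "t > 0" and x: "x \<ge> 0"
  shows "max 0 (w * g - (1 / 2 - \<kappa> * w / t) * c * x) \<le> max 0 (\<bar>g\<bar> - c / 4 * x)"
proof -
  have "\<kappa> * w \<le> \<kappa> * 1" using w \<kappa> by (intro mult_left_mono)
  then have "\<kappa> * w / t \<le> 1 / 4" using t by (simp add: field_simps)
  then have "1 / 4 * (c * x) \<le> (1 / 2 - \<kappa> * w / t) * (c * x)" using c x by (intro mult_right_mono) auto
  moreover have "w * g \<le> \<bar>g\<bar>"
  proof -
    have "w * g \<le> w * \<bar>g\<bar>" using w by (intro mult_left_mono) auto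
    also have "\<dots> \<le> 1 * \<bar>g\<bar>" using w by (intro mult_right_mono) auto
    finally show ?thesis by simp
  qed
  ultimately show ?thesis by (simp add: mult.assoc)
qed

lemma tent_rescale:
  fixes w \<kappa> g c t v :: real
  assumes "t > 0"
  shows "(t / 2 - \<kappa> * w) * c * \<bar>v / t\<bar> = (1 / 2 - \<kappa> * w / t) * c * \<bar>v\<bar>"
  using assms by (simp add: abs_divide field_simps)

lemma integrable_tent_family:
  fixes w :: "real \<Rightarrow> real" and \<kappa> g c \<psi>\<^sub>0 t :: real
  assumes cont: "continuous_on UNIV w" and w: "\<And>x. 0 \<le> w x" "\<And>x. w x \<le> 1"
    and \<kappa>: "\<kappa> \<ge> 0" and c: "c > 0" and t: "t \<ge> 4 * \<kappa>" "t > 0"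
  shows "integrable lborel (\<lambda>\<psi>. max 0 (w \<psi> * g - (t / 2 - \<kappa> * w \<psi>) * c * \<bar>\<psi> - \<psi>\<^sub>0\<bar>))"
proof -
  have [measurable]: "w \<in> borel_measurable borel" using cont by (rule borel_measurable_continuous_onI)
  define f where "f = (\<lambda>\<psi>. max 0 (w \<psi> * g - (t / 2 - \<kappa> * w \<psi>) * c * \<bar>\<psi> - \<psi>\<^sub>0\<bar>))"
  have "integrable lborel (\<lambda>v. f (\<psi>\<^sub>0 + (1 / t) * v))"
  proof (rule Bochner_Integration.integrable_bound)
    show "integrable lborel (\<lambda>v. max 0 (\<bar>g\<bar> - c / 4 * \<bar>v\<bar>))"
      using tent_has_integral[of "c / 4" "\<bar>g\<bar>"] c by (auto simp: has_bochner_integral_iff)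
    show "(\<lambda>v. f (\<psi>\<^sub>0 + (1 / t) * v)) \<in> borel_measurable lborel" unfolding f_def by measurable
    show "AE v in lborel. norm (f (\<psi>\<^sub>0 + (1 / t) * v)) \<le> norm (max 0 (\<bar>g\<bar> - c / 4 * \<bar>v\<bar>))"
    proof (rule AE_I2)
      fix v
      show "norm (f (\<psi>\<^sub>0 + (1 / t) * v)) \<le> norm (max 0 (\<bar>g\<bar> - c / 4 * \<bar>v\<bar>))"
        using tent_bound[OF w(1) w(2) \<kappa> c t, of "\<bar>v\<bar>" "\<psi>\<^sub>0 + v / t" g] tent_rescale[OF t(2)]
        by (simp add: f_def)
    qed
  qed
  then show ?thesis using t unfolding f_def[symmetric]
    by (subst (asm) lborel_integrable_real_affine_iff) auto
qed

text \<open>With \<open>\<psi> = \<psi>\<^sub>0 + v / t\<close> the integrand becomes a tent of fixed size whose parameters converge, and the tent of height \<open>\<bar>g\<bar>\<close>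
  and slope \<open>c / 4\<close> dominates it. The parameter \<open>\<kappa>\<close>, which measures a bounded change of the time, disappears in the limit.\<close>
lemma tent_family_limit:
  fixes w :: "real \<Rightarrow> real" and \<kappa> g c \<psi>\<^sub>0 :: real
  assumes cont: "continuous_on UNIV w" and w: "\<And>x. 0 \<le> w x" "\<And>x. w x \<le> 1"
    and \<kappa>: "\<kappa> \<ge> 0" and c: "c > 0"
  shows "((\<lambda>t. t * (\<integral>\<psi>. max 0 (w \<psi> * g - (t / 2 - \<kappa> * w \<psi>) * c * \<bar>\<psi> - \<psi>\<^sub>0\<bar>) \<partial>lborel)) \<longlongrightarrow>
           2 * (max 0 (w \<psi>\<^sub>0 * g))\<^sup>2 / c) at_top"
proof -
  have [measurable]: "w \<in> borel_measurable borel" using cont by (rule borel_measurable_continuous_onI)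
  define F where "F = (\<lambda>t v. max 0 (w (\<psi>\<^sub>0 + v / t) * g - (1 / 2 - \<kappa> * w (\<psi>\<^sub>0 + v / t) / t) * c * \<bar>v\<bar>))"
  define G where "G = (\<lambda>v. max 0 (w \<psi>\<^sub>0 * g - c / 2 * \<bar>v\<bar>))"
  have "((\<lambda>t. integral\<^sup>L lborel (F t)) \<longlongrightarrow> integral\<^sup>L lborel G) at_top"
  proof (rule integral_dominated_convergence_at_top)
    show "G \<in> borel_measurable lborel" "F t \<in> borel_measurable lborel" for t
      unfolding F_def G_def by measurable
    show "integrable lborel (\<lambda>v. max 0 (\<bar>g\<bar> - c / 4 * \<bar>v\<bar>))"
      using tent_has_integral[of "c / 4" "\<bar>g\<bar>"] c by (auto simp: has_bochner_integral_iff)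
    show "\<forall>\<^sub>F t in at_top. AE v in lborel. norm (F t v) \<le> max 0 (\<bar>g\<bar> - c / 4 * \<bar>v\<bar>)"
      using eventually_ge_at_top[of "4 * \<kappa>"] eventually_gt_at_top[of 0]
    proof eventually_elim
      case (elim t)
      show ?case using tent_bound[OF w(1) w(2) \<kappa> c elim] by (intro AE_I2) (simp add: F_def)
    qed
    show "AE v in lborel. ((\<lambda>t. F t v) \<longlongrightarrow> G v) at_top"
    proof (rule AE_I2)
      fix v
      have "((\<lambda>t. \<psi>\<^sub>0 + v / t) \<longlongrightarrow> \<psi>\<^sub>0) at_top" by real_asymp
      moreover have "isCont w \<psi>\<^sub>0" using cont by (simp add: continuous_on_eq_continuous_at)
      ultimately have wl: "((\<lambda>t. w (\<psi>\<^sub>0 + v / t)) \<longlongrightarrow> w \<psi>\<^sub>0) at_top" by (rule isCont_tendsto_compose[rotated])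
      have "((\<lambda>t. \<kappa> * w (\<psi>\<^sub>0 + v / t) / t) \<longlongrightarrow> 0) at_top"
        by (rule real_tendsto_divide_at_top[OF tendsto_mult[OF tendsto_const wl] filterlim_ident])
      then have "((\<lambda>t. F t v) \<longlongrightarrow> max 0 (w \<psi>\<^sub>0 * g - (1 / 2 - 0) * c * \<bar>v\<bar>)) at_top"
        unfolding F_def by (intro tendsto_intros wl)
      then show "((\<lambda>t. F t v) \<longlongrightarrow> G v) at_top" by (simp add: G_def)
    qed
  qed
  moreover have "integral\<^sup>L lborel G = 2 * (max 0 (w \<psi>\<^sub>0 * g))\<^sup>2 / c"
    using has_bochner_integral_integral_eq[OF tent_has_integral[of "c / 2" "w \<psi>\<^sub>0 * g"]] c by (simp add: G_def)
  moreover have "\<forall>\<^sub>F t in at_top. integral\<^sup>L lborel (F t) =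
      t * (\<integral>\<psi>. max 0 (w \<psi> * g - (t / 2 - \<kappa> * w \<psi>) * c * \<bar>\<psi> - \<psi>\<^sub>0\<bar>) \<partial>lborel)"
    using eventually_gt_at_top[of 0]
  proof eventually_elim
    case (elim t)
    define f where "f = (\<lambda>\<psi>. max 0 (w \<psi> * g - (t / 2 - \<kappa> * w \<psi>) * c * \<bar>\<psi> - \<psi>\<^sub>0\<bar>))"
    have "f (\<psi>\<^sub>0 + (1 / t) * v) = F t v" for v
      using tent_rescale[OF elim] by (simp add: f_def F_def)
    moreover have "integral\<^sup>L lborel f = \<bar>1 / t\<bar> *\<^sub>R (\<integral>v. f (\<psi>\<^sub>0 + (1 / t) * v) \<partial>lborel)"
      using elim by (intro lborel_integral_real_affine) simp
    ultimately show ?case using elim unfolding f_def[symmetric] by simp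
  qed
  ultimately show ?thesis by (simp add: filterlim_cong)
qed

section \<open>Measure of the surviving boundary points\<close>

definition surviving_angles :: "nat \<Rightarrow> real \<Rightarrow> real \<Rightarrow> real \<Rightarrow> real \<Rightarrow> real set" where
  "surviving_angles q \<theta> \<epsilon> t \<psi> = {\<beta>\<in>{- pi<..pi}. \<forall>i. 2 * cos \<psi> * real i \<le> t \<longrightarrow>
     \<not> rotation_hits \<epsilon> (real q * (\<beta> - \<theta>) / (2 * pi)) (real q * (pi - 2 * \<psi>) / (2 * pi)) i}"

lemma sets_rotation_hits [measurable]:
  "Measurable.pred borel (\<lambda>\<beta>. rotation_hits \<epsilon> (real q * (\<beta> - \<theta>) / (2 * pi)) \<rho> i)"
  unfolding rotation_hits_def by measurable

lemma sets_surviving_angles: "surviving_angles q \<theta> \<epsilon> t \<psi> \<in> sets borel"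
  unfolding surviving_angles_def by measurable

lemma emeasure_arc_finite: "emeasure lborel (S \<inter> {- pi<..pi}) < \<infinity>"
proof -
  have "emeasure lborel (S \<inter> {- pi<..pi}) \<le> emeasure lborel {- pi..pi}" by (rule emeasure_mono) auto
  also have "\<dots> < \<infinity>" by (simp add: emeasure_lborel_Icc_eq)
  finally show ?thesis .
qed

lemma measure_arc_mono:
  assumes "S \<subseteq> R" "R \<subseteq> {- pi<..pi}" "R \<in> sets borel"
  shows "measure lborel S \<le> measure lborel R"
proof -
  have "R \<inter> {- pi<..pi} = R" using assms(2) by auto
  then have "emeasure lborel R < \<infinity>" using emeasure_arc_finite[of R] by simp
  moreover have "emeasure lborel S \<le> emeasure lborel R" using assms by (intro emeasure_mono) auto
  ultimately show ?thesis unfolding measure_def by (intro enn2real_mono) auto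
qed

lemma measure_unit_Icc_le: "measure lborel ({x..y} \<inter> {0..<1 :: real}) \<le> max 0 (y - x)"
proof (cases "x \<le> y")
  case True
  have "measure lborel ({x..y} \<inter> {0..<1 :: real}) \<le> measure lborel {x..y}"
    unfolding measure_def by (intro enn2real_mono emeasure_mono) (auto simp: emeasure_lborel_Icc_eq)
  also have "\<dots> = y - x" using True by simp
  finally show ?thesis by simp
qed simp

lemma frac_circle_upper:
  fixes m :: nat
  assumes m: "m > 0" and S: "S \<subseteq> {\<beta>\<in>{- pi<..pi}. frac (real m / (2 * pi) * \<beta> + w) \<in> {x..y}}"
  shows "measure lborel S \<le> 2 * pi * max 0 (y - x)"
proof -
  have "measure lborel S \<le> measure lborel {\<beta>\<in>{- pi<..pi}. frac (real m / (2 * pi) * \<beta> + w) \<in> {x..y}}"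
    by (rule measure_arc_mono[OF S]) (auto, measurable)
  also have "\<dots> = 2 * pi * measure lborel ({x..y} \<inter> {0..<1})" by (rule measure_frac_circle[OF _ m]) simp
  also have "\<dots> \<le> 2 * pi * max 0 (y - x)" by (intro mult_left_mono measure_unit_Icc_le) auto
  finally show ?thesis .
qed

lemma frac_circle_lower:
  fixes m :: nat
  assumes m: "m > 0" and S: "{\<beta>\<in>{- pi<..pi}. frac (real m / (2 * pi) * \<beta> + w) \<in> {x<..<y}} \<subseteq> S"
    and S': "S \<subseteq> {- pi<..pi}" "S \<in> sets borel" and xy: "0 \<le> x" "y \<le> 1"
  shows "2 * pi * max 0 (y - x) \<le> measure lborel S"
proof (cases "x \<le> y")
  case True
  have "{x<..<y} \<inter> {0..<1} = {x<..<y}" using xy by auto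
  then have "2 * pi * (y - x) = 2 * pi * measure lborel ({x<..<y} \<inter> {0..<1})" using True by simp
  also have "\<dots> = measure lborel {\<beta>\<in>{- pi<..pi}. frac (real m / (2 * pi) * \<beta> + w) \<in> {x<..<y}}"
    by (rule measure_frac_circle[OF _ m, symmetric]) simp
  also have "\<dots> \<le> measure lborel S" by (rule measure_arc_mono[OF S S'])
  finally show ?thesis using True by simp
next
  case False
  then show ?thesis by simp
qed

context
  fixes q b :: nat and a :: int and \<theta> \<epsilon> t \<psi> \<eta> g :: real
  assumes q: "q > 0" and b: "b > 0" and \<epsilon>: "\<epsilon> > 0" and t: "t > 0" and cos: "cos \<psi> > 0"
  defines "\<eta> \<equiv> real q * (pi - 2 * \<psi>) / (2 * pi) - of_int a / real b" and "g \<equiv> 1 / real b - 2 * \<epsilon>"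
begin

text \<open>The position in the gap, as a fraction of the period \<open>1 / b\<close>, is the fractional part of an affine
  function of \<open>\<beta>\<close> that runs through \<open>b q\<close> periods. For negative \<open>\<eta>\<close> the rotation is reflected, so that positions are measured
  from the other side.\<close>
lemma measure_survivors_le:
  assumes ab: "coprime a (int b)" and small: "real b * \<bar>\<eta>\<bar> \<le> 2 * \<epsilon>" and tb: "t \<ge> 2 * real b"
  shows "measure lborel (surviving_angles q \<theta> \<epsilon> t \<psi>) \<le>
     2 * pi * max 0 (real b * (g - (t / (2 * cos \<psi>) - 2 * real b) * \<bar>\<eta>\<bar>))"
proof -
  define T where "T = t / (2 * cos \<psi>)"
  define u where "u = (\<lambda>\<beta>. real q * (\<beta> - \<theta>) / (2 * pi))"
  define \<rho> where "\<rho> = real q * (pi - 2 * \<psi>) / (2 * pi)"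
  have bq: "b * q > 0" using b q by simp
  have T: "T \<ge> real b"
  proof -
    have "real b * (2 * cos \<psi>) \<le> real b * 2" using cos_le_one[of \<psi>] by (intro mult_left_mono) auto
    then show ?thesis using tb cos by (simp add: T_def field_simps)
  qed
  have surv: "\<not> rotation_hits \<epsilon> (u \<beta>) \<rho> i" if "\<beta> \<in> surviving_angles q \<theta> \<epsilon> t \<psi>" "real i \<le> T" for \<beta> i
    using that cos by (auto simp: surviving_angles_def u_def \<rho>_def T_def field_simps)
  have in_arc: "\<beta> \<in> {- pi<..pi}" if "\<beta> \<in> surviving_angles q \<theta> \<epsilon> t \<psi>" for \<beta>
    using that by (auto simp: surviving_angles_def)
  have "measure lborel (surviving_angles q \<theta> \<epsilon> t \<psi>) \<le>
     2 * pi * max 0 (real b * (g - (T - 2 * real b) * \<bar>\<eta>\<bar>))"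
  proof (cases "\<eta> \<ge> 0")
    case True
    define w where "w = real b * (\<epsilon> - real q * \<theta> / (2 * pi))"
    have z: "real (b * q) / (2 * pi) * \<beta> + w = real b * (u \<beta> + \<epsilon>)" for \<beta>
      by (simp add: u_def w_def algebra_simps diff_divide_distrib)
    have "measure lborel (surviving_angles q \<theta> \<epsilon> t \<psi>) \<le> 2 * pi *
        max 0 ((1 - real b * ((T - real b) * \<eta>)) - real b * (2 * \<epsilon> - real b * \<eta>))"
    proof (rule frac_circle_upper[OF bq], rule subsetI)
      fix \<beta> assume \<beta>: "\<beta> \<in> surviving_angles q \<theta> \<epsilon> t \<psi>"
      define x where "x = frac (real b * (u \<beta> + \<epsilon>))"
      define c where "c = \<lfloor>real b * (u \<beta> + \<epsilon>)\<rfloor> + 1"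
      define d where "d = (1 - x) / real b"
      have "real b * (u \<beta> + \<epsilon>) = of_int c - real b * d"
        using b by (simp add: c_def d_def x_def frac_def)
      then have ub: "u \<beta> = of_int c / real b - \<epsilon> - d" using b by (simp add: field_simps)
      have x: "0 \<le> x" "x < 1" by (auto simp: x_def frac_lt_1)
      have dd: "0 \<le> d" "d \<le> 1 / real b" using x b by (auto simp: d_def field_simps)
      have r: "\<rho> = of_int a / real b + \<eta>" by (simp add: \<eta>_def \<rho>_def)
      have sm: "real b * \<eta> \<le> 2 * \<epsilon>" using small True by simp
      note * = rotation_survives_imp[OF b ab True r sm T ub dd surv[OF \<beta>]]
      have "real b * ((T - real b) * \<eta>) \<le> real b * d" by (intro mult_left_mono *) auto
      moreover have "real b * d \<le> real b * (1 / real b - 2 * \<epsilon> + real b * \<eta>)" by (intro mult_left_mono *) auto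
      moreover have "real b * d = 1 - x" using b by (simp add: d_def)
      moreover have "real b * (1 / real b - 2 * \<epsilon> + real b * \<eta>) = 1 - real b * (2 * \<epsilon> - real b * \<eta>)"
        using b by (simp add: right_diff_distrib distrib_left)
      ultimately have "x \<in> {real b * (2 * \<epsilon> - real b * \<eta>)..1 - real b * ((T - real b) * \<eta>)}" by auto
      then show "\<beta> \<in> {\<beta> \<in> {- pi<..pi}. frac (real (b * q) / (2 * pi) * \<beta> + w) \<in>
          {real b * (2 * \<epsilon> - real b * \<eta>)..1 - real b * ((T - real b) * \<eta>)}}"
        unfolding z using in_arc[OF \<beta>] by (simp add: x_def)
    qed
    also have "(1 - real b * ((T - real b) * \<eta>)) - real b * (2 * \<epsilon> - real b * \<eta>) =
        real b * (g - (T - 2 * real b) * \<bar>\<eta>\<bar>)"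
      using True b by (simp add: g_def algebra_simps)
    finally show ?thesis .
  next
    case False
    define h where "h = - \<eta>"
    have h: "h \<ge> 0" "\<bar>\<eta>\<bar> = h" using False by (auto simp: h_def)
    define w where "w = real b * (- \<epsilon> - real q * \<theta> / (2 * pi))"
    have z: "real (b * q) / (2 * pi) * \<beta> + w = real b * (u \<beta> - \<epsilon>)" for \<beta>
      by (simp add: u_def w_def algebra_simps diff_divide_distrib)
    have "measure lborel (surviving_angles q \<theta> \<epsilon> t \<psi>) \<le> 2 * pi *
        max 0 (real b * (1 / real b - 2 * \<epsilon> + real b * h) - real b * ((T - real b) * h))"
    proof (rule frac_circle_upper[OF bq], rule subsetI)
      fix \<beta> assume \<beta>: "\<beta> \<in> surviving_angles q \<theta> \<epsilon> t \<psi>"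
      define x where "x = frac (real b * (u \<beta> - \<epsilon>))"
      define c where "c = - \<lfloor>real b * (u \<beta> - \<epsilon>)\<rfloor>"
      define d where "d = x / real b"
      have "real b * (u \<beta> - \<epsilon>) = - of_int c + real b * d"
        using b by (simp add: c_def d_def x_def frac_def)
      then have ub: "- u \<beta> = of_int c / real b - \<epsilon> - d" using b by (simp add: field_simps)
      have x: "0 \<le> x" "x < 1" by (auto simp: x_def frac_lt_1)
      have dd: "0 \<le> d" "d \<le> 1 / real b" using x b by (auto simp: d_def field_simps)
      have r: "- \<rho> = of_int (- a) / real b + h" by (simp add: h_def \<eta>_def \<rho>_def)
      have sm: "real b * h \<le> 2 * \<epsilon>" using small h by simp
      have ab': "coprime (- a) (int b)" using ab by simp
      have surv': "\<not> rotation_hits \<epsilon> (- u \<beta>) (- \<rho>) i" if "real i \<le> T" for i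
        using surv[OF \<beta> that] by (simp add: rotation_hits_uminus)
      note * = rotation_survives_imp[OF b ab' h(1) r sm T ub dd surv']
      have "real b * ((T - real b) * h) \<le> real b * d" by (intro mult_left_mono *) auto
      moreover have "real b * d \<le> real b * (1 / real b - 2 * \<epsilon> + real b * h)" by (intro mult_left_mono *) auto
      moreover have "real b * d = x" using b by (simp add: d_def)
      ultimately have "x \<in> {real b * ((T - real b) * h)..real b * (1 / real b - 2 * \<epsilon> + real b * h)}" by auto
      then show "\<beta> \<in> {\<beta> \<in> {- pi<..pi}. frac (real (b * q) / (2 * pi) * \<beta> + w) \<in>
          {real b * ((T - real b) * h)..real b * (1 / real b - 2 * \<epsilon> + real b * h)}}"
        unfolding z using in_arc[OF \<beta>] by (simp add: x_def)
    qed
    also have "real b * (1 / real b - 2 * \<epsilon> + real b * h) - real b * ((T - real b) * h) =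
        real b * (g - (T - 2 * real b) * \<bar>\<eta>\<bar>)"
      unfolding h(2) by (simp add: g_def algebra_simps)
    finally show ?thesis .
  qed
  then show ?thesis by (simp only: T_def)
qed

lemma measure_survivors_ge:
  shows "2 * pi * max 0 (real b * (g - t / (2 * cos \<psi>) * \<bar>\<eta>\<bar>)) \<le> measure lborel (surviving_angles q \<theta> \<epsilon> t \<psi>)"
proof -
  define T where "T = t / (2 * cos \<psi>)"
  define u where "u = (\<lambda>\<beta>. real q * (\<beta> - \<theta>) / (2 * pi))"
  define \<rho> where "\<rho> = real q * (pi - 2 * \<psi>) / (2 * pi)"
  have bq: "b * q > 0" using b q by simp
  have T: "T \<ge> 0" using t cos by (simp add: T_def)
  have surv: "\<beta> \<in> surviving_angles q \<theta> \<epsilon> t \<psi>"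
    if "\<beta> \<in> {- pi<..pi}" "\<And>i. real i \<le> T \<Longrightarrow> \<not> rotation_hits \<epsilon> (u \<beta>) \<rho> i" for \<beta>
    using that cos by (auto simp: surviving_angles_def u_def \<rho>_def T_def field_simps)
  have sub: "surviving_angles q \<theta> \<epsilon> t \<psi> \<subseteq> {- pi<..pi}" by (auto simp: surviving_angles_def)
  have "2 * pi * max 0 (real b * (g - T * \<bar>\<eta>\<bar>)) \<le> measure lborel (surviving_angles q \<theta> \<epsilon> t \<psi>)"
  proof (cases "\<eta> \<ge> 0")
    case True
    define w where "w = real b * (\<epsilon> - real q * \<theta> / (2 * pi))"
    have z: "real (b * q) / (2 * pi) * \<beta> + w = real b * (u \<beta> + \<epsilon>)" for \<beta>
      by (simp add: u_def w_def algebra_simps diff_divide_distrib)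
    have "real b * (g - T * \<bar>\<eta>\<bar>) = (1 - real b * (T * \<eta>)) - real b * (2 * \<epsilon>)"
      using True b by (simp add: g_def algebra_simps)
    also have "2 * pi * max 0 \<dots> \<le> measure lborel (surviving_angles q \<theta> \<epsilon> t \<psi>)"
    proof (rule frac_circle_lower[OF bq _ sub sets_surviving_angles], rule subsetI)
      show "0 \<le> real b * (2 * \<epsilon>)" "1 - real b * (T * \<eta>) \<le> 1" using \<epsilon> T True by auto
      fix \<beta> assume \<beta>: "\<beta> \<in> {\<beta> \<in> {- pi<..pi}. frac (real (b * q) / (2 * pi) * \<beta> + w) \<in>
          {real b * (2 * \<epsilon>)<..<1 - real b * (T * \<eta>)}}"
      define x where "x = frac (real b * (u \<beta> + \<epsilon>))"
      define c where "c = \<lfloor>real b * (u \<beta> + \<epsilon>)\<rfloor> + 1"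
      define d where "d = (1 - x) / real b"
      have "real b * (u \<beta> + \<epsilon>) = of_int c - real b * d"
        using b by (simp add: c_def d_def x_def frac_def)
      then have ub: "u \<beta> = of_int c / real b - \<epsilon> - d" using b by (simp add: field_simps)
      have r: "\<rho> = of_int a / real b + \<eta>" by (simp add: \<eta>_def \<rho>_def)
      have x: "real b * (2 * \<epsilon>) < x" "x < 1 - real b * (T * \<eta>)" using \<beta> unfolding z by (auto simp: x_def)
      have d: "T * \<eta> < d" "d < 1 / real b - 2 * \<epsilon>" using x b by (auto simp: d_def field_simps)
      show "\<beta> \<in> surviving_angles q \<theta> \<epsilon> t \<psi>"
        using \<beta> rotation_survives[OF b True r ub d] by (intro surv) auto
    qed
    finally show ?thesis .
  next
    case False
    define h where "h = - \<eta>"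
    have h: "h \<ge> 0" "\<bar>\<eta>\<bar> = h" using False by (auto simp: h_def)
    define w where "w = real b * (- \<epsilon> - real q * \<theta> / (2 * pi))"
    have z: "real (b * q) / (2 * pi) * \<beta> + w = real b * (u \<beta> - \<epsilon>)" for \<beta>
      by (simp add: u_def w_def algebra_simps diff_divide_distrib)
    have "real b * (g - T * \<bar>\<eta>\<bar>) = real b * (1 / real b - 2 * \<epsilon>) - real b * (T * h)"
      unfolding h(2) by (simp add: g_def algebra_simps)
    also have "2 * pi * max 0 \<dots> \<le> measure lborel (surviving_angles q \<theta> \<epsilon> t \<psi>)"
    proof (rule frac_circle_lower[OF bq _ sub sets_surviving_angles], rule subsetI)
      show "0 \<le> real b * (T * h)" using T h by simp
      have "real b * (1 / real b - 2 * \<epsilon>) = 1 - real b * (2 * \<epsilon>)" using b by (simp add: algebra_simps)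
      then show "real b * (1 / real b - 2 * \<epsilon>) \<le> 1" using \<epsilon> by simp
      fix \<beta> assume \<beta>: "\<beta> \<in> {\<beta> \<in> {- pi<..pi}. frac (real (b * q) / (2 * pi) * \<beta> + w) \<in>
          {real b * (T * h)<..<real b * (1 / real b - 2 * \<epsilon>)}}"
      define x where "x = frac (real b * (u \<beta> - \<epsilon>))"
      define c where "c = - \<lfloor>real b * (u \<beta> - \<epsilon>)\<rfloor>"
      define d where "d = x / real b"
      have "real b * (u \<beta> - \<epsilon>) = - of_int c + real b * d"
        using b by (simp add: c_def d_def x_def frac_def)
      then have ub: "- u \<beta> = of_int c / real b - \<epsilon> - d" using b by (simp add: field_simps)
      have r: "- \<rho> = of_int (- a) / real b + h" by (simp add: h_def \<eta>_def \<rho>_def)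
      have x: "real b * (T * h) < x" "x < real b * (1 / real b - 2 * \<epsilon>)" using \<beta> unfolding z by (auto simp: x_def)
      have "x / real b < 1 / real b - 2 * \<epsilon>" using x(2) b by (simp add: pos_divide_less_eq mult.commute)
      then have d: "T * h < d" "d < 1 / real b - 2 * \<epsilon>" using x b by (auto simp: d_def field_simps)
      show "\<beta> \<in> surviving_angles q \<theta> \<epsilon> t \<psi>"
        using \<beta> rotation_survives[OF b h(1) r ub d] by (intro surv) (auto simp: rotation_hits_uminus)
    qed
    finally show ?thesis .
  qed
  then show ?thesis by (simp only: T_def)
qed

end

section \<open>From the billiard to the rotation\<close>

lemma wrap_angle_range: "wrap_angle x \<in> {- pi<..pi}" "\<exists>k::int. wrap_angle x = x + 2 * pi * of_int k"
proof -
  define y where "y = (x - pi) / (2 * pi)"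
  have x: "x = 2 * pi * y + pi" by (simp add: y_def)
  have w: "wrap_angle x = pi - 2 * pi * (of_int \<lceil>y\<rceil> - y)"
    unfolding wrap_angle_def y_def[symmetric] by (subst x) (simp add: algebra_simps)
  have "0 \<le> of_int \<lceil>y\<rceil> - y" "of_int \<lceil>y\<rceil> - y < 1" by linarith+
  then have "0 \<le> 2 * pi * (of_int \<lceil>y\<rceil> - y)" "2 * pi * (of_int \<lceil>y\<rceil> - y) < 2 * pi * 1"
    using pi_gt_zero by (auto intro: mult_strict_left_mono)
  then show "wrap_angle x \<in> {- pi<..pi}" unfolding w by auto
  show "\<exists>k::int. wrap_angle x = x + 2 * pi * of_int k"
    by (intro exI[of _ "- \<lceil>y\<rceil>"]) (simp add: wrap_angle_def y_def)
qed

text \<open>The wrapped iterates are the orbit of the unwrapped rotation, reduced modulo \<open>2 \<pi>\<close>.\<close>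
lemma billiard_map_iterate:
  assumes "\<beta> \<in> {- pi<..pi}"
  shows "\<exists>k::int. (billiard_map ^^ i) (\<beta>, \<psi>) = (\<beta> + real i * (pi - 2 * \<psi>) + 2 * pi * of_int k, \<psi>) \<and>
     \<beta> + real i * (pi - 2 * \<psi>) + 2 * pi * of_int k \<in> {- pi<..pi}"
proof (induction i)
  case 0
  then show ?case using assms by (intro exI[of _ 0]) auto
next
  case (Suc i)
  then obtain k where k: "(billiard_map ^^ i) (\<beta>, \<psi>) = (\<beta> + real i * (pi - 2 * \<psi>) + 2 * pi * of_int k, \<psi>)" by blast
  define y where "y = \<beta> + real i * (pi - 2 * \<psi>) + 2 * pi * of_int k + pi - 2 * \<psi>"
  obtain l where l: "wrap_angle y = y + 2 * pi * of_int l" using wrap_angle_range(2) by blast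
  have "(billiard_map ^^ Suc i) (\<beta>, \<psi>) = (wrap_angle y, \<psi>)" by (simp add: k y_def)
  moreover have "wrap_angle y = \<beta> + real (Suc i) * (pi - 2 * \<psi>) + 2 * pi * of_int (k + l)"
    unfolding l by (simp add: y_def algebra_simps)
  ultimately show ?case using wrap_angle_range(1)[of y] by (intro exI[of _ "k + l"]) auto
qed

lemma polygon_holes_iff_rotation_hits:
  assumes q: "q > 0" and \<beta>: "\<beta> \<in> {- pi<..pi}"
  shows "fst ((billiard_map ^^ i) (\<beta>, \<psi>)) \<in> polygon_holes q \<theta> \<Delta> \<longleftrightarrow>
     rotation_hits (real q * \<Delta> / (4 * pi)) (real q * (\<beta> - \<theta>) / (2 * pi)) (real q * (pi - 2 * \<psi>) / (2 * pi)) i"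
proof -
  obtain k where k: "(billiard_map ^^ i) (\<beta>, \<psi>) = (\<beta> + real i * (pi - 2 * \<psi>) + 2 * pi * of_int k, \<psi>)"
     "\<beta> + real i * (pi - 2 * \<psi>) + 2 * pi * of_int k \<in> {- pi<..pi}"
    using billiard_map_iterate[OF \<beta>] by blast
  define s where "s = \<beta> - \<theta> + real i * (pi - 2 * \<psi>)"
  have "fst ((billiard_map ^^ i) (\<beta>, \<psi>)) \<in> polygon_holes q \<theta> \<Delta> \<longleftrightarrow>
      (\<exists>j<q. \<exists>l::int. \<bar>s + 2 * pi * of_int k - 2 * pi * real j / real q - 2 * pi * of_int l\<bar> \<le> \<Delta> / 2)"
    using k by (auto simp: polygon_holes_def boundary_arc_def s_def algebra_simps)
  also have "\<dots> \<longleftrightarrow> (\<exists>m::int. \<bar>s - 2 * pi * of_int m / real q\<bar> \<le> \<Delta> / 2)"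
  proof
    assume "\<exists>j<q. \<exists>l::int. \<bar>s + 2 * pi * of_int k - 2 * pi * real j / real q - 2 * pi * of_int l\<bar> \<le> \<Delta> / 2"
    then obtain j and l :: int where jl: "\<bar>s + 2 * pi * of_int k - 2 * pi * real j / real q - 2 * pi * of_int l\<bar> \<le> \<Delta> / 2"
      by blast
    have "s - 2 * pi * of_int (int j + int q * (l - k)) / real q =
        s + 2 * pi * of_int k - 2 * pi * real j / real q - 2 * pi * of_int l"
      using q by (simp add: field_simps)
    then show "\<exists>m::int. \<bar>s - 2 * pi * of_int m / real q\<bar> \<le> \<Delta> / 2" using jl by metis
  next
    assume "\<exists>m::int. \<bar>s - 2 * pi * of_int m / real q\<bar> \<le> \<Delta> / 2"
    then obtain m :: int where m: "\<bar>s - 2 * pi * of_int m / real q\<bar> \<le> \<Delta> / 2" by blast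
    define M where "M = m + int q * k"
    define j where "j = nat (M mod int q)"
    have j: "j < q" "int j = M mod int q" using q by (auto simp: j_def nat_less_iff)
    define D where "D = M div int q"
    have "int q * D + int j = M" unfolding D_def j(2) by (rule mult_div_mod_eq)
    then have "m = int j + int q * D - int q * k" unfolding M_def by linarith
    then have eqm: "of_int m = real j + real q * of_int D - real q * of_int k" by simp
    have "s - 2 * pi * of_int m / real q = s + 2 * pi * of_int k - 2 * pi * real j / real q - 2 * pi * of_int (D)"
      unfolding eqm using q by (simp add: field_simps)
    then show "\<exists>j<q. \<exists>l::int. \<bar>s + 2 * pi * of_int k - 2 * pi * real j / real q - 2 * pi * of_int l\<bar> \<le> \<Delta> / 2"
      using m j(1) by metis
  qed
  also have "\<dots> \<longleftrightarrow> (\<exists>m::int. \<bar>real q * (\<beta> - \<theta>) / (2 * pi) + real i * (real q * (pi - 2 * \<psi>) / (2 * pi)) - of_int m\<bar>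
      \<le> real q * \<Delta> / (4 * pi))"
  proof -
    have "real q * (\<beta> - \<theta>) / (2 * pi) + real i * (real q * (pi - 2 * \<psi>) / (2 * pi)) - of_int m =
        real q / (2 * pi) * (s - 2 * pi * of_int m / real q)" for m :: int
      using q by (simp add: s_def field_simps)
    moreover have "\<bar>real q / (2 * pi) * y\<bar> \<le> real q * \<Delta> / (4 * pi) \<longleftrightarrow> \<bar>y\<bar> \<le> \<Delta> / 2" for y
      using q by (simp add: abs_mult field_simps)
    ultimately show ?thesis by simp
  qed
  finally show ?thesis by (simp add: rotation_hits_def)
qed

text \<open>If \<open>cos \<psi> = 0\<close>, every visit of the hole happens at time 0, and the equivalence still holds.\<close>
lemma escape_time_gt_iff:
  assumes "cos (snd x) \<ge> 0"
  shows "escape_time H x > ereal t \<longleftrightarrow>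
     (\<forall>i. 2 * cos (snd x) * real i \<le> t \<longrightarrow> fst ((billiard_map ^^ i) x) \<notin> H)"
proof (cases "\<exists>n. fst ((billiard_map ^^ n) x) \<in> H")
  case False
  then show ?thesis by (simp add: escape_time_def escape_count_def)
next
  case True
  define N where "N = (LEAST n. fst ((billiard_map ^^ n) x) \<in> H)"
  have N: "fst ((billiard_map ^^ N) x) \<in> H" unfolding N_def using True by (rule LeastI_ex)
  have le: "N \<le> i" if "fst ((billiard_map ^^ i) x) \<in> H" for i unfolding N_def using that by (rule Least_le)
  have e: "escape_time H x = ereal (2 * cos (snd x) * real N)"
    using True by (simp add: escape_time_def escape_count_def N_def)
  have mono: "2 * cos (snd x) * real N \<le> 2 * cos (snd x) * real i" if "N \<le> i" for i
    using that assms by (intro mult_left_mono) auto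
  show ?thesis
  proof
    assume gt: "escape_time H x > ereal t"
    show "\<forall>i. 2 * cos (snd x) * real i \<le> t \<longrightarrow> fst ((billiard_map ^^ i) x) \<notin> H"
    proof (intro allI impI notI)
      fix i assume i: "2 * cos (snd x) * real i \<le> t" "fst ((billiard_map ^^ i) x) \<in> H"
      show False using mono[OF le[OF i(2)]] i(1) gt unfolding e by simp
    qed
  next
    assume "\<forall>i. 2 * cos (snd x) * real i \<le> t \<longrightarrow> fst ((billiard_map ^^ i) x) \<notin> H"
    then have "\<not> 2 * cos (snd x) * real N \<le> t" using N by blast
    then show "escape_time H x > ereal t" unfolding e by simp
  qed
qed

lemma phase_space_cos: "(\<beta>, \<psi>) \<in> phase_space \<Longrightarrow> cos \<psi> \<ge> 0"
  by (auto simp: phase_space_def intro!: cos_ge_zero)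

lemma survival_set_eq:
  assumes q: "q > 0"
  shows "{x\<in>phase_space. escape_time (polygon_holes q \<theta> \<Delta>) x > ereal t} =
     {(\<beta>, \<psi>). (\<beta>, \<psi>) \<in> phase_space \<and> \<beta> \<in> surviving_angles q \<theta> (real q * \<Delta> / (4 * pi)) t \<psi>}"
proof -
  have "escape_time (polygon_holes q \<theta> \<Delta>) (\<beta>, \<psi>) > ereal t \<longleftrightarrow>
      \<beta> \<in> surviving_angles q \<theta> (real q * \<Delta> / (4 * pi)) t \<psi>" if "(\<beta>, \<psi>) \<in> phase_space" for \<beta> \<psi>
  proof -
    have \<beta>: "\<beta> \<in> {- pi<..pi}" using that by (simp add: phase_space_def)
    show ?thesis
      using escape_time_gt_iff[of "(\<beta>, \<psi>)"] phase_space_cos[OF that] \<beta>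
      by (simp add: surviving_angles_def polygon_holes_iff_rotation_hits[OF q \<beta>])
  qed
  then show ?thesis by auto
qed

text \<open>The contribution of the angle \<open>\<psi>\<close> to the survival probability.\<close>
definition survival_density :: "nat \<Rightarrow> real \<Rightarrow> real \<Rightarrow> real \<Rightarrow> real \<Rightarrow> real" where
  "survival_density q \<theta> \<epsilon> t \<psi> = (if \<psi> \<in> {- (pi / 2)..pi / 2}
     then cos \<psi> * measure lborel (surviving_angles q \<theta> \<epsilon> t \<psi>) / (4 * pi) else 0)"

lemma emeasure_survival:
  assumes q: "q > 0"
  shows "emeasure billiard_measure {x\<in>phase_space. escape_time (polygon_holes q \<theta> \<Delta>) x > ereal t} =
     (\<integral>\<^sup>+ \<psi>. ennreal (survival_density q \<theta> (real q * \<Delta> / (4 * pi)) t \<psi>) \<partial>lborel)"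
proof -
  define \<epsilon> where "\<epsilon> = real q * \<Delta> / (4 * pi)"
  define X where "X = {x. x \<in> phase_space \<and> (\<forall>i. 2 * cos (snd x) * real i \<le> t \<longrightarrow>
     \<not> rotation_hits \<epsilon> (real q * (fst x - \<theta>) / (2 * pi)) (real q * (pi - 2 * snd x) / (2 * pi)) i)}"
  have X: "{x\<in>phase_space. escape_time (polygon_holes q \<theta> \<Delta>) x > ereal t} = X"
    unfolding survival_set_eq[OF q] X_def \<epsilon>_def[symmetric] by (auto simp: surviving_angles_def phase_space_def)
  have ps [measurable]: "phase_space \<in> sets (borel \<Otimes>\<^sub>M borel)"
    unfolding phase_space_def by (intro pair_measureI) auto
  have Xm [measurable]: "X \<in> sets (borel \<Otimes>\<^sub>M borel)"
    unfolding X_def rotation_hits_def by measurable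
  have XM: "X \<in> sets (lborel :: (real \<times> real) measure)" using Xm unfolding borel_prod sets_lborel .
  have psM: "phase_space \<in> sets (lborel :: (real \<times> real) measure)" using ps unfolding borel_prod sets_lborel .
  have XR: "X \<in> sets (restrict_space lborel phase_space)"
    using XM by (auto simp: sets_restrict_space X_def intro!: image_eqI[of _ _ X])
  have fm: "(\<lambda>(\<beta>, \<psi>). ennreal (cos \<psi> / (4 * pi))) \<in> borel_measurable (lborel :: (real \<times> real) measure)"
  proof -
    have "(\<lambda>(\<beta>, \<psi>). ennreal (cos \<psi> / (4 * pi))) \<in> borel_measurable (borel \<Otimes>\<^sub>M borel :: (real \<times> real) measure)"
      by measurable
    then show ?thesis by (simp add: borel_prod)
  qed
  have "emeasure billiard_measure X =
      (\<integral>\<^sup>+x. (case x of (\<beta>, \<psi>) \<Rightarrow> ennreal (cos \<psi> / (4 * pi))) * indicator X x \<partial>restrict_space lborel phase_space)"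
    unfolding billiard_measure_def using fm XR
    by (intro emeasure_density measurable_restrict_space1)
  also have "\<dots> = (\<integral>\<^sup>+x. (case x of (\<beta>, \<psi>) \<Rightarrow> ennreal (cos \<psi> / (4 * pi))) * indicator X x * indicator phase_space x \<partial>lborel)"
    using psM by (intro nn_integral_restrict_space) simp
  also have "\<dots> = (\<integral>\<^sup>+x. (case x of (\<beta>, \<psi>) \<Rightarrow> ennreal (cos \<psi> / (4 * pi))) * indicator X x \<partial>(lborel \<Otimes>\<^sub>M lborel))"
    unfolding lborel_prod by (intro nn_integral_cong) (auto simp: X_def indicator_def)
  also have "\<dots> = (\<integral>\<^sup>+\<psi>. \<integral>\<^sup>+\<beta>. ennreal (cos \<psi> / (4 * pi)) * indicator X (\<beta>, \<psi>) \<partial>lborel \<partial>lborel)"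
    by (subst lborel_pair.nn_integral_snd[symmetric]) (simp_all, measurable)
  also have "\<dots> = (\<integral>\<^sup>+ \<psi>. ennreal (survival_density q \<theta> \<epsilon> t \<psi>) \<partial>lborel)"
  proof (rule nn_integral_cong)
    fix \<psi> :: real
    define S where "S = surviving_angles q \<theta> \<epsilon> t \<psi>"
    have S: "S \<in> sets borel" unfolding S_def by (rule sets_surviving_angles)
    show "(\<integral>\<^sup>+\<beta>. ennreal (cos \<psi> / (4 * pi)) * indicator X (\<beta>, \<psi>) \<partial>lborel) = ennreal (survival_density q \<theta> \<epsilon> t \<psi>)"
    proof (cases "\<psi> \<in> {- (pi / 2)..pi / 2}")
      case True
      then have "indicator X (\<beta>, \<psi>) = (indicator S \<beta> :: ennreal)" for \<beta>
        by (auto simp: X_def S_def indicator_def surviving_angles_def phase_space_def)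
      then have "(\<integral>\<^sup>+\<beta>. ennreal (cos \<psi> / (4 * pi)) * indicator X (\<beta>, \<psi>) \<partial>lborel) =
          ennreal (cos \<psi> / (4 * pi)) * emeasure lborel S"
        using S by (simp add: nn_integral_cmult)
      also have "emeasure lborel S = ennreal (measure lborel S)"
      proof -
        have "S \<inter> {- pi<..pi} = S" by (auto simp: S_def surviving_angles_def)
        then have "emeasure lborel S < \<infinity>" using emeasure_arc_finite[of S] by simp
        then show ?thesis by (intro emeasure_eq_ennreal_measure) auto
      qed
      also have "ennreal (cos \<psi> / (4 * pi)) * \<dots> = ennreal (cos \<psi> / (4 * pi) * measure lborel S)"
        using True by (intro ennreal_mult[symmetric]) (auto intro!: divide_nonneg_pos cos_ge_zero)
      finally show ?thesis using True by (simp add: survival_density_def S_def)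
    next
      case False
      then have "indicator X (\<beta>, \<psi>) = (0 :: ennreal)" for \<beta>
        by (auto simp: X_def indicator_def phase_space_def)
      moreover have "survival_density q \<theta> \<epsilon> t \<psi> = 0"
        using False by (simp only: survival_density_def if_False)
      ultimately show ?thesis by simp
    qed
  qed
  finally show ?thesis unfolding X \<epsilon>_def .
qed

section \<open>Sandwiching the survival density\<close>

text \<open>The cosine, continued by 0 outside the range of incidence angles, so that all integrals extend over the
  real line and the integrands stay continuous.\<close>
definition clamped_cos :: "real \<Rightarrow> real" where
  "clamped_cos \<psi> = cos (max (- (pi / 2)) (min \<psi> (pi / 2)))"

lemma clamped_cos_continuous: "continuous_on UNIV clamped_cos"
  unfolding clamped_cos_def by (intro continuous_intros)

lemma clamped_cos_bounds: "0 \<le> clamped_cos \<psi>" "clamped_cos \<psi> \<le> 1"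
proof -
  have "- (pi / 2) \<le> pi / 2" using pi_ge_zero by linarith
  then have "max (- (pi / 2)) (min \<psi> (pi / 2)) \<le> pi / 2" by (intro max.boundedI) auto
  then show "0 \<le> clamped_cos \<psi>" unfolding clamped_cos_def by (intro cos_ge_zero) auto
qed (simp add: clamped_cos_def)

lemma clamped_cos_eq: "\<psi> \<in> {- (pi / 2)..pi / 2} \<Longrightarrow> clamped_cos \<psi> = cos \<psi>"
  by (simp add: clamped_cos_def)

lemma clamped_cos_eq_0: "\<psi> \<notin> {- (pi / 2)..pi / 2} \<Longrightarrow> clamped_cos \<psi> = 0"
  by (auto simp: clamped_cos_def max_def min_def)

definition periodic_angle :: "nat \<Rightarrow> nat \<Rightarrow> nat \<Rightarrow> real" where
  "periodic_angle q b a = pi / 2 - pi * real a / real (q * b)"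

text \<open>The approximate survival density near the angle of the rotation \<open>a / b\<close>, without the factor \<open>b / 2\<close> and already
  multiplied by the cosine: with \<open>T = t / (2 cos \<psi>)\<close> the product \<open>cos \<psi> (g - T \<bar>\<eta>\<bar>)\<close> has no
  denominator, so grazing trajectories need no special treatment. The parameter \<open>\<kappa>\<close> is \<open>2 b\<close> in the upper bound and
  0 in the lower one.\<close>
definition tent :: "nat \<Rightarrow> real \<Rightarrow> real \<Rightarrow> real \<Rightarrow> nat \<Rightarrow> nat \<Rightarrow> real \<Rightarrow> real" where
  "tent q \<epsilon> \<kappa> t b a \<psi> = max 0 (clamped_cos \<psi> * (1 / real b - 2 * \<epsilon>) -
     (t / 2 - \<kappa> * clamped_cos \<psi>) * (real q / pi) * \<bar>\<psi> - periodic_angle q b a\<bar>)"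

lemma rotation_offset:
  assumes "q > 0" "b > 0"
  shows "\<bar>real q * (pi - 2 * \<psi>) / (2 * pi) - of_int (int a) / real b\<bar> = real q / pi * \<bar>\<psi> - periodic_angle q b a\<bar>"
proof -
  have "real q * (pi - 2 * \<psi>) / (2 * pi) - of_int (int a) / real b = real q / pi * - (\<psi> - periodic_angle q b a)"
    using assms by (simp add: periodic_angle_def field_simps)
  then show ?thesis by (simp only: abs_mult abs_minus_cancel) simp
qed

lemma max_mult_nonneg: "w \<ge> 0 \<Longrightarrow> w * max 0 x = max 0 (w * x)" for w x :: real
  by (simp add: max_mult_distrib_left)

lemma survival_density_upper:
  assumes q: "q > 0" and b: "b > 0" and ab: "coprime a b" and \<epsilon>: "\<epsilon> > 0"
    and small: "real b * \<bar>real q * (pi - 2 * \<psi>) / (2 * pi) - of_int (int a) / real b\<bar> \<le> 2 * \<epsilon>"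
    and t: "t \<ge> 2 * real b"
  shows "survival_density q \<theta> \<epsilon> t \<psi> \<le> real b / 2 * tent q \<epsilon> (2 * real b) t b a \<psi>"
proof (cases "\<psi> \<in> {- (pi / 2)..pi / 2} \<and> cos \<psi> \<noteq> 0")
  case True
  then have c: "cos \<psi> > 0" using cos_ge_zero[of \<psi>] by auto
  have t0: "t > 0" using t b by (auto intro: less_le_trans)
  define \<eta> where "\<eta> = real q * (pi - 2 * \<psi>) / (2 * pi) - of_int (int a) / real b"
  define g where "g = 1 / real b - 2 * \<epsilon>"
  have ab': "coprime (int a) (int b)" using ab by simp
  have "cos \<psi> * measure lborel (surviving_angles q \<theta> \<epsilon> t \<psi>) \<le>
      cos \<psi> * (2 * pi * max 0 (real b * (g - (t / (2 * cos \<psi>) - 2 * real b) * \<bar>\<eta>\<bar>)))"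
    unfolding g_def \<eta>_def using c
    by (intro mult_left_mono measure_survivors_le[OF q b \<epsilon> t0 c ab' small t]) auto
  also have "\<dots> = 2 * pi * (real b * max 0 (cos \<psi> * (g - (t / (2 * cos \<psi>) - 2 * real b) * \<bar>\<eta>\<bar>)))"
    using c b by (simp add: max_mult_nonneg mult_ac)
  also have "cos \<psi> * (g - (t / (2 * cos \<psi>) - 2 * real b) * \<bar>\<eta>\<bar>) = cos \<psi> * g - (t / 2 - 2 * real b * cos \<psi>) * \<bar>\<eta>\<bar>"
    using c by (simp add: field_simps)
  also have "max 0 \<dots> = tent q \<epsilon> (2 * real b) t b a \<psi>"
    using True unfolding tent_def g_def \<eta>_def rotation_offset[OF q b] by (simp add: clamped_cos_eq mult.assoc)
  finally have "cos \<psi> * measure lborel (surviving_angles q \<theta> \<epsilon> t \<psi>) / (4 * pi) \<le>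
      2 * pi * (real b * tent q \<epsilon> (2 * real b) t b a \<psi>) / (4 * pi)"
    by (intro divide_right_mono) auto
  then show ?thesis using True by (simp add: survival_density_def)
next
  case False
  have "survival_density q \<theta> \<epsilon> t \<psi> = 0"
    using False unfolding survival_density_def by auto
  then show ?thesis by (simp add: tent_def)
qed

lemma survival_density_nonneg: "survival_density q \<theta> \<epsilon> t \<psi> \<ge> 0"
  by (auto simp: survival_density_def intro!: divide_nonneg_pos mult_nonneg_nonneg cos_ge_zero)

lemma survival_density_lower:
  assumes q: "q > 0" and b: "b > 0" and \<epsilon>: "\<epsilon> > 0" and t: "t > 0"
  shows "real b / 2 * tent q \<epsilon> 0 t b a \<psi> \<le> survival_density q \<theta> \<epsilon> t \<psi>"
proof (cases "\<psi> \<in> {- (pi / 2)..pi / 2} \<and> cos \<psi> \<noteq> 0")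
  case True
  then have c: "cos \<psi> > 0" using cos_ge_zero[of \<psi>] by auto
  define \<eta> where "\<eta> = real q * (pi - 2 * \<psi>) / (2 * pi) - of_int (int a) / real b"
  define g where "g = 1 / real b - 2 * \<epsilon>"
  have "tent q \<epsilon> 0 t b a \<psi> = max 0 (cos \<psi> * g - (t / 2) * \<bar>\<eta>\<bar>)"
    using True unfolding tent_def g_def \<eta>_def rotation_offset[OF q b] by (simp add: clamped_cos_eq mult.assoc)
  also have "cos \<psi> * g - (t / 2) * \<bar>\<eta>\<bar> = cos \<psi> * (g - t / (2 * cos \<psi>) * \<bar>\<eta>\<bar>)"
    using c by (simp add: field_simps)
  finally have "2 * pi * (real b * tent q \<epsilon> 0 t b a \<psi>) =
      cos \<psi> * (2 * pi * max 0 (real b * (g - t / (2 * cos \<psi>) * \<bar>\<eta>\<bar>)))"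
    using c b by (simp add: max_mult_nonneg mult_ac)
  also have "\<dots> \<le> cos \<psi> * measure lborel (surviving_angles q \<theta> \<epsilon> t \<psi>)"
    unfolding g_def \<eta>_def using c
    by (intro mult_left_mono measure_survivors_ge[OF q b \<epsilon> t c]) auto
  finally have "2 * pi * (real b * tent q \<epsilon> 0 t b a \<psi>) / (4 * pi) \<le>
      cos \<psi> * measure lborel (surviving_angles q \<theta> \<epsilon> t \<psi>) / (4 * pi)"
    by (intro divide_right_mono) auto
  then show ?thesis using True by (simp add: survival_density_def)
next
  case False
  then have "clamped_cos \<psi> = 0"
    using clamped_cos_eq[of \<psi>] clamped_cos_eq_0[of \<psi>] by auto
  then have "tent q \<epsilon> 0 t b a \<psi> = 0" using t by (simp add: tent_def max_absorb1 mult_nonneg_nonneg)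
  then show ?thesis using survival_density_nonneg by simp
qed

definition rational_rotations :: "nat \<Rightarrow> nat \<Rightarrow> (nat \<times> nat) set" where
  "rational_rotations q Q = Sigma {1..Q} (\<lambda>b. {a. a \<le> q * b \<and> coprime a b})"

lemma finite_rational_rotations: "finite (rational_rotations q Q)"
  unfolding rational_rotations_def by (intro finite_SigmaI) auto

text \<open>By Dirichlet's theorem every rotation has an approximation \<open>a / b\<close> with \<open>b \<le> Q\<close> that satisfies
  \<open>b \<bar>\<eta>\<bar> < 1 / Q \<le> 2 \<epsilon>\<close>. Its tent alone dominates the density.\<close>
lemma survival_density_upper_sum:
  assumes q: "q > 0" and \<epsilon>: "\<epsilon> > 0" and Q: "Q > 0" "1 / real Q \<le> 2 * \<epsilon>" and t: "t \<ge> 2 * real Q"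
  shows "survival_density q \<theta> \<epsilon> t \<psi> \<le>
     (\<Sum>(b, a)\<in>rational_rotations q Q. real b / 2 * tent q \<epsilon> (2 * real b) t b a \<psi>)"
proof (cases "\<psi> \<in> {- (pi / 2)..pi / 2}")
  case True
  define \<rho> where "\<rho> = real q * (pi - 2 * \<psi>) / (2 * pi)"
  have \<rho>: "0 \<le> \<rho>" "\<rho> \<le> real q"
  proof -
    show "0 \<le> \<rho>" using True by (auto simp: \<rho>_def intro!: divide_nonneg_pos mult_nonneg_nonneg)
    have "(pi - 2 * \<psi>) / (2 * pi) \<le> 1" using True by (simp add: field_simps)
    then have "real q * ((pi - 2 * \<psi>) / (2 * pi)) \<le> real q * 1" by (intro mult_left_mono) auto
    then show "\<rho> \<le> real q" by (simp add: \<rho>_def)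
  qed
  obtain h k where hk: "coprime h k" "0 < k" "k \<le> int Q" "\<bar>of_int k * \<rho> - of_int h\<bar> < 1 / real Q"
    using Dirichlet_approx_coprime[OF Q(1), of \<rho>] by blast
  have Q1: "1 / real Q \<le> 1" using Q by simp
  have "real_of_int h > - 1"
  proof -
    have "0 \<le> of_int k * \<rho>" using hk(2) \<rho> by simp
    then show ?thesis using hk(4) Q1 by linarith
  qed
  then have h0: "h \<ge> 0" by linarith
  have "real_of_int h < of_int k * real q + 1"
  proof -
    have "of_int k * \<rho> \<le> of_int k * real q" using hk(2) \<rho> by (intro mult_left_mono) auto
    then show ?thesis using hk(4) Q1 by linarith
  qed
  then have "real_of_int h < of_int (k * int q + 1)" by simp
  then have hq: "h \<le> k * int q" by linarith
  define a b where "a = nat h" and "b = nat k"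
  have hb: "h = int a" "k = int b" using h0 hk(2) by (auto simp: a_def b_def)
  have b: "b > 0" "b \<le> Q" using hk(2,3) hb by auto
  have ab: "coprime a b" using hk(1) hb by simp
  have aq: "a \<le> q * b" using hq unfolding hb by (simp add: mult.commute flip: of_nat_mult)
  have mem: "(b, a) \<in> rational_rotations q Q" using b ab aq by (auto simp: rational_rotations_def)
  have "real b * \<bar>\<rho> - of_int (int a) / real b\<bar> = \<bar>real b * (\<rho> - of_int (int a) / real b)\<bar>"
    by (simp add: abs_mult)
  also have "real b * (\<rho> - of_int (int a) / real b) = of_int k * \<rho> - of_int h"
    using b by (simp add: hb right_diff_distrib)
  also have "\<bar>\<dots>\<bar> \<le> 2 * \<epsilon>" using hk(4) Q(2) by linarith
  finally have small: "real b * \<bar>real q * (pi - 2 * \<psi>) / (2 * pi) - of_int (int a) / real b\<bar> \<le> 2 * \<epsilon>"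
    unfolding \<rho>_def .
  have "t \<ge> 2 * real b" using t b by linarith
  then have "survival_density q \<theta> \<epsilon> t \<psi> \<le> real b / 2 * tent q \<epsilon> (2 * real b) t b a \<psi>"
    by (rule survival_density_upper[OF q b(1) ab \<epsilon> small])
  also have "\<dots> = (\<lambda>(b, a). real b / 2 * tent q \<epsilon> (2 * real b) t b a \<psi>) (b, a)" by simp
  also have "\<dots> \<le> (\<Sum>(b, a)\<in>rational_rotations q Q. real b / 2 * tent q \<epsilon> (2 * real b) t b a \<psi>)"
    using mem by (intro member_le_sum finite_rational_rotations) (auto simp: tent_def)
  finally show ?thesis .
next
  case False
  then have "survival_density q \<theta> \<epsilon> t \<psi> = 0" by (simp only: survival_density_def if_False)
  then show ?thesis by (auto simp: tent_def intro!: sum_nonneg)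
qed

text \<open>Each tent is a lower bound on its own. For large \<open>t\<close> their supports are disjoint, since they have width \<open>O(1 / t)\<close> and
  distinct fractions with denominators up to \<open>Q\<close> differ by at least \<open>1 / Q^2\<close>.\<close>
lemma survival_density_lower_sum:
  assumes q: "q > 0" and \<epsilon>: "\<epsilon> > 0" and Q: "Q > 0" and t: "t \<ge> 4 * real Q ^ 2"
  shows "(\<Sum>(b, a)\<in>rational_rotations q Q. real b / 2 * tent q \<epsilon> 0 t b a \<psi>) \<le> survival_density q \<theta> \<epsilon> t \<psi>"
proof -
  define f where "f = (\<lambda>(b, a). real b / 2 * tent q \<epsilon> 0 t b a \<psi>)"
  have "4 * real Q ^ 2 > 0" using Q by simp
  then have t0: "t > 0" using t by linarith
  define \<rho> where "\<rho> = real q * (pi - 2 * \<psi>) / (2 * pi)"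
  have close: "\<bar>\<rho> - real a / real b\<bar> < 2 / t" if ba: "(b, a) \<in> rational_rotations q Q" and nz: "f (b, a) \<noteq> 0" for a b
  proof -
    have b: "b > 0" using ba by (auto simp: rational_rotations_def)
    have "tent q \<epsilon> 0 t b a \<psi> \<noteq> 0" using nz by (auto simp: f_def)
    then have "clamped_cos \<psi> * (1 / real b - 2 * \<epsilon>) - t / 2 * (real q / pi) * \<bar>\<psi> - periodic_angle q b a\<bar> > 0"
      by (auto simp: tent_def max_def split: if_splits)
    moreover have "clamped_cos \<psi> * (1 / real b - 2 * \<epsilon>) \<le> 1"
    proof (cases "1 / real b - 2 * \<epsilon> \<ge> 0")
      case True
      have "1 / real b \<le> 1" using b by simp
      then have "clamped_cos \<psi> * (1 / real b - 2 * \<epsilon>) \<le> 1 * 1"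
        using True \<epsilon> clamped_cos_bounds[of \<psi>] by (intro mult_mono) auto
      then show ?thesis by simp
    next
      case False
      then have "clamped_cos \<psi> * (1 / real b - 2 * \<epsilon>) \<le> 0"
        using clamped_cos_bounds[of \<psi>] by (intro mult_nonneg_nonpos) auto
      then show ?thesis by simp
    qed
    ultimately have "t / 2 * (real q / pi * \<bar>\<psi> - periodic_angle q b a\<bar>) < 1" by (simp only: mult.assoc)
    then have "t / 2 * \<bar>\<rho> - real a / real b\<bar> < 1"
      using rotation_offset[OF q b, of \<psi> a] by (simp add: \<rho>_def)
    then show ?thesis using t0 by (simp add: field_simps)
  qed
  have uniq: "p = p'" if p: "p \<in> rational_rotations q Q" "f p \<noteq> 0" and p': "p' \<in> rational_rotations q Q" "f p' \<noteq> 0" for p p'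
  proof -
    obtain b a b' a' where pp: "p = (b, a)" "p' = (b', a')" by (cases p, cases p')
    have b: "0 < b" "b \<le> Q" "coprime a b" and b': "0 < b'" "b' \<le> Q" "coprime a' b'"
      using p p' by (auto simp: pp rational_rotations_def)
    have "\<bar>real a / real b - real a' / real b'\<bar> < 4 / t"
      using close[of b a] close[of b' a'] p p' unfolding pp by (auto simp: abs_if split: if_splits)
    also have "4 / t \<le> 1 / real Q ^ 2" using t Q t0 by (simp add: field_simps)
    finally have lt: "\<bar>real a / real b - real a' / real b'\<bar> < 1 / real Q ^ 2" .
    have "real a * real b' = real a' * real b"
    proof (rule ccontr)
      assume "real a * real b' \<noteq> real a' * real b"
      then have "int a * int b' - int a' * int b \<noteq> 0" by (simp flip: of_nat_mult)
      then have "1 \<le> \<bar>int a * int b' - int a' * int b\<bar>" by linarith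
      then have "(1 :: real) \<le> of_int \<bar>int a * int b' - int a' * int b\<bar>" by (simp only: of_int_1_le_iff)
      then have "1 \<le> \<bar>real a * real b' - real a' * real b\<bar>"
        by (simp only: of_int_abs of_int_diff of_int_mult of_int_of_nat_eq)
      moreover have "real a / real b - real a' / real b' = (real a * real b' - real a' * real b) / (real b * real b')"
        using b b' by (simp add: field_simps)
      ultimately have "1 / (real b * real b') \<le> \<bar>real a / real b - real a' / real b'\<bar>"
        using b b' by (simp add: abs_mult divide_right_mono)
      moreover have "real b * real b' \<le> real Q ^ 2"
        unfolding power2_eq_square using b b' by (intro mult_mono) auto
      then have "1 / real Q ^ 2 \<le> 1 / (real b * real b')" using b b' by (intro divide_left_mono) auto
      ultimately show False using lt by linarith
    qed
    then have eq: "a * b' = a' * b" by (simp flip: of_nat_mult)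
    have "b dvd a * b'" unfolding eq by simp
    moreover have "coprime b a" using b(3) by (simp only: coprime_commute)
    ultimately have "b dvd b'" by (simp only: coprime_dvd_mult_right_iff)
    moreover have "b' dvd a' * b" unfolding eq[symmetric] by simp
    moreover have "coprime b' a'" using b'(3) by (simp only: coprime_commute)
    ultimately have "b dvd b'" "b' dvd b" by (simp_all only: coprime_dvd_mult_right_iff)
    then have "b = b'" by (rule dvd_antisym)
    then show ?thesis using eq b by (simp add: pp)
  qed
  have "sum f (rational_rotations q Q) \<le> survival_density q \<theta> \<epsilon> t \<psi>"
  proof (cases "\<exists>p\<in>rational_rotations q Q. f p \<noteq> 0")
    case False
    then have "sum f (rational_rotations q Q) = 0" by (intro sum.neutral) auto
    then show ?thesis using survival_density_nonneg by simp
  next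
    case True
    then obtain b a where ba: "(b, a) \<in> rational_rotations q Q" "f (b, a) \<noteq> 0" by auto
    have "sum f (rational_rotations q Q) = sum f {(b, a)}"
    proof (rule sum.mono_neutral_right[OF finite_rational_rotations])
      show "{(b, a)} \<subseteq> rational_rotations q Q" using ba by simp
      show "\<forall>p\<in>rational_rotations q Q - {(b, a)}. f p = 0" using uniq[OF _ _ ba] by blast
    qed
    also have "\<dots> = real b / 2 * tent q \<epsilon> 0 t b a \<psi>" by (simp add: f_def)
    also have "\<dots> \<le> survival_density q \<theta> \<epsilon> t \<psi>"
      using ba by (intro survival_density_lower q \<epsilon> t0) (auto simp: rational_rotations_def)
    finally show ?thesis .
  qed
  then show ?thesis by (simp add: f_def)
qed

section \<open>Asymptotics of the survival probability\<close>

lemma hole_sum_eq_finite: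
  assumes Q: "Q > 0" and x: "x > 0" "1 / real Q \<le> x"
  shows "hole_sum q x = (\<Sum>b\<in>{1..Q}. hole_coeff q b * (max 0 (1 - real b * x))\<^sup>2)"
proof -
  have "hole_sum q x = (\<Sum>n<Q. hole_coeff q (Suc n) * (max 0 (1 - real (Suc n) * x))\<^sup>2)"
    unfolding hole_sum_def
  proof (rule suminf_finite)
    fix n assume "n \<notin> {..<Q}"
    then have "real Q \<le> real (Suc n)" by simp
    then have "real Q * x \<le> real (Suc n) * x" using x by (intro mult_right_mono) auto
    moreover have "1 \<le> real Q * x" using x Q by (simp add: field_simps)
    ultimately have "1 - real (Suc n) * x \<le> 0" by linarith
    then show "hole_coeff q (Suc n) * (max 0 (1 - real (Suc n) * x))\<^sup>2 = 0" by (simp add: max_absorb1)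
  qed simp
  also have "\<dots> = (\<Sum>b\<in>{1..Q}. hole_coeff q b * (max 0 (1 - real b * x))\<^sup>2)"
    by (rule sum.reindex_bij_witness[where i = "\<lambda>b. b - 1" and j = Suc]) auto
  finally show ?thesis .
qed

lemma periodic_tent_tendsto:
  assumes q: "q > 0" and \<kappa>: "\<kappa> \<ge> 0"
  shows "((\<lambda>t. t * (\<integral>\<psi>. tent q \<epsilon> \<kappa> t b a \<psi> \<partial>lborel)) \<longlongrightarrow>
     2 * (max 0 (clamped_cos (periodic_angle q b a) * (1 / real b - 2 * \<epsilon>)))\<^sup>2 / (real q / pi)) at_top"
  unfolding tent_def using q
  by (intro tent_family_limit clamped_cos_continuous clamped_cos_bounds \<kappa>) auto

lemma periodic_tent_integrable:
  assumes q: "q > 0" and \<kappa>: "\<kappa> \<ge> 0" and t: "t \<ge> 4 * \<kappa>" "t > 0"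
  shows "integrable lborel (tent q \<epsilon> \<kappa> t b a)"
  unfolding tent_def[abs_def] using q
  by (intro integrable_tent_family clamped_cos_continuous clamped_cos_bounds \<kappa> t) auto

text \<open>The fraction with \<open>a = q b\<close> belongs to a grazing angle and contributes nothing, so that \<open>sine_sum\<close>, which omits it,
  appears.\<close>
lemma sum_periodic_tent_limits:
  assumes q: "q > 0" and \<epsilon>: "\<epsilon> > 0" and Q: "Q > 0" "1 / real Q \<le> 2 * \<epsilon>"
  shows "(\<Sum>(b, a)\<in>rational_rotations q Q. real b / 2 *
      (2 * (max 0 (clamped_cos (periodic_angle q b a) * (1 / real b - 2 * \<epsilon>)))\<^sup>2 / (real q / pi))) =
      pi / 2 * hole_sum q (2 * \<epsilon>)"
proof -
  have "(\<Sum>(b, a)\<in>rational_rotations q Q. real b / 2 *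
      (2 * (max 0 (clamped_cos (periodic_angle q b a) * (1 / real b - 2 * \<epsilon>)))\<^sup>2 / (real q / pi))) =
     (\<Sum>(b, a)\<in>rational_rotations q Q. pi / real (q * b) * (max 0 (1 - real b * (2 * \<epsilon>)))\<^sup>2 * (sin (pi * real a / real (q * b)))\<^sup>2)"
  proof (rule sum.cong[OF refl], clarify)
    fix b a assume "(b, a) \<in> rational_rotations q Q"
    then have b: "b > 0" and a: "a \<le> q * b" by (auto simp: rational_rotations_def)
    have qb: "real (q * b) > 0" using q b by simp
    have r: "real a / real (q * b) \<le> 1" using a qb by (simp add: divide_le_eq_1 flip: of_nat_mult)
    have "pi * (real a / real (q * b)) \<le> pi * 1" by (intro mult_left_mono r) auto
    then have "periodic_angle q b a \<in> {- (pi / 2)..pi / 2}" by (simp add: periodic_angle_def)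
    then have "clamped_cos (periodic_angle q b a) = cos (pi / 2 - pi * real a / real (q * b))"
      by (simp add: clamped_cos_eq periodic_angle_def)
    also have "\<dots> = sin (pi * real a / real (q * b))" by (simp add: cos_diff)
    finally have c: "clamped_cos (periodic_angle q b a) = sin (pi * real a / real (q * b))" .
    have s: "sin (pi * real a / real (q * b)) \<ge> 0" using clamped_cos_bounds(1) c by metis
    have m: "max 0 (clamped_cos (periodic_angle q b a) * (1 / real b - 2 * \<epsilon>)) =
        sin (pi * real a / real (q * b)) * (1 / real b * max 0 (1 - real b * (2 * \<epsilon>)))"
    proof -
      have e: "1 / real b - 2 * \<epsilon> = 1 / real b * (1 - real b * (2 * \<epsilon>))" using b by (simp add: field_simps)
      have "max 0 (1 / real b - 2 * \<epsilon>) = 1 / real b * max 0 (1 - real b * (2 * \<epsilon>))"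
        unfolding e by (rule max_mult_nonneg[symmetric]) simp
      then show ?thesis unfolding c max_mult_nonneg[OF s, symmetric] by simp
    qed
    have "real b / 2 * (2 * (S * (1 / real b * M))\<^sup>2 / (real q / pi)) = pi / real (q * b) * M\<^sup>2 * S\<^sup>2" for S M
      using b q by (simp add: power2_eq_square field_simps)
    then show "real b / 2 * (2 * (max 0 (clamped_cos (periodic_angle q b a) * (1 / real b - 2 * \<epsilon>)))\<^sup>2 / (real q / pi)) =
       pi / real (q * b) * (max 0 (1 - real b * (2 * \<epsilon>)))\<^sup>2 * (sin (pi * real a / real (q * b)))\<^sup>2"
      unfolding m .
  qed
  also have "\<dots> = (\<Sum>b\<in>{1..Q}. \<Sum>a | a \<le> q * b \<and> coprime a b.
      pi / real (q * b) * (max 0 (1 - real b * (2 * \<epsilon>)))\<^sup>2 * (sin (pi * real a / real (q * b)))\<^sup>2)"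
    unfolding rational_rotations_def by (intro sum.Sigma[symmetric]) auto
  also have "\<dots> = (\<Sum>b\<in>{1..Q}. pi / 2 * (hole_coeff q b * (max 0 (1 - real b * (2 * \<epsilon>)))\<^sup>2))"
  proof (intro sum.cong refl)
    fix b assume "b \<in> {1..Q}"
    then have b: "b > 0" by auto
    have eq: "(\<Sum>a | a \<le> q * b \<and> coprime a b. (sin (pi * real a / real (q * b)))\<^sup>2) = sine_sum q b"
      unfolding sine_sum_def
    proof (rule sum.mono_neutral_right)
      show "\<forall>a\<in>{a. a \<le> q * b \<and> coprime a b} - {a. a < q * b \<and> coprime a b}. (sin (pi * real a / real (q * b)))\<^sup>2 = 0"
      proof
        fix a assume "a \<in> {a. a \<le> q * b \<and> coprime a b} - {a. a < q * b \<and> coprime a b}"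
        then have "a = q * b" by auto
        then have "pi * real a / real (q * b) = pi" using q b by simp
        then show "(sin (pi * real a / real (q * b)))\<^sup>2 = 0" by simp
      qed
    qed auto
    show "(\<Sum>a | a \<le> q * b \<and> coprime a b.
      pi / real (q * b) * (max 0 (1 - real b * (2 * \<epsilon>)))\<^sup>2 * (sin (pi * real a / real (q * b)))\<^sup>2) =
      pi / 2 * (hole_coeff q b * (max 0 (1 - real b * (2 * \<epsilon>)))\<^sup>2)"
      unfolding sum_distrib_left[symmetric] eq by (simp add: hole_coeff_def)
  qed
  also have "\<dots> = pi / 2 * hole_sum q (2 * \<epsilon>)"
    using \<epsilon> by (simp add: hole_sum_eq_finite[OF Q(1) _ Q(2)] sum_distrib_left)
  finally show ?thesis .
qed

text \<open>The survival probability lies between two finite sums of integrals of tents that have the same limit.\<close>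
theorem survival_prob_asymptotics:
  assumes q: "q > 0" and \<Delta>: "\<Delta> > 0"
  shows "((\<lambda>t. t * survival_prob (polygon_holes q \<theta> \<Delta>) t) \<longlongrightarrow> pi / 2 * hole_sum q (real q * \<Delta> / (2 * pi))) at_top"
proof -
  define \<epsilon> where "\<epsilon> = real q * \<Delta> / (4 * pi)"
  have \<epsilon>: "\<epsilon> > 0" using q \<Delta> by (simp add: \<epsilon>_def)
  (* Fractions with denominators above Q leave no gap between the translates of the hole. *)
  obtain Q :: nat where "1 / (2 * \<epsilon>) < real Q" using reals_Archimedean2 by blast
  moreover have "1 / (2 * \<epsilon>) > 0" using \<epsilon> by simp
  ultimately have Q0: "real Q > 0" "1 / (2 * \<epsilon>) < real Q" by linarith+
  then have Q: "Q > 0" "1 / real Q \<le> 2 * \<epsilon>" using \<epsilon> by (simp_all add: field_simps)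
  define R where "R = rational_rotations q Q"
  have R: "finite R" unfolding R_def by (rule finite_rational_rotations)
  define f where "f = (\<lambda>\<kappa> t (b, a) \<psi>. real b / 2 * tent q \<epsilon> (\<kappa> * real b) t b a \<psi>)"
  define I where "I = (\<lambda>\<kappa> t. \<Sum>p\<in>R. integral\<^sup>L lborel (f \<kappa> t p))"
  have lim: "((\<lambda>t. t * I \<kappa> t) \<longlongrightarrow> pi / 2 * hole_sum q (2 * \<epsilon>)) at_top" if \<kappa>: "\<kappa> \<ge> 0" for \<kappa>
  proof -
    have "((\<lambda>t. \<Sum>(b, a)\<in>R. real b / 2 * (t * (\<integral>\<psi>. tent q \<epsilon> (\<kappa> * real b) t b a \<psi> \<partial>lborel))) \<longlongrightarrow>
        (\<Sum>(b, a)\<in>R. real b / 2 * (2 * (max 0 (clamped_cos (periodic_angle q b a) * (1 / real b - 2 * \<epsilon>)))\<^sup>2 / (real q / pi)))) at_top"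
      unfolding case_prod_unfold using \<kappa> by (intro tendsto_sum tendsto_mult_left periodic_tent_tendsto q) simp
    moreover have "t * I \<kappa> t = (\<Sum>(b, a)\<in>R. real b / 2 * (t * (\<integral>\<psi>. tent q \<epsilon> (\<kappa> * real b) t b a \<psi> \<partial>lborel)))" for t
      unfolding I_def f_def sum_distrib_left by (intro sum.cong refl) auto
    ultimately show ?thesis unfolding R_def sum_periodic_tent_limits[OF q \<epsilon> Q] by simp
  qed
  have int: "integrable lborel (f \<kappa> t p)" if p: "p \<in> R" and \<kappa>: "0 \<le> \<kappa>" "\<kappa> \<le> 2" and t: "t \<ge> 8 * real Q" "t > 0" for \<kappa> t p
  proof -
    obtain b a where ba: "p = (b, a)" by (cases p)
    have "b \<le> Q" using p by (auto simp: ba R_def rational_rotations_def)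
    then have "\<kappa> * real b \<le> 2 * real Q" using \<kappa> by (intro mult_mono) auto
    then have "integrable lborel (tent q \<epsilon> (\<kappa> * real b) t b a)"
      using t \<kappa> by (intro periodic_tent_integrable q) auto
    then show ?thesis by (auto simp: f_def ba)
  qed
  have nn: "(\<integral>\<^sup>+\<psi>. ennreal (\<Sum>p\<in>R. f \<kappa> t p \<psi>) \<partial>lborel) = ennreal (I \<kappa> t)"
    if \<kappa>: "0 \<le> \<kappa>" "\<kappa> \<le> 2" and t: "t \<ge> 8 * real Q" "t > 0" for \<kappa> t
  proof -
    have "(\<integral>\<^sup>+\<psi>. ennreal (\<Sum>p\<in>R. f \<kappa> t p \<psi>) \<partial>lborel) = ennreal (\<integral>\<psi>. (\<Sum>p\<in>R. f \<kappa> t p \<psi>) \<partial>lborel)"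
      by (intro nn_integral_eq_integral Bochner_Integration.integrable_sum int that AE_I2 sum_nonneg)
         (auto simp: f_def tent_def)
    also have "(\<integral>\<psi>. (\<Sum>p\<in>R. f \<kappa> t p \<psi>) \<partial>lborel) = I \<kappa> t"
      unfolding I_def by (intro Bochner_Integration.integral_sum int that)
    finally show ?thesis .
  qed
  have I0: "I \<kappa> t \<ge> 0" for \<kappa> t
    unfolding I_def by (intro sum_nonneg Bochner_Integration.integral_nonneg) (auto simp: f_def tent_def)
  have ev: "\<forall>\<^sub>F t in at_top. t * I 0 t \<le> t * survival_prob (polygon_holes q \<theta> \<Delta>) t \<and>
      t * survival_prob (polygon_holes q \<theta> \<Delta>) t \<le> t * I 2 t"
    using eventually_ge_at_top[of "8 * real Q"] eventually_ge_at_top[of "4 * real Q ^ 2"] eventually_gt_at_top[of 0]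
  proof eventually_elim
    case (elim t)
    define E where "E = emeasure billiard_measure {x\<in>phase_space. escape_time (polygon_holes q \<theta> \<Delta>) x > ereal t}"
    have E: "E = (\<integral>\<^sup>+ \<psi>. ennreal (survival_density q \<theta> \<epsilon> t \<psi>) \<partial>lborel)"
      unfolding E_def \<epsilon>_def by (rule emeasure_survival[OF q])
    have P: "survival_prob (polygon_holes q \<theta> \<Delta>) t = enn2real E"
      by (simp add: survival_prob_def measure_def E_def)
    have "E \<le> (\<integral>\<^sup>+\<psi>. ennreal (\<Sum>p\<in>R. f 2 t p \<psi>) \<partial>lborel)"
      unfolding E
    proof (intro nn_integral_mono ennreal_leI)
      fix \<psi>
      have "survival_density q \<theta> \<epsilon> t \<psi> \<le> (\<Sum>(b, a)\<in>R. real b / 2 * tent q \<epsilon> (2 * real b) t b a \<psi>)"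
        unfolding R_def using elim by (intro survival_density_upper_sum q \<epsilon> Q) auto
      then show "survival_density q \<theta> \<epsilon> t \<psi> \<le> (\<Sum>p\<in>R. f 2 t p \<psi>)"
        by (simp add: f_def case_prod_unfold)
    qed
    also have "\<dots> = ennreal (I 2 t)" using elim by (intro nn) auto
    finally have up: "E \<le> ennreal (I 2 t)" .
    have "ennreal (I 0 t) = (\<integral>\<^sup>+\<psi>. ennreal (\<Sum>p\<in>R. f 0 t p \<psi>) \<partial>lborel)" using elim by (intro nn[symmetric]) auto
    also have "\<dots> \<le> E"
      unfolding E
    proof (intro nn_integral_mono ennreal_leI)
      fix \<psi>
      have "(\<Sum>(b, a)\<in>R. real b / 2 * tent q \<epsilon> 0 t b a \<psi>) \<le> survival_density q \<theta> \<epsilon> t \<psi>"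
        unfolding R_def using elim by (intro survival_density_lower_sum q \<epsilon> Q) auto
      then show "(\<Sum>p\<in>R. f 0 t p \<psi>) \<le> survival_density q \<theta> \<epsilon> t \<psi>"
        by (simp add: f_def case_prod_unfold)
    qed
    finally have low: "ennreal (I 0 t) \<le> E" .
    have "enn2real E \<le> I 2 t" using up I0 by (intro enn2real_leI)
    moreover have "I 0 t \<le> enn2real E"
    proof -
      have "E < top" using up by (rule le_less_trans) simp
      then have "enn2real (ennreal (I 0 t)) \<le> enn2real E" using low by (intro enn2real_mono)
      then show ?thesis using I0 by simp
    qed
    ultimately show ?case unfolding P using elim by (simp add: mult_left_mono)
  qed
  have "2 * \<epsilon> = real q * \<Delta> / (2 * pi)" by (simp add: \<epsilon>_def)
  then show ?thesis
    using tendsto_sandwich[OF _ _ lim[of 0] lim[of 2], of "\<lambda>t. t * survival_prob (polygon_holes q \<theta> \<Delta>) t"]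
      eventually_mono[OF ev conjunct1] eventually_mono[OF ev conjunct2] by simp
qed

lemma boundary_arc_eq_polygon_holes: "boundary_arc \<theta> \<Delta> = polygon_holes 1 \<theta> \<Delta>"
  by (auto simp: polygon_holes_def)

theorem theorem5:
  fixes q :: nat and \<alpha> \<theta> \<theta>\<^sub>1 :: real
  assumes "q \<ge> 2" and "riemann_hypothesis" and "\<alpha> > 0"
  shows "\<exists>L :: real \<Rightarrow> real.
           (\<forall>\<^sub>F \<Delta> in at_right 0.
              ((\<lambda>t. \<Delta> powr (\<alpha> - 1 / 2) * t *
                  (survival_prob (boundary_arc \<theta>\<^sub>1 \<Delta>) t
                   - real q * survival_prob (polygon_holes q \<theta> \<Delta>) t))
                 \<longlongrightarrow> L \<Delta>) at_top) \<and>
           (L \<longlongrightarrow> 0) (at_right 0)"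
proof -
  define \<delta> where "\<delta> = min (\<alpha> / 2) (1 / 4)"
  have \<delta>: "0 < \<delta>" "\<delta> < 1 / 2" "\<delta> < \<alpha>" using assms(3) by (auto simp: \<delta>_def)
  obtain C where C: "\<And>x. 0 < x \<Longrightarrow> x \<le> 1 \<Longrightarrow>
      \<bar>hole_sum 1 x - real q * hole_sum q (real q * x)\<bar> \<le> C * x powr (1 / 2 - \<delta>)"
    using hole_sum_difference_bound[OF assms(2,1) \<delta>(1,2)] by auto
  define D where "D = (\<lambda>\<Delta>. hole_sum 1 (\<Delta> / (2 * pi)) - real q * hole_sum q (real q * (\<Delta> / (2 * pi))))"
  define L where "L = (\<lambda>\<Delta>. \<Delta> powr (\<alpha> - 1 / 2) * (pi / 2 * D \<Delta>))"
  show ?thesis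
  proof (intro exI[of _ L] conjI)
    show "\<forall>\<^sub>F \<Delta> in at_right 0. ((\<lambda>t. \<Delta> powr (\<alpha> - 1 / 2) * t *
        (survival_prob (boundary_arc \<theta>\<^sub>1 \<Delta>) t - real q * survival_prob (polygon_holes q \<theta> \<Delta>) t)) \<longlongrightarrow> L \<Delta>) at_top"
      using eventually_at_right_less[of 0]
    proof eventually_elim
      case (elim \<Delta>)
      have "((\<lambda>t. \<Delta> powr (\<alpha> - 1 / 2) * (t * survival_prob (polygon_holes 1 \<theta>\<^sub>1 \<Delta>) t -
          real q * (t * survival_prob (polygon_holes q \<theta> \<Delta>) t))) \<longlongrightarrow>
          \<Delta> powr (\<alpha> - 1 / 2) * (pi / 2 * hole_sum 1 (real 1 * \<Delta> / (2 * pi)) - real q * (pi / 2 * hole_sum q (real q * \<Delta> / (2 * pi))))) at_top"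
        using assms(1) elim by (intro tendsto_intros survival_prob_asymptotics) auto
      then show ?case
        by (simp add: boundary_arc_eq_polygon_holes L_def D_def algebra_simps)
    qed
    show "(L \<longlongrightarrow> 0) (at_right 0)"
    proof (rule Lim_null_comparison)
      show "\<forall>\<^sub>F \<Delta> in at_right 0. norm (L \<Delta>) \<le> (pi / 2 * \<bar>C\<bar>) * \<Delta> powr (\<alpha> - \<delta>)"
        using eventually_at_right_real[of 0 1, OF zero_less_one]
      proof eventually_elim
        case (elim \<Delta>)
        define x where "x = \<Delta> / (2 * pi)"
        have x: "0 < x" "x \<le> \<Delta>" using elim pi_gt3 by (auto simp: x_def field_simps)
        (* The gain \<alpha> - \<delta> in the exponent is positive by the choice of \<delta>. *)
        have "\<bar>D \<Delta>\<bar> \<le> C * x powr (1 / 2 - \<delta>)" unfolding D_def x_def[symmetric] using x elim by (intro C) auto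
        also have "\<dots> \<le> \<bar>C\<bar> * \<Delta> powr (1 / 2 - \<delta>)" using x \<delta> by (intro mult_mono powr_mono2) auto
        finally have "norm (L \<Delta>) \<le> \<Delta> powr (\<alpha> - 1 / 2) * (pi / 2 * (\<bar>C\<bar> * \<Delta> powr (1 / 2 - \<delta>)))"
          unfolding L_def by (simp add: abs_mult mult_left_mono)
        also have "\<dots> = (pi / 2 * \<bar>C\<bar>) * (\<Delta> powr (\<alpha> - 1 / 2) * \<Delta> powr (1 / 2 - \<delta>))" by simp
        also have "\<Delta> powr (\<alpha> - 1 / 2) * \<Delta> powr (1 / 2 - \<delta>) = \<Delta> powr (\<alpha> - \<delta>)" by (simp flip: powr_add)
        finally show ?case .
      qed
      have "((\<lambda>\<Delta>. \<Delta> powr (\<alpha> - \<delta>)) \<longlongrightarrow> 0) (at_right 0)"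
        using \<delta> by real_asymp
      then show "((\<lambda>\<Delta>. (pi / 2 * \<bar>C\<bar>) * \<Delta> powr (\<alpha> - \<delta>)) \<longlongrightarrow> 0) (at_right 0)"
        by (rule tendsto_mult_right_zero)
    qed
  qed
qed

end
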